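(* Let $K$ and $L$ be simplicial complexes on disjoint vertex sets. Then $$\Delta(K\dot{\cup}L)=\Delta(\Delta(K)\dot{\cup}\Delta(L)).$$
   Context: Simplicial complexes are finite and contain the empty set. For a complex $K$, $K_0$ denotes its vertex set. $[n]=\{1,\dots,n\}$. $\dot\cup$ denotes the disjoint union of complexes; in $\Delta(K)\dot\cup\Delta(L)$ the vertex sets of the two shifted complexes are regarded as disjoint sets (relabel one of them). Lexicographic order: for sets $S\ne T$ of positive integers of equal size, $S<_L T$ iff $\min(S\triangle T)\in S$. Algebraic shifting (exterior): let $K$ be a simplicial complex with vertex set contained in $[n]$ (label the vertices by positive integers if necessary). Let $V$ be a real vector space with basis $e_1,\dots,e_n$, and let $f_i=\sum_{j=1}^n\alpha_{ij}e_j$, $1\le i\le n$, where the $n^2$ real numbers $\alpha_{ij}$ are algebraically independent over $\mathbb{Q}$. For $S=\{s_1<\dots<s_k\}\subseteq[n]$ put $e_S=e_{s_1}\wedge\dots\wedge e_{s_k}$, $f_S=f_{s_1}\wedge\dots\wedge f_{s_k}$ in $\bigwedge V$, and let $\tilde f_S$ be the image of $f_S$ in $(\bigwedge V)/(e_T: T\subseteq[n],\,T\notin K)$. Then $$\Delta(K)=\{S\subseteq[n]:\ \tilde f_S\notin \mathrm{span}\{\tilde f_{S'}: |S'|=|S|,\ S'<_L S\}\}.$$ $\Delta(K)$ does not depend on the choice of the generic matrix, of $n$, or of the vertex labelling; it is a simplicial complex with vertex set $\{1,\dots,|K_0|\}$. *)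

theory Defs
  imports "HOL-Analysis.Finite_Function_Topology"
begin

section \<open>Simplicial complexes\<close>

definition abstract_complex :: "'a set set \<Rightarrow> bool" where
  "abstract_complex K \<longleftrightarrow>
     finite K \<and> {} \<in> K \<and> (\<forall>S\<in>K. finite S \<and> (\<forall>T. T \<subseteq> S \<longrightarrow> T \<in> K))"

definition vertex_set :: "'a set set \<Rightarrow> 'a set" where
  "vertex_set K = {v. {v} \<in> K}"

definition relabel :: "('a \<Rightarrow> 'b) \<Rightarrow> 'a set set \<Rightarrow> 'b set set" where
  "relabel \<phi> K = (\<lambda>S. \<phi> ` S) ` K"

text \<open>Disjoint union of complexes whose vertex sets need not be disjoint: the vertices are
  first made distinct by relabelling them into a sum type.\<close>

definition disjoint_union :: "'a set set \<Rightarrow> 'b set set \<Rightarrow> ('a + 'b) set set"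
    (infixl \<open>\<uplus>\<close> 65) where
  "K \<uplus> L = relabel Inl K \<union> relabel Inr L"

section \<open>Lexicographic order\<close>

definition lex_less :: "nat set \<Rightarrow> nat set \<Rightarrow> bool" where
  "lex_less S T \<longleftrightarrow> S \<noteq> T \<and> Min ((S - T) \<union> (T - S)) \<in> S"

section \<open>Algebraic independence over the rationals\<close>

text \<open>A polynomial with rational coefficients in variables indexed by \<open>'i\<close> is a finitely
  supported map from exponent vectors to coefficients.\<close>

type_synonym 'i rat_mpoly = "('i \<Rightarrow>\<^sub>0 nat) \<Rightarrow>\<^sub>0 rat"

definition mpoly_eval :: "'i rat_mpoly \<Rightarrow> ('i \<Rightarrow> real) \<Rightarrow> real" where
  "mpoly_eval p x =
     (\<Sum>m\<in>Poly_Mapping.keys p. of_rat (Poly_Mapping.lookup p m) *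
        (\<Prod>i\<in>Poly_Mapping.keys m. x i ^ Poly_Mapping.lookup m i))"

definition algebraically_independent :: "'i set \<Rightarrow> ('i \<Rightarrow> real) \<Rightarrow> bool" where
  "algebraically_independent I x \<longleftrightarrow>
     (\<forall>p :: 'i rat_mpoly. (\<forall>m\<in>Poly_Mapping.keys p. Poly_Mapping.keys m \<subseteq> I) \<longrightarrow>
        mpoly_eval p x = 0 \<longrightarrow> p = 0)"

section \<open>Exterior algebra\<close>

text \<open>The exterior algebra of a real vector space with basis \<open>e\<^sub>1, e\<^sub>2, \<dots>\<close> is modelled by
  coordinates with respect to the basis \<open>e\<^sub>S\<close>, for finite sets \<open>S\<close>. The subalgebra belonging to
  the span \<open>V\<close> of \<open>e\<^sub>1, \<dots>, e\<^sub>n\<close> is \<open>ext_algebra n\<close>.\<close>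

type_synonym ext = "nat set \<Rightarrow>\<^sub>0 real"

definition e_basis :: "nat set \<Rightarrow> ext" where
  "e_basis S = Poly_Mapping.single S 1"

definition ext_algebra :: "nat \<Rightarrow> ext set" where
  "ext_algebra n = span (e_basis ` Pow {1..n})"

text \<open>The product \<open>e\<^sub>S \<and> e\<^sub>T\<close> is \<open>0\<close> if \<open>S\<close> and \<open>T\<close> meet; otherwise sorting the concatenation
  of the increasing sequences of \<open>S\<close> and \<open>T\<close> gives the sign \<open>-1\<close> to the number of inversions.\<close>

definition e_wedge :: "nat set \<Rightarrow> nat set \<Rightarrow> ext" where
  "e_wedge S T =
     (if S \<inter> T = {} then (- 1) ^ card {(s, t). s \<in> S \<and> t \<in> T \<and> t < s} *\<^sub>R e_basis (S \<union> T)
      else 0)"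

definition wedge :: "ext \<Rightarrow> ext \<Rightarrow> ext" where
  "wedge x y =
     (\<Sum>S\<in>Poly_Mapping.keys x. \<Sum>T\<in>Poly_Mapping.keys y.
        (Poly_Mapping.lookup x S * Poly_Mapping.lookup y T) *\<^sub>R e_wedge S T)"

text \<open>\<open>ext_prod f S\<close> is the product of the \<open>f s\<close>, for \<open>s \<in> S\<close>, in increasing order of \<open>s\<close>;
  the unit of the exterior algebra is \<open>e_basis {}\<close>.\<close>

definition ext_prod :: "(nat \<Rightarrow> ext) \<Rightarrow> nat set \<Rightarrow> ext" where
  "ext_prod f S = foldr (\<lambda>s x. wedge (f s) x) (sorted_list_of_set S) (e_basis {})"

text \<open>The two-sided ideal of \<open>ext_algebra n\<close> generated by the \<open>e\<^sub>T\<close> with \<open>T \<notin> K\<close>, and the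
  image of an element in the quotient, represented as a coset.\<close>

definition nonface_ideal :: "nat \<Rightarrow> nat set set \<Rightarrow> ext set" where
  "nonface_ideal n K =
     span {wedge (wedge x (e_basis T)) y | x T y.
       x \<in> ext_algebra n \<and> y \<in> ext_algebra n \<and> T \<subseteq> {1..n} \<and> T \<notin> K}"

definition quotient_image :: "nat \<Rightarrow> nat set set \<Rightarrow> ext \<Rightarrow> ext set" where
  "quotient_image n K x = {y \<in> ext_algebra n. y - x \<in> nonface_ideal n K}"

section \<open>Exterior algebraic shifting\<close>

definition generic_vector :: "nat \<Rightarrow> (nat \<times> nat \<Rightarrow> real) \<Rightarrow> nat \<Rightarrow> ext" where
  "generic_vector n \<alpha> i = (\<Sum>j=1..n. \<alpha> (i, j) *\<^sub>R e_basis {j})"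

text \<open>The shifting of a complex \<open>K\<close> with vertices in \<open>{1..n}\<close>, computed with the matrix \<open>\<alpha>\<close>.
  The span of the cosets of the \<open>f\<^sub>R\<close> in the quotient space consists of the
  cosets of the elements of the span of the \<open>f\<^sub>R\<close>.\<close>

definition shifting_wrt :: "nat \<Rightarrow> (nat \<times> nat \<Rightarrow> real) \<Rightarrow> nat set set \<Rightarrow> nat set set" where
  "shifting_wrt n \<alpha> K =
     {S. S \<subseteq> {1..n} \<and>
         quotient_image n K (ext_prod (generic_vector n \<alpha>) S) \<notin>
           quotient_image n K `
             span {ext_prod (generic_vector n \<alpha>) R | R.
                     R \<subseteq> {1..n} \<and> card R = card S \<and> lex_less R S}}"

definition is_shifting :: "'a set set \<Rightarrow> nat set set \<Rightarrow> bool" where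
  "is_shifting K D \<longleftrightarrow>
     (\<exists>n \<phi> \<alpha>. inj_on \<phi> (vertex_set K) \<and> \<phi> ` vertex_set K \<subseteq> {1..n} \<and>
        algebraically_independent ({1..n} \<times> {1..n}) \<alpha> \<and>
        D = shifting_wrt n \<alpha> (relabel \<phi> K))"

text \<open>The result depends neither on \<open>n\<close>, nor on the labelling \<open>\<phi>\<close>, nor on the generic
  matrix \<open>\<alpha>\<close>, so a choice of these data is made separately for each complex.\<close>

definition algebraic_shifting :: "'a set set \<Rightarrow> nat set set" (\<open>\<Delta>\<close>) where
  "\<Delta> K = (SOME D. is_shifting K D)"

end

theory Submission
  imports Defs "HOL-Library.Multiset"
begin

text \<open>By duality, \<open>S\<close> belongs to \<open>\<Delta> K\<close> iff some form \<open>x\<close> on \<open>K\<close> satisfies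
  \<open>\<langle>f\<^sub>R, x\<rangle> = 0\<close> for all \<open>R <\<^sub>L S\<close> and \<open>\<langle>f\<^sub>S, x\<rangle> \<noteq> 0\<close>. Fix a set \<open>P\<close> with maximum \<open>p\<close>. The conditions
  coming from the \<open>R\<close> that precede every \<open>P \<union> {r}\<close>, \<open>r > p\<close>, say that certain contractions of \<open>x\<close> of
  positive degree vanish; contracting the remaining \<open>x\<close> with \<open>f\<^sub>P\<close> gives a space \<open>U\<^sub>P(K)\<close> of vectors
  on the vertices. As the rows of a generic matrix cut down \<open>U\<^sub>P(K)\<close> one dimension at a time,
  \<open>P \<union> {r} \<in> \<Delta> K\<close> iff \<open>p < r \<le> p + dim U\<^sub>P(K)\<close>. Forms of positive degree on a disjoint union split,
  so \<open>dim U\<^sub>P(K \<union> L) = dim U\<^sub>P(K) + dim U\<^sub>P(L)\<close>, and \<open>\<Delta> (K \<union> L)\<close> is determined by \<open>\<Delta> K\<close>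
  and \<open>\<Delta> L\<close>. The corollary follows from \<open>\<Delta> (\<Delta> K) = \<Delta> K\<close>: the shifting of \<open>K\<close> is
  closed under replacing a vertex by a smaller one, and triangular row and column operations show
  that such complexes are fixed by \<open>\<Delta>\<close>.\<close>

section \<open>Generic points\<close>

text \<open>Algebraic independence over the rationals speaks only about polynomials, while a form
  that witnesses \<open>S \<in> \<Delta> K\<close> is an arbitrary real solution of linear equations
  depending on the matrix. The obstacle is removed by solving these equations inside the ring of
  polynomials in the matrix entries (\<open>polynomial_form_exists\<close>): the solution may then
  be specialised to other matrices. Such a solution involves only the rows of its equations, so the
  next row is independent of it; this is why each generic row lowers the dimension by exactly one
  until it is zero. Positive degree matters because the components of a disjoint union share the
  empty face and no other. The numbers \<open>dim U\<^sub>P\<close> return to combinatorics as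
  numbers of one-point extensions of \<open>P\<close>, so the formula for a union contains only the
  two shiftings. Since \<open>\<Delta>\<close> makes its choices separately for each complex, the
  three shiftings are first computed with one common matrix whose columns are the vertices
  themselves; independence of all choices is proved for this purpose.\<close>

inductive_set polyfun :: "'i set \<Rightarrow> (('i \<Rightarrow> real) \<Rightarrow> real) set" for J where
  const: "(\<lambda>_. of_rat c) \<in> polyfun J"
| var: "i \<in> J \<Longrightarrow> (\<lambda>x. x i) \<in> polyfun J"
| add: "f \<in> polyfun J \<Longrightarrow> g \<in> polyfun J \<Longrightarrow> (\<lambda>x. f x + g x) \<in> polyfun J"
| mult: "f \<in> polyfun J \<Longrightarrow> g \<in> polyfun J \<Longrightarrow> (\<lambda>x. f x * g x) \<in> polyfun J"

lemma polyfun_zero: "(\<lambda>_. 0) \<in> polyfun J"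
  using polyfun.const[of 0] by simp

lemma polyfun_one: "(\<lambda>_. 1) \<in> polyfun J"
  using polyfun.const[of 1] by simp

lemma polyfun_uminus: "f \<in> polyfun J \<Longrightarrow> (\<lambda>x. - f x) \<in> polyfun J"
  using polyfun.mult[OF polyfun.const[of "-1"]] by (simp add: of_rat_minus)

lemma polyfun_sum: "(\<And>t. t \<in> T \<Longrightarrow> f t \<in> polyfun J) \<Longrightarrow> (\<lambda>x. \<Sum>t\<in>T. f t x) \<in> polyfun J"
  by (induction T rule: infinite_finite_induct) (auto intro: polyfun_zero polyfun.add)

lemma polyfun_mono: "f \<in> polyfun J \<Longrightarrow> J \<subseteq> J' \<Longrightarrow> f \<in> polyfun J'"
  by (induction rule: polyfun.induct) (auto intro: polyfun.intros)

lemma polyfun_cong: "f \<in> polyfun J \<Longrightarrow> (\<And>i. i \<in> J \<Longrightarrow> x i = y i) \<Longrightarrow> f x = f y"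
  by (induction rule: polyfun.induct) auto

lemma polyfun_reindex: "f \<in> polyfun J \<Longrightarrow> (\<lambda>x. f (x \<circ> h)) \<in> polyfun (h ` J)"
  by (induction rule: polyfun.induct) (auto intro: polyfun.intros)

text \<open>Algebraic independence, restated for functions: a rational polynomial identity that
  holds at \<open>a\<close> holds at every point, and may therefore be specialised to a matrix of
  choice.\<close>

definition generic :: "'i set \<Rightarrow> ('i \<Rightarrow> real) \<Rightarrow> bool" where
  "generic J a \<longleftrightarrow> (\<forall>f\<in>polyfun J. f a = 0 \<longrightarrow> (\<forall>b. f b = 0))"

lemma genericD: "generic J a \<Longrightarrow> f \<in> polyfun J \<Longrightarrow> f a = 0 \<Longrightarrow> f b = 0"
  by (auto simp: generic_def)

lemma generic_mono: "generic J a \<Longrightarrow> J' \<subseteq> J \<Longrightarrow> generic J' a"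
  by (auto simp: generic_def intro: polyfun_mono)

text \<open>Serves for exchanging rows, for transposing, and for pulling a matrix back along a
  labelling of its columns.\<close>

lemma generic_reindex:
  assumes "generic J a" "inj_on h I" "h ` I \<subseteq> J"
  shows "generic I (a \<circ> h)"
  unfolding generic_def
proof (intro ballI impI allI)
  fix f b assume f: "f \<in> polyfun I" and "f (a \<circ> h) = 0"
  \<comment> \<open>The point \<open>b \<circ> inv_into I h\<close> pulls back along
    \<open>h\<close> to a point that agrees with \<open>b\<close> on \<open>I\<close>.\<close>
  then have "f ((b \<circ> inv_into I h) \<circ> h) = 0"
    using genericD[OF generic_mono[OF assms(1,3)] polyfun_reindex[OF f, of h]] by blast
  then show "f b = 0"
    using polyfun_cong[OF f, of "(b \<circ> inv_into I h) \<circ> h" b] assms(2) by simp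
qed

section \<open>Evaluation of rational polynomials is a ring homomorphism\<close>

abbreviation monomial :: "('i \<Rightarrow>\<^sub>0 nat) \<Rightarrow> ('i \<Rightarrow> real) \<Rightarrow> real" where
  "monomial m x \<equiv> \<Prod>i\<in>Poly_Mapping.keys m. x i ^ Poly_Mapping.lookup m i"

lemma monomial_superset:
  assumes "finite B" "Poly_Mapping.keys m \<subseteq> B"
  shows "monomial m x = (\<Prod>i\<in>B. x i ^ Poly_Mapping.lookup m i)"
  using assms by (intro prod.mono_neutral_left) (auto simp: in_keys_iff)

lemma monomial_add: "monomial (m + m') x = monomial m x * monomial m' x"
proof -
  let ?B = "Poly_Mapping.keys m \<union> Poly_Mapping.keys m'"
  have "monomial (m + m') x = (\<Prod>i\<in>?B. x i ^ Poly_Mapping.lookup (m + m') i)"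
    by (rule monomial_superset) (auto simp: Poly_Mapping.keys_add)
  then show ?thesis
    by (simp add: monomial_superset[of ?B m] monomial_superset[of ?B m'] lookup_add power_add
        prod.distrib)
qed

lemma mpoly_eval_superset:
  assumes "finite B" "Poly_Mapping.keys p \<subseteq> B"
  shows "mpoly_eval p x = (\<Sum>m\<in>B. of_rat (Poly_Mapping.lookup p m) * monomial m x)"
  unfolding mpoly_eval_def using assms by (intro sum.mono_neutral_left) (auto simp: in_keys_iff)

lemma mpoly_eval_single: "mpoly_eval (Poly_Mapping.single m c) x = of_rat c * monomial m x"
  using mpoly_eval_superset[of "{m}" "Poly_Mapping.single m c"] by simp

lemma mpoly_eval_zero [simp]: "mpoly_eval 0 x = 0"
  by (simp add: mpoly_eval_def)

lemma mpoly_eval_add: "mpoly_eval (p + q) x = mpoly_eval p x + mpoly_eval q x"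
proof -
  let ?B = "Poly_Mapping.keys p \<union> Poly_Mapping.keys q"
  have "mpoly_eval (p + q) x = (\<Sum>m\<in>?B. of_rat (Poly_Mapping.lookup (p + q) m) * monomial m x)"
    by (rule mpoly_eval_superset) (auto simp: Poly_Mapping.keys_add)
  then show ?thesis
    by (simp add: mpoly_eval_superset[of ?B p] mpoly_eval_superset[of ?B q] lookup_add of_rat_add
        algebra_simps sum.distrib)
qed

lemma mpoly_eval_sum: "mpoly_eval (\<Sum>t\<in>T. p t) x = (\<Sum>t\<in>T. mpoly_eval (p t) x)"
  by (induction T rule: infinite_finite_induct) (auto simp: mpoly_eval_add)

lemma poly_mapping_sum_singles:
  "p = (\<Sum>m\<in>Poly_Mapping.keys p. Poly_Mapping.single m (Poly_Mapping.lookup p m))"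
  by (rule poly_mapping_eqI)
    (auto simp: lookup_sum lookup_single when_def in_keys_iff sum.delta' intro: sum.neutral)

lemma mpoly_eval_mult: "mpoly_eval (p * q) x = mpoly_eval p x * mpoly_eval q x"
proof -
  have "p * q = (\<Sum>m\<in>Poly_Mapping.keys p. \<Sum>m'\<in>Poly_Mapping.keys q.
      Poly_Mapping.single (m + m') (Poly_Mapping.lookup p m * Poly_Mapping.lookup q m'))"
    by (subst poly_mapping_sum_singles[of p], subst poly_mapping_sum_singles[of q])
      (simp add: sum_product mult_single)
  then show ?thesis
    by (simp add: mpoly_eval_sum mpoly_eval_single monomial_add of_rat_mult mpoly_eval_def[of p]
        mpoly_eval_def[of q] sum_product algebra_simps)
qed

lemma polyfun_eq_mpoly_eval:
  assumes "f \<in> polyfun J"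
  shows "\<exists>p. (\<forall>m\<in>Poly_Mapping.keys p. Poly_Mapping.keys m \<subseteq> J) \<and> (\<forall>x. f x = mpoly_eval p x)"
  using assms
proof induction
  case (const c)
  show ?case
    by (rule exI[of _ "Poly_Mapping.single 0 c"]) (auto simp: mpoly_eval_single)
next
  case (var i)
  then show ?case
    by (intro exI[of _ "Poly_Mapping.single (Poly_Mapping.single i 1) 1"])
      (auto simp: mpoly_eval_single)
next
  case (add f g)
  then obtain p q where
    "\<forall>m\<in>Poly_Mapping.keys p. Poly_Mapping.keys m \<subseteq> J" "\<forall>x. f x = mpoly_eval p x"
    "\<forall>m\<in>Poly_Mapping.keys q. Poly_Mapping.keys m \<subseteq> J" "\<forall>x. g x = mpoly_eval q x" by blast
  then show ?case
    using Poly_Mapping.keys_add[of p q]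
    by (intro exI[of _ "p + q"]) (auto simp: mpoly_eval_add dest!: subsetD)
next
  case (mult f g)
  then obtain p q where pq:
    "\<forall>m\<in>Poly_Mapping.keys p. Poly_Mapping.keys m \<subseteq> J" "\<forall>x. f x = mpoly_eval p x"
    "\<forall>m\<in>Poly_Mapping.keys q. Poly_Mapping.keys m \<subseteq> J" "\<forall>x. g x = mpoly_eval q x" by blast
  have "Poly_Mapping.keys m \<subseteq> J" if m: "m \<in> Poly_Mapping.keys (p * q)" for m
  proof -
    obtain m1 m2 where "m = m1 + m2" "m1 \<in> Poly_Mapping.keys p" "m2 \<in> Poly_Mapping.keys q"
      using m Poly_Mapping.keys_mult[of p q] by blast
    then show ?thesis using pq Poly_Mapping.keys_add[of m1 m2] by blast
  qed
  then show ?case using pq by (intro exI[of _ "p * q"]) (auto simp: mpoly_eval_mult)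
qed

lemma algebraically_independent_imp_generic:
  assumes "algebraically_independent J a"
  shows "generic J a"
  unfolding generic_def
proof (intro ballI impI allI)
  fix f b assume "f \<in> polyfun J" "f a = 0"
  then obtain p where "\<forall>m\<in>Poly_Mapping.keys p. Poly_Mapping.keys m \<subseteq> J" "\<forall>x. f x = mpoly_eval p x"
    using polyfun_eq_mpoly_eval by blast
  then show "f b = 0"
    using assms \<open>f a = 0\<close> by (metis algebraically_independent_def mpoly_eval_zero)
qed

section \<open>Existence of algebraically independent families\<close>

text \<open>The graph over the support is a finite subset of a countable set and determines the
  map.\<close>

lemma countable_poly_mapping:
  fixes A :: "'k set"
  assumes "countable A"
  shows "countable {p :: 'k \<Rightarrow>\<^sub>0 'v::{zero,countable}. Poly_Mapping.keys p \<subseteq> A}"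
proof -
  let ?g = "\<lambda>p :: 'k \<Rightarrow>\<^sub>0 'v. (\<lambda>k. (k, Poly_Mapping.lookup p k)) ` Poly_Mapping.keys p"
  have "inj ?g"
  proof (rule injI)
    fix p q assume e: "?g p = ?g q"
    have *: "Poly_Mapping.lookup p k = v \<and> v \<noteq> 0 \<longleftrightarrow> (k, v) \<in> ?g p"
      for p :: "'k \<Rightarrow>\<^sub>0 'v" and k v
      by (auto simp: in_keys_iff)
    show "p = q"
      by (rule poly_mapping_eqI) (metis * e)
  qed
  moreover have "?g ` {p. Poly_Mapping.keys p \<subseteq> A} \<subseteq> {B. finite B \<and> B \<subseteq> A \<times> UNIV}"
    by auto
  moreover have "countable {B. finite B \<and> B \<subseteq> A \<times> (UNIV :: 'v set)}"
    by (intro countable_Collect_finite_subset countable_SIGMA assms) auto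
  ultimately show ?thesis
    by (meson countable_image_inj_on countable_subset inj_on_subset subset_UNIV)
qed

text \<open>Expand \<open>p\<close> in powers of the variable \<open>i\<close>. Some coefficient is
  a non-zero polynomial in the variables \<open>I\<close>, hence non-zero at \<open>a\<close>, so
  what remains is a non-zero polynomial in one real variable.\<close>

lemma mpoly_eval_finite_roots:
  fixes p :: "'i rat_mpoly"
  assumes ind: "algebraically_independent I a" and i: "i \<notin> I"
    and keys: "\<forall>m\<in>Poly_Mapping.keys p. Poly_Mapping.keys m \<subseteq> insert i I" and "p \<noteq> 0"
  shows "finite {x. mpoly_eval p (a(i := x)) = 0}"
proof -
  let ?K = "Poly_Mapping.keys p"
  define u where "u m = Poly_Mapping.update i 0 m" for m :: "'i \<Rightarrow>\<^sub>0 nat"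
  define q where "q d = (\<Sum>m\<in>{m \<in> ?K. Poly_Mapping.lookup m i = d}.
    Poly_Mapping.single (u m) (Poly_Mapping.lookup p m))" for d
  \<comment> \<open>A monomial is recovered from its \<open>i\<close>-free part and its degree in
    \<open>i\<close>, so no cancellation occurs in \<open>q d\<close>.\<close>
  have inj: "m = m'" if "u m = u m'" "Poly_Mapping.lookup m i = Poly_Mapping.lookup m' i" for m m'
  proof (rule poly_mapping_eqI)
    fix k show "Poly_Mapping.lookup m k = Poly_Mapping.lookup m' k"
      using that(2) arg_cong[OF that(1), of "\<lambda>m. Poly_Mapping.lookup m k"]
      by (cases "k = i") (simp_all add: u_def lookup_update)
  qed
  have mon: "monomial m (a(i := x)) = monomial (u m) a * x ^ Poly_Mapping.lookup m i" for m x
  proof -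
    have "monomial m (a(i := x))
        = (\<Prod>k\<in>insert i (Poly_Mapping.keys m). (a(i := x)) k ^ Poly_Mapping.lookup m k)"
      by (rule monomial_superset) auto
    also have "\<dots> = x ^ Poly_Mapping.lookup m i *
        (\<Prod>k\<in>Poly_Mapping.keys m - {i}. (a(i := x)) k ^ Poly_Mapping.lookup m k)"
      by (simp add: prod.insert_remove)
    also have "(\<Prod>k\<in>Poly_Mapping.keys m - {i}. (a(i := x)) k ^ Poly_Mapping.lookup m k)
        = (\<Prod>k\<in>Poly_Mapping.keys m - {i}. a k ^ Poly_Mapping.lookup (u m) k)"
      by (rule prod.cong) (auto simp: u_def lookup_update)
    also have "\<dots> = monomial (u m) a"
      by (rule monomial_superset[symmetric]) (auto simp: u_def keys_update)
    finally show ?thesis by simp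
  qed
  define N where "N = Max ((\<lambda>m. Poly_Mapping.lookup m i) ` ?K)"
  have N: "Poly_Mapping.lookup m i \<le> N" if "m \<in> ?K" for m
    unfolding N_def using that by (intro Max_ge) auto
  have eval: "mpoly_eval p (a(i := x)) = (\<Sum>d\<le>N. mpoly_eval (q d) a * x ^ d)" for x
  proof -
    have "mpoly_eval p (a(i := x)) = (\<Sum>m\<in>?K. of_rat (Poly_Mapping.lookup p m) * monomial (u m) a
        * x ^ Poly_Mapping.lookup m i)"
      unfolding mpoly_eval_def mon by (simp only: mult.assoc)
    also have "\<dots> = (\<Sum>d\<le>N. \<Sum>m\<in>{m \<in> ?K. Poly_Mapping.lookup m i = d}.
        of_rat (Poly_Mapping.lookup p m) * monomial (u m) a * x ^ Poly_Mapping.lookup m i)"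
      by (rule sum.group[symmetric]) (use N in auto)
    also have "\<dots> = (\<Sum>d\<le>N. mpoly_eval (q d) a * x ^ d)"
      by (intro sum.cong) (auto simp: q_def mpoly_eval_sum mpoly_eval_single sum_distrib_right)
    finally show ?thesis .
  qed
  obtain m0 where m0: "m0 \<in> ?K" using \<open>p \<noteq> 0\<close> poly_mapping_eqI[of p 0] by (auto simp: in_keys_iff)
  let ?d = "Poly_Mapping.lookup m0 i"
  have "Poly_Mapping.lookup (q ?d) (u m0) = (\<Sum>m\<in>{m \<in> ?K. Poly_Mapping.lookup m i = ?d}.
      if m = m0 then Poly_Mapping.lookup p m0 else 0)"
    unfolding q_def lookup_sum
    by (rule sum.cong) (auto simp: lookup_single when_def dest: inj)
  also have "\<dots> = Poly_Mapping.lookup p m0"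
    using m0 by simp
  finally have *: "Poly_Mapping.lookup (q ?d) (u m0) = Poly_Mapping.lookup p m0" .
  have "q ?d \<noteq> 0"
  proof
    assume "q ?d = 0"
    then show False using * m0 unfolding in_keys_iff by (metis lookup_zero)
  qed
  moreover have "\<forall>m\<in>Poly_Mapping.keys (q d). Poly_Mapping.keys m \<subseteq> I" for d
  proof
    fix m assume "m \<in> Poly_Mapping.keys (q d)"
    then have "m \<in> (\<Union>m\<in>{m \<in> ?K. Poly_Mapping.lookup m i = d}.
        Poly_Mapping.keys (Poly_Mapping.single (u m) (Poly_Mapping.lookup p m)))"
      unfolding q_def by (rule subsetD[OF Poly_Mapping.keys_sum])
    then obtain m' where "m' \<in> ?K"
      and m: "m \<in> Poly_Mapping.keys (Poly_Mapping.single (u m') (Poly_Mapping.lookup p m'))"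
      by blast
    have "m = u m'" using m by (simp split: if_splits)
    then show "Poly_Mapping.keys m \<subseteq> I"
      using keys \<open>m' \<in> ?K\<close> by (auto simp: u_def keys_update)
  qed
  ultimately have "mpoly_eval (q ?d) a \<noteq> 0"
    using ind by (auto simp: algebraically_independent_def)
  then show ?thesis
    unfolding eval using polyfun_roots_finite[of "\<lambda>d. mpoly_eval (q d) a" ?d N] N[OF m0] by simp
qed

text \<open>Coordinates are added one at a time: countably many polynomials each exclude finitely
  many values of the new coordinate, and the reals are uncountable. Without existence,
  \<open>SOME\<close> in the definition of \<open>\<Delta>\<close> would say nothing.\<close>

lemma algebraically_independent_exists:
  fixes I :: "'i set"
  assumes "finite I"
  shows "\<exists>x. algebraically_independent I x"
  using assms
proof (induction I)
  case empty
  have "algebraically_independent {} (\<lambda>_ :: 'i. 0)"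
    unfolding algebraically_independent_def
  proof (intro allI impI)
    fix p :: "'i rat_mpoly"
    assume k: "\<forall>m\<in>Poly_Mapping.keys p. Poly_Mapping.keys m \<subseteq> {}"
      and "mpoly_eval p (\<lambda>_. 0) = 0"
    have "Poly_Mapping.keys p \<subseteq> {0}" using k by auto
    then have "mpoly_eval p (\<lambda>_. 0) = of_rat (Poly_Mapping.lookup p 0)"
      using mpoly_eval_superset[of "{0}" p "\<lambda>_. 0"] by simp
    then have "Poly_Mapping.lookup p 0 = 0" using \<open>mpoly_eval p _ = 0\<close> by simp
    then have "Poly_Mapping.lookup p k = 0" for k
      using \<open>Poly_Mapping.keys p \<subseteq> {0}\<close> by (cases "k = 0") (auto simp: in_keys_iff subset_iff)
    then show "p = 0" by (intro poly_mapping_eqI) simp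
  qed
  then show ?case by blast
next
  case (insert i I)
  then obtain a where a: "algebraically_independent I a" by blast
  let ?P = "{p :: 'i rat_mpoly. Poly_Mapping.keys p \<subseteq> {m. Poly_Mapping.keys m \<subseteq> insert i I}}"
  have "countable ?P"
    using insert.hyps by (intro countable_poly_mapping countable_finite) auto
  then have "countable (\<Union>p\<in>?P - {0}. {x. mpoly_eval p (a(i := x)) = 0})"
    by (intro countable_UN countable_Diff) (auto intro!: countable_finite mpoly_eval_finite_roots[OF a insert.hyps(2)])
  then obtain x where x: "x \<notin> (\<Union>p\<in>?P - {0}. {x. mpoly_eval p (a(i := x)) = 0})"
    using uncountable_UNIV_real by (metis UNIV_eq_I)
  have "algebraically_independent (insert i I) (a(i := x))"
    unfolding algebraically_independent_def using x by auto
  then show ?case by blast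
qed

section \<open>Linear systems over a subring\<close>

text \<open>Gaussian elimination by cross-multiplication, without division, so that the solution
  stays in a subring \<open>D\<close> containing the coefficients. The number of unknowns is finite,
  that of equations is not restricted.\<close>

lemma solution_in_subring:
  fixes D :: "real set" and E :: "('x \<Rightarrow> real) set"
  assumes D: "0 \<in> D" "1 \<in> D" "\<And>c d. c \<in> D \<Longrightarrow> d \<in> D \<Longrightarrow> c + d \<in> D"
      "\<And>c d. c \<in> D \<Longrightarrow> d \<in> D \<Longrightarrow> c * d \<in> D" "\<And>c. c \<in> D \<Longrightarrow> - c \<in> D"
    and "finite X"
    and "\<And>e t. e \<in> E \<Longrightarrow> t \<in> X \<Longrightarrow> e t \<in> D" "\<And>t. t \<in> X \<Longrightarrow> b t \<in> D"
    and "\<And>e. e \<in> E \<Longrightarrow> (\<Sum>t\<in>X. e t * x t) = 0" "(\<Sum>t\<in>X. b t * x t) \<noteq> 0"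
  shows "\<exists>y. (\<forall>t. y t \<in> D) \<and> (\<forall>e\<in>E. (\<Sum>t\<in>X. e t * y t) = 0) \<and> (\<Sum>t\<in>X. b t * y t) \<noteq> 0"
  using assms(6-)
proof (induction X arbitrary: E b rule: finite_induct)
  case empty
  then show ?case by simp
next
  case (insert t X)
  have sumD: "(\<Sum>s\<in>Y. f s) \<in> D" if "\<And>s. s \<in> Y \<Longrightarrow> f s \<in> D" for Y :: "'x set" and f
    using that by (induction Y rule: infinite_finite_induct) (auto simp: D)
  have diffD: "c - d \<in> D" if "c \<in> D" "d \<in> D" for c d
    using D(3)[OF that(1) D(5)[OF that(2)]] by simp
  show ?case
  \<comment> \<open>If no equation involves the unknown \<open>t\<close>, either the functional
    \<open>b\<close> does not involve it and \<open>t\<close> is dropped, or the unit vector at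
    \<open>t\<close> is a solution.\<close>
  proof (cases "\<forall>e\<in>E. e t = 0")
    case zero: True
    show ?thesis
    proof (cases "b t = 0")
      case True
      have *: "(\<Sum>s\<in>insert t X. f s * y s) = (\<Sum>s\<in>X. f s * y s)" if "f t = 0" for f y :: "'x \<Rightarrow> real"
        using insert.hyps that by simp
      have "\<exists>y. (\<forall>t. y t \<in> D) \<and> (\<forall>e\<in>E. (\<Sum>t\<in>X. e t * y t) = 0) \<and> (\<Sum>t\<in>X. b t * y t) \<noteq> 0"
      proof (rule insert.IH)
        show "(\<Sum>s\<in>X. e s * x s) = 0" if "e \<in> E" for e
          using insert.prems(3)[OF that] bspec[OF zero that] insert.hyps by simp
        show "(\<Sum>s\<in>X. b s * x s) \<noteq> 0"
          using insert.prems(4) True insert.hyps by simp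
      qed (use insert.prems in auto)
      then show ?thesis using * zero True by auto
    next
      case False
      have *: "(\<Sum>s\<in>insert t X. f s * (if s = t then 1 else 0)) = f t" for f :: "'x \<Rightarrow> real"
        using insert.hyps by (simp add: if_distrib[of "(*) _"] sum.delta cong: if_cong)
      show ?thesis
        by (rule exI[of _ "\<lambda>s. if s = t then 1 else 0"]) (simp only: *, use zero False D in auto)
    qed
  next
    case False
    then obtain e0 where e0: "e0 \<in> E" "e0 t \<noteq> 0" by blast
    \<comment> \<open>\<open>g e\<close> is the equation \<open>e\<close> with \<open>t\<close>
      eliminated by means of the pivot \<open>e0\<close>; in particular \<open>g e0\<close>
      vanishes.\<close>
    define g where "g e s = e0 t * e s - e t * e0 s" for e s
    have g_sum: "(\<Sum>s\<in>X. g e s * z s) = e0 t * (\<Sum>s\<in>X. e s * z s) - e t * (\<Sum>s\<in>X. e0 s * z s)"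
      for e z by (simp add: g_def sum_distrib_left sum_subtractf algebra_simps)
    have x0: "(\<Sum>s\<in>X. e s * x s) = - e t * x t" if "e \<in> E" for e
      using insert.prems(3)[OF that] insert.hyps by simp
    have "\<exists>y. (\<forall>t. y t \<in> D) \<and> (\<forall>e\<in>g ` E. (\<Sum>t\<in>X. e t * y t) = 0) \<and> (\<Sum>t\<in>X. g b t * y t) \<noteq> 0"
    proof (rule insert.IH)
      show "e s \<in> D" if "e \<in> g ` E" "s \<in> X" for e s
        using that insert.prems e0 by (auto simp: g_def intro!: diffD D(4))
      show "g b s \<in> D" if "s \<in> X" for s
        using that insert.prems e0 by (auto simp: g_def intro!: diffD D(4))
      show "(\<Sum>s\<in>X. e s * x s) = 0" if "e \<in> g ` E" for e
        using that x0 e0 by (auto simp: g_sum)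
      have "(\<Sum>s\<in>X. g b s * x s) = e0 t * (\<Sum>s\<in>insert t X. b s * x s)"
        unfolding g_sum x0[OF e0(1)] using insert.hyps by (simp add: algebra_simps)
      then show "(\<Sum>s\<in>X. g b s * x s) \<noteq> 0"
        using e0 insert.prems(4) by simp
    qed
    then obtain y where y: "\<forall>t. y t \<in> D" "\<forall>e\<in>E. (\<Sum>t\<in>X. g e t * y t) = 0"
      "(\<Sum>t\<in>X. g b t * y t) \<noteq> 0" by auto
    \<comment> \<open>Scaling \<open>y\<close> by the pivot \<open>e0 t\<close> avoids dividing by
      it in the coordinate \<open>t\<close>.\<close>
    define z where "z s = (if s = t then - (\<Sum>s\<in>X. e0 s * y s) else e0 t * y s)" for s
    have z_sum: "(\<Sum>s\<in>insert t X. e s * z s) = (\<Sum>s\<in>X. g e s * y s)" for e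
    proof -
      have "(\<Sum>s\<in>X. e s * z s) = (\<Sum>s\<in>X. e s * (e0 t * y s))"
        by (rule sum.cong) (use insert.hyps in \<open>auto simp: z_def\<close>)
      also have "\<dots> = e0 t * (\<Sum>s\<in>X. e s * y s)"
        by (simp add: sum_distrib_left algebra_simps)
      finally have "(\<Sum>s\<in>X. e s * z s) = e0 t * (\<Sum>s\<in>X. e s * y s)" .
      then show ?thesis
        using insert.hyps by (simp add: g_sum z_def)
    qed
    show ?thesis
      by (rule exI[of _ z], unfold z_sum)
        (use y e0 insert.prems(1) in \<open>auto simp: z_def intro!: D(4,5) sumD\<close>)
  qed
qed

section \<open>Alternating forms\<close>

text \<open>A form of degree \<open>k\<close> on a complex is dual to the degree \<open>k\<close> part of its exterior face
  ring; encoding it as a function on lists of vertices avoids both an order on the vertices and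
  explicit signs.\<close>

definition alternating :: "('a list \<Rightarrow> real) \<Rightarrow> bool" where
  "alternating x \<longleftrightarrow> (\<forall>xs v w ys. x (xs @ v # w # ys) = - x (xs @ w # v # ys))"

definition forms :: "'a set set \<Rightarrow> nat \<Rightarrow> ('a list \<Rightarrow> real) set" where
  "forms K k = {x. alternating x \<and> (\<forall>l. x l \<noteq> 0 \<longrightarrow> length l = k \<and> set l \<in> K)}"

lemma alternatingD: "alternating x \<Longrightarrow> x (xs @ v # w # ys) = - x (xs @ w # v # ys)"
  unfolding alternating_def by blast

lemma alternating_front: "alternating x \<Longrightarrow> x (v # w # ys) = - x (w # v # ys)"
  using alternatingD[of x "[]" v w ys] by simp

lemma alternating_if:
  assumes "alternating x" "\<And>xs v w ys. P (xs @ v # w # ys) = P (xs @ w # v # ys)"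
  shows "alternating (\<lambda>l. if P l then x l else 0)"
  unfolding alternating_def
proof (intro allI)
  fix xs v w ys
  show "(if P (xs @ v # w # ys) then x (xs @ v # w # ys) else 0) =
      - (if P (xs @ w # v # ys) then x (xs @ w # v # ys) else 0)"
    using alternatingD[OF assms(1), of xs v w ys] assms(2)[of xs v w ys] by simp
qed

text \<open>The sign is chosen before the form: it is the same for all of them, which later allows
  two forms to be compared on sorted lists alone.\<close>

lemma alternating_move:
  fixes m :: "'a list"
  shows "\<exists>s\<in>{1, -1}. \<forall>x. alternating x \<longrightarrow> (\<forall>p q. x (p @ v # m @ q) = s * x (p @ m @ v # q))"
proof (induction m)
  case Nil
  show ?case by (rule bexI[of _ 1]) auto
next
  case (Cons w m)
  then obtain s where s: "s \<in> {1, -1}"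
    and *: "\<And>x p q. alternating x \<Longrightarrow> x (p @ v # m @ q) = s * x (p @ m @ v # q)" by blast
  have "x (p @ v # (w # m) @ q) = - s * x (p @ (w # m) @ v # q)" if "alternating x" for x p q
    using alternatingD[OF that, of p v w "m @ q"] *[OF that, of "p @ [w]" q] by simp
  then show ?case using s by (intro bexI[of _ "- s"]) auto
qed

lemma alternating_perm:
  fixes l :: "'a list"
  assumes "mset l = mset l'"
  shows "\<exists>s\<in>{1, -1}. \<forall>x. alternating x \<longrightarrow> (\<forall>p. x (p @ l) = s * x (p @ l'))"
  using assms
proof (induction l arbitrary: l')
  case Nil
  then show ?case by (intro bexI[of _ 1]) auto
next
  case (Cons v l)
  then have "v \<in> set l'" by (metis list.set_intros(1) mset_eq_setD)
  then obtain m q where l': "l' = m @ v # q" by (meson split_list)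
  with Cons.prems have "mset l = mset (m @ q)" by simp
  from Cons.IH[OF this] obtain s where s: "s \<in> {1, -1}"
    and s': "\<And>x p. alternating x \<Longrightarrow> x (p @ l) = s * x (p @ m @ q)" by blast
  obtain t where t: "t \<in> {1, -1}"
    and t': "\<And>x p q. alternating x \<Longrightarrow> x (p @ v # m @ q) = t * x (p @ m @ v # q)"
    using alternating_move[where m = m and v = v] by blast
  have "x (p @ v # l) = (s * t) * x (p @ l')" if "alternating x" for x p
    using s'[OF that, of "p @ [v]"] t'[OF that, of p q] by (simp add: l')
  then show ?case using s t by (intro bexI[of _ "s * t"]) auto
qed

lemma alternating_perm_eq_0_iff:
  assumes "alternating x" "mset l = mset l'"
  shows "x l = 0 \<longleftrightarrow> x l' = 0"
proof -
  obtain s :: real where "s \<in> {1, -1}" "x ([] @ l) = s * x ([] @ l')"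
    using alternating_perm[OF assms(2)] assms(1) by meson
  then show ?thesis by auto
qed

lemma alternating_set_eq_0_iff:
  assumes "alternating x" "distinct l" "distinct l'" "set l = set l'"
  shows "x l = 0 \<longleftrightarrow> x l' = 0"
  using alternating_perm_eq_0_iff[OF assms(1)] set_eq_iff_mset_eq_distinct[OF assms(2,3)] assms(4)
  by blast

lemma alternating_distinct:
  assumes "alternating x" "x l \<noteq> 0"
  shows "distinct l"
proof (rule ccontr)
  assume "\<not> distinct l"
  then obtain xs ys zs v where l: "l = xs @ [v] @ ys @ [v] @ zs"
    using not_distinct_decomp by blast
  have "x (xs @ v # v # ys @ zs) = 0"
    using alternatingD[OF assms(1), of xs v v "ys @ zs"] by simp
  moreover have "mset l = mset (xs @ v # v # ys @ zs)" by (simp add: l)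
  ultimately show False using alternating_perm_eq_0_iff[OF assms(1)] assms(2) by blast
qed

lemma alternating_eq_if_eq_on_sorted:
  fixes x y :: "'a :: linorder list \<Rightarrow> real"
  assumes "alternating x" "alternating y"
    and eq: "\<And>l. sorted l \<Longrightarrow> distinct l \<Longrightarrow> set l \<subseteq> A \<Longrightarrow> x l = y l" and "set l \<subseteq> A"
  shows "x l = y l"
proof (cases "distinct l")
  case True
  have "mset l = mset (sort l)" by simp
  from alternating_perm[OF this] obtain s where
    "\<And>x. alternating x \<Longrightarrow> x ([] @ l) = s * x ([] @ sort l)" by blast
  then have "x l = s * x (sort l)" "y l = s * y (sort l)" using assms by auto
  then show ?thesis using eq[of "sort l"] True assms(4) by simp
next
  case False
  then show ?thesis using alternating_distinct assms(1,2) by metis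
qed

lemma formsD:
  assumes "x \<in> forms K k"
  shows "alternating x" "x l \<noteq> 0 \<Longrightarrow> length l = k" "x l \<noteq> 0 \<Longrightarrow> set l \<in> K"
  using assms by (auto simp: forms_def)

lemma forms_lin:
  assumes "x \<in> forms K k" "y \<in> forms K k"
  shows "(\<lambda>l. c * x l + d * y l) \<in> forms K k"
proof -
  have "c * x (xs @ v # w # ys) + d * y (xs @ v # w # ys)
    = - (c * x (xs @ w # v # ys) + d * y (xs @ w # v # ys))" for xs v w ys
    using alternatingD[of x xs v w ys] alternatingD[of y xs v w ys] assms
    by (simp add: forms_def)
  moreover have "c * x l + d * y l \<noteq> 0 \<Longrightarrow> x l \<noteq> 0 \<or> y l \<noteq> 0" for l by auto
  ultimately show ?thesis using assms unfolding forms_def alternating_def by blast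
qed

section \<open>Contraction with the rows of a matrix\<close>

text \<open>The transpose of left multiplication by the vector with coordinates
  \<open>a (i, v)\<close>. Since \<open>fold\<close> starts with the first row,
  \<open>contrs V a R x []\<close> is the value of \<open>x\<close> on the wedge product of the rows
  in the order of \<open>R\<close>.\<close>

definition contr :: "'a set \<Rightarrow> ('i \<times> 'a \<Rightarrow> real) \<Rightarrow> 'i \<Rightarrow> ('a list \<Rightarrow> real) \<Rightarrow> 'a list \<Rightarrow> real" where
  "contr V a i x = (\<lambda>l. \<Sum>v\<in>V. a (i, v) * x (v # l))"

abbreviation contrs ::
    "'a set \<Rightarrow> ('i \<times> 'a \<Rightarrow> real) \<Rightarrow> 'i list \<Rightarrow> ('a list \<Rightarrow> real) \<Rightarrow> 'a list \<Rightarrow> real" where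
  "contrs V a R \<equiv> fold (contr V a) R"

lemma contr_sum: "contr V a i (\<lambda>l. \<Sum>t\<in>T. c t * x t l) = (\<lambda>l. \<Sum>t\<in>T. c t * contr V a i (x t) l)"
proof
  fix l
  have "contr V a i (\<lambda>l. \<Sum>t\<in>T. c t * x t l) l = (\<Sum>v\<in>V. \<Sum>t\<in>T. c t * (a (i, v) * x t (v # l)))"
    by (simp add: contr_def sum_distrib_left algebra_simps)
  then show "contr V a i (\<lambda>l. \<Sum>t\<in>T. c t * x t l) l = (\<Sum>t\<in>T. c t * contr V a i (x t) l)"
    by (subst (asm) sum.swap) (simp add: contr_def sum_distrib_left)
qed

lemma contrs_sum:
  "contrs V a R (\<lambda>l. \<Sum>t\<in>T. c t * x t l) = (\<lambda>l. \<Sum>t\<in>T. c t * contrs V a R (x t) l)"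
  by (induction R arbitrary: x) (simp_all add: contr_sum)

lemma contrs_lin:
  "contrs V a R (\<lambda>l. c * x l + d * y l) = (\<lambda>l. c * contrs V a R x l + d * contrs V a R y l)"
  using contrs_sum[of V a R "\<lambda>b. if b then c else d" "\<lambda>b. if b then x else y" "UNIV :: bool set"]
  by (simp add: UNIV_bool add.commute)

lemma contrs_zero: "contrs V a R (\<lambda>l. 0) = (\<lambda>l. 0)"
  using contrs_sum[of V a R "\<lambda>b. 0" _ "{}"] by simp

lemma contrs_uminus: "contrs V a R (\<lambda>l. - x l) = (\<lambda>l. - contrs V a R x l)"
  using contrs_lin[of V a R "-1" x 0 x] by simp

lemma alternating_contr:
  assumes "alternating x"
  shows "alternating (contr V a i x)"
  unfolding alternating_def contr_def
proof (intro allI)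
  fix xs v w ys
  have "x (u # xs @ v # w # ys) = - x (u # xs @ w # v # ys)" for u
    using alternatingD[OF assms, of "u # xs" v w ys] by simp
  then show "(\<Sum>u\<in>V. a (i, u) * x (u # xs @ v # w # ys)) =
      - (\<Sum>u\<in>V. a (i, u) * x (u # xs @ w # v # ys))"
    by (simp add: sum_negf)
qed

lemma alternating_contrs: "alternating x \<Longrightarrow> alternating (contrs V a R x)"
  by (induction R arbitrary: x) (auto intro: alternating_contr)

lemma contr_swap:
  assumes "alternating x"
  shows "contr V a i (contr V a j x) = (\<lambda>l. - contr V a j (contr V a i x) l)"
proof
  fix l
  have "contr V a i (contr V a j x) l = (\<Sum>w\<in>V. \<Sum>v\<in>V. a (i, w) * (a (j, v) * x (v # w # l)))"
    by (simp add: contr_def sum_distrib_left)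
  also have "\<dots> = (\<Sum>v\<in>V. \<Sum>w\<in>V. a (i, w) * (a (j, v) * x (v # w # l)))"
    by (rule sum.swap)
  also have "\<dots> = (\<Sum>v\<in>V. \<Sum>w\<in>V. - (a (j, v) * (a (i, w) * x (w # v # l))))"
    by (intro sum.cong refl, subst alternating_front[OF assms]) simp
  also have "\<dots> = - contr V a j (contr V a i x) l"
    by (simp add: contr_def sum_distrib_left sum_negf)
  finally show "contr V a i (contr V a j x) l = - contr V a j (contr V a i x) l" .
qed

text \<open>Contractions anticommute, so rows obey the same rules as vertices: reordering changes at
  most the sign, and a repeated row gives zero.\<close>

lemma alternating_rows:
  assumes "alternating x"
  shows "alternating (\<lambda>R. contrs V a R x l)"
  unfolding alternating_def
proof (intro allI)
  fix xs i j ys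
  have "contr V a j (contr V a i (contrs V a xs x))
      = (\<lambda>l. - contr V a i (contr V a j (contrs V a xs x)) l)"
    by (rule contr_swap[OF alternating_contrs[OF assms]])
  then show "contrs V a (xs @ i # j # ys) x l = - contrs V a (xs @ j # i # ys) x l"
    by (simp only: fold_append fold_Cons comp_apply contrs_uminus)
qed

text \<open>The record of non-zero matrix entries is what triangular matrices exploit later: it
  orders each vertex of \<open>m\<close> relative to its row.\<close>

lemma contrs_support_entries:
  assumes "contrs V a R x l \<noteq> 0"
  shows "\<exists>m. list_all2 (\<lambda>i v. v \<in> V \<and> a (i, v) \<noteq> 0) R m \<and> x (m @ l) \<noteq> 0"
  using assms
proof (induction R arbitrary: x)
  case (Cons i R)
  then obtain m where m: "list_all2 (\<lambda>i v. v \<in> V \<and> a (i, v) \<noteq> 0) R m"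
    "contr V a i x (m @ l) \<noteq> 0" by force
  then obtain v where "v \<in> V" "a (i, v) * x (v # m @ l) \<noteq> 0"
    unfolding contr_def by (metis (no_types, lifting) sum.neutral)
  then show ?case using m(1) by (intro exI[of _ "v # m"]) auto
qed auto

lemma contrs_support:
  assumes "contrs V a R x l \<noteq> 0"
  shows "\<exists>m. length m = length R \<and> set m \<subseteq> V \<and> x (m @ l) \<noteq> 0"
proof -
  obtain m where m: "list_all2 (\<lambda>i v. v \<in> V \<and> a (i, v) \<noteq> 0) R m" "x (m @ l) \<noteq> 0"
    using contrs_support_entries[OF assms] by blast
  then have "set m \<subseteq> V" by (auto simp: list_all2_conv_all_nth in_set_conv_nth)
  then show ?thesis using m list_all2_lengthD[OF m(1)] by auto
qed

lemma contrs_cong: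
  assumes "\<And>i v. i \<in> set R \<Longrightarrow> v \<in> V \<Longrightarrow> a (i, v) = b (i, v)"
  shows "contrs V a R x = contrs V b R x"
  using assms
proof (induction R arbitrary: x)
  case (Cons i R)
  have "contr V a i x = contr V b i x"
    unfolding contr_def using Cons.prems by (intro ext sum.cong) auto
  then show ?case using Cons by auto
qed auto

lemma contrs_polyfun:
  assumes "\<And>l. (\<lambda>M. x M l) \<in> polyfun (I \<times> V)" "set R \<subseteq> I"
  shows "(\<lambda>M. contrs V M R (x M) l) \<in> polyfun (I \<times> V)"
  using assms
proof (induction R arbitrary: x)
  case (Cons i R)
  have "(\<lambda>M. contr V M i (x M) l) \<in> polyfun (I \<times> V)" for l
    unfolding contr_def using Cons.prems by (intro polyfun_sum polyfun.mult polyfun.var) auto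
  from Cons.IH[OF this] Cons.prems show ?case by simp
qed auto

text \<open>Being alternating and having the prescribed contractions zero are linear equations whose
  coefficients are polynomials in the matrix. Solving them over the ring of polynomial values at
  \<open>a\<close> and lifting the solution to polynomials gives \<open>X\<close>; genericity turns
  its equations at \<open>a\<close> into identities in \<open>M\<close>. In general
  \<open>X a\<close> is not \<open>x\<close>.\<close>

lemma polynomial_form_exists:
  fixes K :: "'a set set" and a :: "'i \<times> 'a \<Rightarrow> real"
  assumes V: "finite V" "\<And>S. S \<in> K \<Longrightarrow> S \<subseteq> V" and gen: "generic (I \<times> V) a"
    and x: "x \<in> forms K k"
    and Q: "\<And>R l. (R, l) \<in> Q \<Longrightarrow> set R \<subseteq> I" "\<And>R l. (R, l) \<in> Q \<Longrightarrow> contrs V a R x l = 0"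
    and R0: "set R0 \<subseteq> I" "contrs V a R0 x l0 \<noteq> 0"
  shows "\<exists>X. (\<forall>l. (\<lambda>M. X M l) \<in> polyfun (I \<times> V)) \<and> (\<forall>M. X M \<in> forms K k) \<and>
    (\<forall>R l M. (R, l) \<in> Q \<longrightarrow> contrs V M R (X M) l = 0) \<and> contrs V a R0 (X a) l0 \<noteq> 0"
proof -
  define L where "L = {l. length l = k \<and> set l \<in> K}"
  have "finite L"
    using finite_lists_length_eq[OF V(1), of k] V(2)
    by (rule_tac finite_subset) (auto simp: L_def)
  define P where "P = polyfun (I \<times> V)"
  \<comment> \<open>The subring of real numbers that are values at \<open>a\<close> of rational
    polynomials in the entries.\<close>
  define D where "D = (\<lambda>f. f a) ` P"
  have DI: "f \<in> P \<Longrightarrow> f a \<in> D" for f by (auto simp: D_def)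
  \<comment> \<open>The unit vectors \<open>ind m\<close> need not be alternating; this property is
    imposed by the equations \<open>s\<close> instead.\<close>
  define ind :: "'a list \<Rightarrow> 'a list \<Rightarrow> real" where "ind m = (\<lambda>l. of_bool (l = m))" for m
  define c where "c R l m = contrs V a R (ind m) l" for R l m
  define s where "s l l' m = ind m l + ind m l'" for l l' m
  have x_L: "x l = 0" if "l \<notin> L" for l
    using that formsD(2,3)[OF x] by (auto simp: L_def)
  have ind_sum: "(\<Sum>m\<in>L. ind m l * z m) = z l" if "\<And>l. l \<notin> L \<Longrightarrow> z l = 0" for z l
  proof -
    have "(\<Sum>m\<in>L. ind m l * z m) = (\<Sum>m\<in>L. if m = l then z l else 0)"
      by (rule sum.cong) (auto simp: ind_def)
    then show ?thesis using that \<open>finite L\<close> by simp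
  qed
  have c_sum: "(\<Sum>m\<in>L. c R l m * z m) = contrs V a R z l" if "\<And>l. l \<notin> L \<Longrightarrow> z l = 0" for z R l
  proof -
    have "z = (\<lambda>l. \<Sum>m\<in>L. z m * ind m l)"
      using ind_sum[of z] that by (auto simp: mult.commute)
    then have "contrs V a R z l = contrs V a R (\<lambda>l. \<Sum>m\<in>L. z m * ind m l) l" by simp
    then show ?thesis by (simp add: contrs_sum c_def mult.commute)
  qed
  have s_sum: "(\<Sum>m\<in>L. s l l' m * z m) = z l + z l'" if "\<And>l. l \<notin> L \<Longrightarrow> z l = 0" for z l l'
    using ind_sum[OF that] by (simp add: s_def distrib_right sum.distrib)
  define E where "E = {c R l | R l. (R, l) \<in> Q} \<union>
    {s (xs @ v # w # ys) (xs @ w # v # ys) | xs v w ys. True}"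
  have ind_P: "(\<lambda>_. ind m l) \<in> P" for m l
    unfolding P_def ind_def of_bool_def by (auto intro: polyfun_zero polyfun_one)
  have c_D: "c R l m \<in> D" if "set R \<subseteq> I" for R l m
  proof -
    have "(\<lambda>M. contrs V M R (ind m) l) \<in> P"
      unfolding P_def
      by (rule contrs_polyfun[OF _ that]) (rule ind_P[unfolded P_def])
    then show ?thesis unfolding c_def by (rule DI)
  qed
  have "\<exists>y. (\<forall>t. y t \<in> D) \<and> (\<forall>e\<in>E. (\<Sum>t\<in>L. e t * y t) = 0) \<and> (\<Sum>t\<in>L. c R0 l0 t * y t) \<noteq> 0"
  proof (rule solution_in_subring)
    show "0 \<in> D" "1 \<in> D"
      using DI polyfun_zero polyfun_one unfolding P_def by blast+
    show "d + e \<in> D" "d * e \<in> D" if "d \<in> D" "e \<in> D" for d e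
      using that DI[unfolded P_def, OF polyfun.add] DI[unfolded P_def, OF polyfun.mult]
      by (auto simp: D_def P_def)
    show "- d \<in> D" if "d \<in> D" for d
      using that DI[unfolded P_def, OF polyfun_uminus] by (auto simp: D_def P_def)
    show "finite L" by fact
    show "e t \<in> D" if "e \<in> E" for e t
    proof -
      have "s l l' t \<in> D" for l l'
        using DI[of "\<lambda>_. ind t l + ind t l'"] ind_P polyfun.add unfolding P_def s_def by blast
      then show ?thesis
        using that c_D Q(1) unfolding E_def by blast
    qed
    show "c R0 l0 t \<in> D" for t by (rule c_D[OF R0(1)])
    show "(\<Sum>t\<in>L. e t * x t) = 0" if "e \<in> E" for e
    proof -
      have "(\<Sum>t\<in>L. c R l t * x t) = 0" if "(R, l) \<in> Q" for R l
        using c_sum[of x] x_L Q(2)[OF that] by simp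
      moreover have "(\<Sum>t\<in>L. s (xs @ v # w # ys) (xs @ w # v # ys) t * x t) = 0" for xs v w ys
        using s_sum[of x] x_L alternatingD[OF formsD(1)[OF x], of xs v w ys] by simp
      ultimately show ?thesis using that unfolding E_def by auto
    qed
    show "(\<Sum>t\<in>L. c R0 l0 t * x t) \<noteq> 0"
      using c_sum[of x] x_L R0(2) by simp
  qed
  then obtain y where y: "\<And>t. y t \<in> D" "\<And>e. e \<in> E \<Longrightarrow> (\<Sum>t\<in>L. e t * y t) = 0"
    "(\<Sum>t\<in>L. c R0 l0 t * y t) \<noteq> 0" by blast
  \<comment> \<open>Each coordinate, a value at \<open>a\<close>, is replaced by a polynomial with
    this value.\<close>
  have "\<exists>F. \<forall>t. F t \<in> P \<and> F t a = y t"
    by (rule choice) (metis (no_types, lifting) y(1) D_def imageE)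
  then obtain F where F: "\<And>t. F t \<in> P" "\<And>t. F t a = y t" by blast
  define X where "X M l = (if l \<in> L then F l M else 0)" for M l
  have X_L: "X M l = 0" if "l \<notin> L" for M l using that by (simp add: X_def)
  have X_P: "(\<lambda>M. X M l) \<in> P" for l
    using F(1) polyfun_zero unfolding X_def P_def by (cases "l \<in> L") simp_all
  have X_a: "(\<Sum>t\<in>L. e t * X a t) = (\<Sum>t\<in>L. e t * y t)" for e
    by (rule sum.cong) (auto simp: X_def F(2))
  show ?thesis
  proof (intro exI[of _ X] conjI allI impI)
    show "(\<lambda>M. X M l) \<in> polyfun (I \<times> V)" for l using X_P by (simp add: P_def)
    show "contrs V M R (X M) l = 0" if "(R, l) \<in> Q" for R l M
    proof (rule genericD[OF gen, where f = "\<lambda>M. contrs V M R (X M) l"])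
      show "(\<lambda>M. contrs V M R (X M) l) \<in> polyfun (I \<times> V)"
        using contrs_polyfun Q(1)[OF that] X_P unfolding P_def by blast
      have "c R l \<in> E" using that unfolding E_def by blast
      from y(2)[OF this] show "contrs V a R (X a) l = 0"
        using c_sum[of "X a"] X_L X_a by simp
    qed
    show "X M \<in> forms K k" for M
      unfolding forms_def alternating_def
    proof (intro CollectI conjI allI)
      fix xs v w ys
      have "X M (xs @ v # w # ys) + X M (xs @ w # v # ys) = 0"
      proof (rule genericD[OF gen, where f = "\<lambda>M. X M (xs @ v # w # ys) + X M (xs @ w # v # ys)"])
        show "(\<lambda>M. X M (xs @ v # w # ys) + X M (xs @ w # v # ys)) \<in> polyfun (I \<times> V)"
          using X_P unfolding P_def by (intro polyfun.add)
        have "s (xs @ v # w # ys) (xs @ w # v # ys) \<in> E" unfolding E_def by blast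
        from y(2)[OF this] show "X a (xs @ v # w # ys) + X a (xs @ w # v # ys) = 0"
          using s_sum[of "X a"] X_L X_a by simp
      qed
      then show "X M (xs @ v # w # ys) = - X M (xs @ w # v # ys)" by simp
    next
      fix l show "X M l \<noteq> 0 \<longrightarrow> length l = k \<and> set l \<in> K"
        by (simp add: X_def L_def)
    qed
    show "contrs V a R0 (X a) l0 \<noteq> 0"
      using y(3) c_sum[of "X a"] X_L X_a by simp
  qed
qed

section \<open>Dimensions\<close>

lemma dim_eq_0_iff:
  fixes W :: "'v::real_vector set"
  assumes "subspace W" "W \<subseteq> span B" "finite B"
  shows "dim W = 0 \<longleftrightarrow> W = {0}"
proof
  assume "dim W = 0"
  obtain C where C: "C \<subseteq> W" "independent C" "W \<subseteq> span C" "card C = dim W"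
    using basis_exists by blast
  have "finite C" using C assms by (meson independent_span_bound order_trans)
  then have "C = {}" using C(4) \<open>dim W = 0\<close> by simp
  then show "W = {0}" using C(3) subspace_0[OF assms(1)] by auto
next
  assume "W = {0}"
  then show "dim W = 0"
    by (intro dim_unique[of "{}"]) (auto simp: independent_empty)
qed

lemma dim_kernel:
  fixes W :: "'v::real_vector set" and f :: "'v \<Rightarrow> real"
  assumes W: "subspace W" "W \<subseteq> span B" "finite B" and f: "linear f" and u: "u \<in> W" "f u \<noteq> 0"
  shows "dim W = Suc (dim {w \<in> W. f w = 0})"
proof -
  let ?K = "{w \<in> W. f w = 0}"
  obtain C where C: "C \<subseteq> ?K" "independent C" "?K \<subseteq> span C" "card C = dim ?K"
    using basis_exists by blast
  have "C \<subseteq> span B" using C(1) W(2) by blast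
  then have "finite C" using independent_span_bound[OF W(3) C(2)] by blast
  have "subspace ?K"
    using W(1) f unfolding subspace_def
    by (auto simp: linear_add[OF f] linear_scale[OF f] linear_0[OF f])
  then have "span C = ?K" using C by (metis span_minimal subset_antisym)
  then have "u \<notin> span C" using u by auto
  then have ind: "independent (insert u C)" using C(2) by (simp add: independent_insert)
  have "W \<subseteq> span (insert u C)"
  proof
    fix w assume "w \<in> W"
    let ?w = "w - (f w / f u) *\<^sub>R u"
    have "?w \<in> ?K"
      using \<open>w \<in> W\<close> u W(1)
      by (auto simp: subspace_diff subspace_scale linear_diff[OF f] linear_scale[OF f])
    then have "?w \<in> span C" using \<open>span C = ?K\<close> by simp
    then show "w \<in> span (insert u C)"
      by (subst span_breakdown_eq) blast
  qed
  moreover have "card (insert u C) = Suc (dim ?K)"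
    using C(4) \<open>finite C\<close> \<open>u \<notin> span C\<close> span_base[of u C] by (metis card_insert_disjoint)
  moreover have "insert u C \<subseteq> W" using C(1) u(1) by blast
  ultimately show ?thesis
    using ind by (intro dim_unique)
qed

lemma dim_direct_sum:
  fixes U W :: "'v::real_vector set"
  assumes U: "subspace U" "U \<subseteq> span B" and W: "subspace W" "W \<subseteq> span B" and "finite B"
    and "U \<inter> W \<subseteq> {0}"
  shows "dim {u + w | u w. u \<in> U \<and> w \<in> W} = dim U + dim W"
proof -
  obtain C where C: "C \<subseteq> U" "independent C" "U \<subseteq> span C" "card C = dim U"
    using basis_exists by blast
  obtain D where D: "D \<subseteq> W" "independent D" "W \<subseteq> span D" "card D = dim W"
    using basis_exists by blast
  have fin: "finite C" "finite D"
    using C D U W \<open>finite B\<close> by (meson independent_span_bound order_trans)+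
  have "0 \<notin> C" using C(2) dependent_zero by blast
  then have disj: "C \<inter> D = {}" using C(1) D(1) assms(6) by blast
  have spans: "span C = U" "span D = W"
    using C D U W by (metis span_minimal subset_antisym)+
  have "independent (C \<union> D)"
  proof (rule independent_if_scalars_zero)
    show "finite (C \<union> D)" using fin by simp
    fix g x assume "(\<Sum>x\<in>C \<union> D. g x *\<^sub>R x) = 0" and x: "x \<in> C \<union> D"
    then have sum: "(\<Sum>x\<in>C. g x *\<^sub>R x) + (\<Sum>x\<in>D. g x *\<^sub>R x) = 0"
      using fin disj by (simp add: sum.union_disjoint)
    have inU: "(\<Sum>x\<in>C. g x *\<^sub>R x) \<in> U"
      by (intro subspace_sum[OF U(1)] subspace_scale[OF U(1)]) (use C in auto)
    have inW: "(\<Sum>x\<in>D. g x *\<^sub>R x) \<in> W"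
      by (intro subspace_sum[OF W(1)] subspace_scale[OF W(1)]) (use D in auto)
    have "(\<Sum>x\<in>C. g x *\<^sub>R x) = - (\<Sum>x\<in>D. g x *\<^sub>R x)"
      using sum by (simp add: eq_neg_iff_add_eq_0)
    then have "(\<Sum>x\<in>C. g x *\<^sub>R x) \<in> W"
      using inW subspace_neg[OF W(1)] by metis
    then have C0: "(\<Sum>x\<in>C. g x *\<^sub>R x) = 0" using inU assms(6) by blast
    then have D0: "(\<Sum>x\<in>D. g x *\<^sub>R x) = 0" using sum by simp
    show "g x = 0"
      using x independentD[OF C(2) fin(1) order_refl C0] independentD[OF D(2) fin(2) order_refl D0]
      by blast
  qed
  moreover have "span (C \<union> D) = {u + w | u w. u \<in> U \<and> w \<in> W}"
    unfolding span_Un spans by auto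
  ultimately have "dim {u + w | u w. u \<in> U \<and> w \<in> W} = card (C \<union> D)"
    by (metis dim_span_eq_card_independent)
  then show ?thesis using C D fin disj by (simp add: card_Un_disjoint)
qed

text \<open>By \<open>cut\<close>, a functional \<open>f t\<close> with \<open>t < N\<close> is not
  identically zero on the common kernel of its predecessors unless that kernel is zero; every step
  then lowers the dimension by exactly one until zero is reached.\<close>

locale functional_chain =
  fixes U :: "'v::real_vector set" and f :: "nat \<Rightarrow> 'v \<Rightarrow> real" and B :: "'v set" and N :: nat
  assumes U: "subspace U" "U \<subseteq> span B" "finite B" and f: "\<And>s. linear (f s)"
    and cut: "\<And>t u. t < N \<Longrightarrow> u \<in> U \<Longrightarrow> u \<noteq> 0 \<Longrightarrow> (\<And>s. s < t \<Longrightarrow> f s u = 0) \<Longrightarrow>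
      \<exists>u\<in>U. (\<forall>s<t. f s u = 0) \<and> f t u \<noteq> 0"
begin

abbreviation kernel :: "nat \<Rightarrow> 'v set" where
  "kernel t \<equiv> {u \<in> U. \<forall>s<t. f s u = 0}"

lemma subspace_kernel: "subspace (kernel t)"
  using U(1) unfolding subspace_def
  by (auto simp: linear_add[OF f] linear_scale[OF f] linear_0[OF f])

lemma kernel_span: "kernel t \<subseteq> span B"
  using U by auto

lemma dim_kernel_0: "dim (kernel t) = 0 \<longleftrightarrow> kernel t = {0}"
  by (rule dim_eq_0_iff[OF subspace_kernel kernel_span U(3)])

lemma dim_kernel_eq: "t \<le> N \<Longrightarrow> dim (kernel t) = dim U - t"
proof (induction t)
  case (Suc t)
  have Suc_eq: "kernel (Suc t) = {u \<in> kernel t. f t u = 0}"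
    by (auto simp: less_Suc_eq)
  show ?case
  proof (cases "kernel t = {0}")
    case True
    then have "dim (kernel t) = 0" unfolding dim_kernel_0 .
    moreover have "kernel (Suc t) = {0}"
      unfolding Suc_eq using True by (auto simp: linear_0[OF f])
    then have "dim (kernel (Suc t)) = 0"
      unfolding dim_kernel_0 .
    ultimately show ?thesis using Suc by simp
  next
    case False
    then obtain u where "u \<in> kernel t" "u \<noteq> 0" using subspace_0[OF subspace_kernel] by blast
    then obtain u' where "u' \<in> kernel t" "f t u' \<noteq> 0"
      using cut[of t u] Suc.prems by auto
    then have "dim (kernel t) = Suc (dim (kernel (Suc t)))"
      unfolding Suc_eq by (rule dim_kernel[OF subspace_kernel kernel_span U(3) f])
    then show ?thesis using Suc by simp
  qed
qed simp

text \<open>The functional \<open>f t\<close> cuts something off iff the kernel before it, of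
  dimension \<open>dim U - t\<close>, is non-zero. Injectivity forces
  \<open>dim U \<le> N\<close>.\<close>

lemma cut_iff_less_dim:
  assumes inj: "\<And>u. u \<in> U \<Longrightarrow> (\<And>s. s < N \<Longrightarrow> f s u = 0) \<Longrightarrow> u = 0"
  shows "t < N \<and> (\<exists>u\<in>U. (\<forall>s<t. f s u = 0) \<and> f t u \<noteq> 0) \<longleftrightarrow> t < dim U"
proof
  assume "t < N \<and> (\<exists>u\<in>U. (\<forall>s<t. f s u = 0) \<and> f t u \<noteq> 0)"
  then obtain u where u: "t < N" "u \<in> kernel t" "f t u \<noteq> 0" by blast
  then have "u \<noteq> 0" using linear_0[OF f] by metis
  then have "kernel t \<noteq> {0}" using u by blast
  then have "dim (kernel t) \<noteq> 0" unfolding dim_kernel_0 .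
  then show "t < dim U" using dim_kernel_eq[of t] u by simp
next
  assume "t < dim U"
  have "kernel N = {0}" using inj subspace_0[OF subspace_kernel] by blast
  then have "dim (kernel N) = 0" unfolding dim_kernel_0 .
  then have "t < N" using \<open>t < dim U\<close> dim_kernel_eq[of N] by simp
  moreover have "kernel t \<noteq> {0}"
    using dim_kernel_eq[of t] \<open>t < N\<close> \<open>t < dim U\<close> unfolding dim_kernel_0[symmetric] by simp
  then obtain u where "u \<in> kernel t" "u \<noteq> 0" using subspace_0[OF subspace_kernel] by blast
  ultimately show "t < N \<and> (\<exists>u\<in>U. (\<forall>s<t. f s u = 0) \<and> f t u \<noteq> 0)"
    using cut[of t u] by blast
qed

end

section \<open>Generic rows\<close>

lemma contrs_snoc_Nil: "contrs V a (R @ [r]) x [] = (\<Sum>v\<in>V. a (r, v) * contrs V a R x [v])"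
  by (simp add: contr_def)

text \<open>The solution can be chosen polynomial in the rows in \<open>I\<close>, and the entries of row \<open>r\<close> are
  linearly independent over such polynomials.\<close>

lemma generic_row:
  fixes K :: "'a set set" and a :: "'i \<times> 'a \<Rightarrow> real"
  assumes V: "finite V" "\<And>S. S \<in> K \<Longrightarrow> S \<subseteq> V"
    and gen: "generic (insert r I \<times> V) a" and r: "r \<notin> I"
    and x: "x \<in> forms K k"
    and Q: "\<And>R l. (R, l) \<in> Q \<Longrightarrow> set R \<subseteq> I" "\<And>R l. (R, l) \<in> Q \<Longrightarrow> contrs V a R x l = 0"
    and R0: "set R0 \<subseteq> I" "contrs V a R0 x [v0] \<noteq> 0"
  shows "\<exists>y\<in>forms K k. (\<forall>(R, l)\<in>Q. contrs V a R y l = 0) \<and> contrs V a (R0 @ [r]) y [] \<noteq> 0"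
proof -
  have gen': "generic (I \<times> V) a"
    by (rule generic_mono[OF gen]) auto
  have "\<exists>X. (\<forall>l. (\<lambda>M. X M l) \<in> polyfun (I \<times> V)) \<and> (\<forall>M. X M \<in> forms K k) \<and>
      (\<forall>R l M. (R, l) \<in> Q \<longrightarrow> contrs V M R (X M) l = 0) \<and> contrs V a R0 (X a) [v0] \<noteq> 0"
    by (rule polynomial_form_exists[where Q = Q and K = K and x = x]; fact V gen' x Q R0)
  then obtain X where X: "\<And>l. (\<lambda>M. X M l) \<in> polyfun (I \<times> V)" "\<And>M. X M \<in> forms K k"
    "\<And>R l M. (R, l) \<in> Q \<Longrightarrow> contrs V M R (X M) l = 0" "contrs V a R0 (X a) [v0] \<noteq> 0"
    by blast
  have "v0 \<in> V"
    using contrs_support[OF X(4)] formsD(3)[OF X(2)] V(2) by fastforce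
  have "contrs V a (R0 @ [r]) (X a) [] \<noteq> 0"
  proof
    assume 0: "contrs V a (R0 @ [r]) (X a) [] = 0"
    \<comment> \<open>Row \<open>r\<close> becomes the unit vector at \<open>v0\<close>, all other
      rows are kept. \<open>X\<close> and the contractions along \<open>R0\<close> do not see row
      \<open>r\<close>, so the identity would give
      \<open>contrs V a R0 (X a) [v0] = 0\<close>.\<close>
    define b where "b = (\<lambda>(i, v). if i = r then of_bool (v = v0) else a (i, v))"
    have "contrs V b (R0 @ [r]) (X b) [] = 0"
    proof (rule genericD[OF gen, where f = "\<lambda>M. contrs V M (R0 @ [r]) (X M) []"])
      show "(\<lambda>M. contrs V M (R0 @ [r]) (X M) []) \<in> polyfun (insert r I \<times> V)"
        using R0(1) by (intro contrs_polyfun polyfun_mono[OF X(1)]) auto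
    qed (rule 0)
    moreover have "contrs V b R0 (X b) = contrs V a R0 (X a)"
    proof -
      have "X b l = X a l" for l
        by (rule polyfun_cong[OF X(1)]) (use r in \<open>auto simp: b_def\<close>)
      then have "X b = X a" by blast
      moreover have "contrs V b R0 (X a) = contrs V a R0 (X a)"
        by (rule contrs_cong) (use r R0(1) in \<open>auto simp: b_def\<close>)
      ultimately show ?thesis by simp
    qed
    moreover have "(\<Sum>v\<in>V. b (r, v) * z v) = z v0" for z :: "'a \<Rightarrow> real"
    proof -
      have "(\<Sum>v\<in>V. b (r, v) * z v) = (\<Sum>v\<in>V. if v = v0 then z v0 else 0)"
        by (rule sum.cong) (auto simp: b_def)
      then show ?thesis using V(1) \<open>v0 \<in> V\<close> by simp
    qed
    ultimately show False using X(4) unfolding contrs_snoc_Nil by simp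
  qed
  then show ?thesis using X(2,3) by blast
qed

section \<open>Vectors on the vertices and ranks of generic matrices\<close>

lemma lookup_scaleR [simp]:
  "Poly_Mapping.lookup (c *\<^sub>R (x :: 'a \<Rightarrow>\<^sub>0 real)) k = c * Poly_Mapping.lookup x k"
proof -
  have "finite {i. c *\<^sub>R Poly_Mapping.lookup x i \<noteq> 0}"
    by (rule finite_subset[of _ "Poly_Mapping.keys x"]) (auto simp: in_keys_iff)
  then show ?thesis by (simp add: scaleR_poly_mapping_def)
qed

definition vectors :: "'a set \<Rightarrow> ('a \<Rightarrow>\<^sub>0 real) set" where
  "vectors V = {u. Poly_Mapping.keys u \<subseteq> V}"

definition vector_of :: "'a set \<Rightarrow> ('a \<Rightarrow> real) \<Rightarrow> 'a \<Rightarrow>\<^sub>0 real" where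
  "vector_of V g = (\<Sum>v\<in>V. Poly_Mapping.single v (g v))"

definition row :: "'a set \<Rightarrow> ('i \<times> 'a \<Rightarrow> real) \<Rightarrow> 'i \<Rightarrow> ('a \<Rightarrow>\<^sub>0 real) \<Rightarrow> real" where
  "row V a i u = (\<Sum>v\<in>V. a (i, v) * Poly_Mapping.lookup u v)"

lemma lookup_vector_of:
  "finite V \<Longrightarrow> Poly_Mapping.lookup (vector_of V g) v = (if v \<in> V then g v else 0)"
  by (simp add: vector_of_def lookup_sum lookup_single when_def)

lemma vector_of_in_vectors: "finite V \<Longrightarrow> vector_of V g \<in> vectors V"
  by (auto simp: vectors_def in_keys_iff lookup_vector_of split: if_splits)

lemma vectors_lookup: "u \<in> vectors V \<Longrightarrow> v \<notin> V \<Longrightarrow> Poly_Mapping.lookup u v = 0"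
  by (auto simp: vectors_def in_keys_iff)

lemma linear_row: "linear (row V a i)"
  by (rule linearI)
    (simp_all add: row_def lookup_add algebra_simps sum.distrib sum_distrib_left)

lemma subspace_vectors: "subspace (vectors V)"
  unfolding subspace_def vectors_def
  by (auto simp: in_keys_iff lookup_add subset_iff) (metis add.right_neutral)

lemma vectors_span:
  assumes "finite V"
  shows "vectors V \<subseteq> span ((\<lambda>v. Poly_Mapping.single v 1) ` V)"
proof
  fix u assume u: "u \<in> vectors V"
  have "u = (\<Sum>v\<in>V. Poly_Mapping.lookup u v *\<^sub>R Poly_Mapping.single v 1)"
    by (rule poly_mapping_eqI)
      (use assms u in \<open>auto simp: lookup_sum lookup_single when_def vectors_lookup if_distrib
        cong: if_cong\<close>)
  also have "\<dots> \<in> span ((\<lambda>v. Poly_Mapping.single v 1) ` V)"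
    by (intro span_sum span_scale span_base) auto
  finally show "u \<in> span ((\<lambda>v. Poly_Mapping.single v 1) ` V)" .
qed

lemma dim_vectors:
  assumes "finite V"
  shows "dim (vectors V) = card V"
proof -
  let ?e = "\<lambda>v. Poly_Mapping.single v (1 :: real)"
  have inj: "inj_on ?e V"
    by (rule inj_onI) (metis lookup_single_eq lookup_single_not_eq zero_neq_one)
  have "independent (?e ` V)"
  proof (rule independent_if_scalars_zero)
    fix g x assume 0: "(\<Sum>x\<in>?e ` V. g x *\<^sub>R x) = 0" and "x \<in> ?e ` V"
    then obtain w where w: "w \<in> V" "x = ?e w" by blast
    have "(\<Sum>v\<in>V. g (?e v) *\<^sub>R ?e v) = 0"
      using 0 by (simp add: sum.reindex[OF inj])
    then have "Poly_Mapping.lookup (\<Sum>v\<in>V. g (?e v) *\<^sub>R ?e v) w = 0" by simp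
    then show "g x = 0"
      using assms w by (simp add: lookup_sum lookup_single when_def if_distrib cong: if_cong)
  qed (use assms in simp)
  then have "dim (vectors V) = card (?e ` V)"
    using vectors_span[OF assms]
    by (intro dim_unique[of "?e ` V"]) (auto simp: vectors_def)
  then show ?thesis by (simp add: card_image[OF inj])
qed

text \<open>On the complex of isolated points \<open>V\<close>, forms of degree one are vectors, and
  \<open>generic_row\<close> becomes a statement about the rows of a matrix.\<close>

lemma vectors_chain:
  fixes a :: "nat \<times> 'a \<Rightarrow> real"
  assumes V: "finite V" and gen: "generic ({1..n} \<times> V) a"
  shows "functional_chain (vectors V) (\<lambda>s. row V a (Suc s)) ((\<lambda>v. Poly_Mapping.single v 1) ` V) n"
proof
  fix t u assume t: "t < n" and u: "u \<in> vectors V" "u \<noteq> 0"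
    and 0: "\<And>s. s < t \<Longrightarrow> row V a (Suc s) u = 0"
  define K where "K = insert {} ((\<lambda>v. {v}) ` V)"
  define x where "x l = (case l of [v] \<Rightarrow> Poly_Mapping.lookup u v | _ \<Rightarrow> 0)" for l
  have "alternating x"
    unfolding alternating_def
  proof (intro allI)
    fix xs v w and ys :: "'a list"
    have "x l = 0" if "length l \<ge> 2" for l using that by (auto simp: x_def split: list.splits)
    then show "x (xs @ v # w # ys) = - x (xs @ w # v # ys)" by simp
  qed
  moreover have "length l = 1 \<and> set l \<in> K" if "x l \<noteq> 0" for l
    using that u vectors_lookup[of u V] by (auto simp: x_def K_def split: list.splits)
  ultimately have x: "x \<in> forms K 1" by (auto simp: forms_def)
  obtain v0 where v0: "Poly_Mapping.lookup u v0 \<noteq> 0"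
    using u(2) poly_mapping_eqI[of u 0] by auto
  have "\<exists>y\<in>forms K 1. (\<forall>(R, l)\<in>{([i], []) | i. i \<in> {1..t}}. contrs V a R y l = 0)
      \<and> contrs V a ([] @ [Suc t]) y [] \<noteq> 0"
  proof (rule generic_row[OF V, where I = "{1..t}"])
    show "S \<subseteq> V" if "S \<in> K" for S using that by (auto simp: K_def)
    show "generic (insert (Suc t) {1..t} \<times> V) a"
      by (rule generic_mono[OF gen]) (use t in auto)
    show "contrs V a R x l = 0" if "(R, l) \<in> {([i], []) | i. i \<in> {1..t}}" for R l
    proof -
      obtain i where "R = [i]" "l = []" "1 \<le> i" "i \<le> t"
        using \<open>(R, l) \<in> _\<close> by auto
      then show ?thesis using 0[of "i - 1"] by (simp add: contr_def x_def row_def)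
    qed
    show "contrs V a [] x [v0] \<noteq> 0" using v0 by (simp add: x_def)
  qed (use x in auto)
  then obtain y where "\<forall>(R, l)\<in>{([i], []) | i. i \<in> {1..t}}. contrs V a R y l = 0"
    and "contrs V a ([] @ [Suc t]) y [] \<noteq> 0" by blast
  then have y: "\<And>i. i \<in> {1..t} \<Longrightarrow> (\<Sum>v\<in>V. a (i, v) * y [v]) = 0"
      "(\<Sum>v\<in>V. a (Suc t, v) * y [v]) \<noteq> 0"
    by (fastforce simp: contr_def)+
  have "row V a i (vector_of V (\<lambda>v. y [v])) = (\<Sum>v\<in>V. a (i, v) * y [v])" for i
    using V by (simp add: row_def lookup_vector_of)
  then show "\<exists>u\<in>vectors V. (\<forall>s<t. row V a (Suc s) u = 0) \<and> row V a (Suc t) u \<noteq> 0"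
    using y V by (intro bexI[of _ "vector_of V (\<lambda>v. y [v])"]) (auto simp: vector_of_in_vectors)
qed (use V subspace_vectors vectors_span in
    \<open>auto simp: linear_add[OF linear_row] linear_scale[OF linear_row]\<close>)

text \<open>Each row lowers the dimension of the common kernel until it is zero, which takes
  \<open>card V\<close> rows.\<close>

lemma generic_rows_injective:
  fixes a :: "nat \<times> 'a \<Rightarrow> real"
  assumes V: "finite V" and gen: "generic ({1..n} \<times> V) a" and n: "card V \<le> n"
    and 0: "\<And>i. i \<in> {1..n} \<Longrightarrow> (\<Sum>v\<in>V. a (i, v) * u v) = 0" and v: "v \<in> V"
  shows "u v = 0"
proof -
  interpret functional_chain "vectors V" "\<lambda>s. row V a (Suc s)" "(\<lambda>v. Poly_Mapping.single v 1) ` V" n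
    by (rule vectors_chain[OF V gen])
  have "dim (kernel n) = 0" using dim_kernel_eq[of n] n dim_vectors[OF V] by simp
  then have "kernel n = {0}" unfolding dim_kernel_0 .
  moreover have "vector_of V u \<in> kernel n"
    using 0 V by (auto simp: vector_of_in_vectors row_def lookup_vector_of)
  ultimately have "vector_of V u = 0" by blast
  then show ?thesis using lookup_vector_of[OF V, of u v] v by simp
qed

text \<open>The first \<open>t\<close> rows leave a non-zero kernel and the next row does not vanish
  on it. Such vectors are the columns, or after transposition the rows, of the triangular changes of
  coordinates used for shifted complexes.\<close>

lemma generic_triangular_vector:
  fixes a :: "nat \<times> 'a \<Rightarrow> real"
  assumes V: "finite V" and gen: "generic ({1..n} \<times> V) a" and t: "t < n" "t < card V"
  shows "\<exists>u. (\<forall>v. v \<notin> V \<longrightarrow> u v = 0) \<and> (\<forall>i\<in>{1..t}. (\<Sum>v\<in>V. a (i, v) * u v) = 0) \<and>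
    (\<Sum>v\<in>V. a (Suc t, v) * u v) \<noteq> 0"
proof -
  interpret functional_chain "vectors V" "\<lambda>s. row V a (Suc s)" "(\<lambda>v. Poly_Mapping.single v 1) ` V" n
    by (rule vectors_chain[OF V gen])
  have "dim (kernel t) \<noteq> 0" using dim_kernel_eq[of t] t dim_vectors[OF V] by simp
  then have "kernel t \<noteq> {0}" unfolding dim_kernel_0 .
  then obtain u where "u \<in> kernel t" "u \<noteq> 0" using subspace_0[OF subspace_kernel] by blast
  then obtain u where u: "u \<in> vectors V" "\<forall>s<t. row V a (Suc s) u = 0" "row V a (Suc t) u \<noteq> 0"
    using cut[of t u] t by blast
  show ?thesis
  proof (intro exI[of _ "Poly_Mapping.lookup u"] conjI ballI allI impI)
    show "Poly_Mapping.lookup u v = 0" if "v \<notin> V" for v using vectors_lookup[OF u(1) that] .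
    show "(\<Sum>v\<in>V. a (i, v) * Poly_Mapping.lookup u v) = 0" if "i \<in> {1..t}" for i
      using u(2)[rule_format, of "i - 1"] that by (auto simp: row_def)
    show "(\<Sum>v\<in>V. a (Suc t, v) * Poly_Mapping.lookup u v) \<noteq> 0"
      using u(3) by (simp add: row_def)
  qed
qed

text \<open>Vertices are stripped off one at a time by the injectivity of the rows. This turns the
  vanishing of all further contractions into the vanishing of the form itself.\<close>

lemma contrs_injective:
  fixes a :: "nat \<times> 'a \<Rightarrow> real"
  assumes V: "finite V" and gen: "generic ({1..n} \<times> V) a" and n: "card V \<le> n"
    and supp: "\<And>l. x l \<noteq> 0 \<Longrightarrow> set l \<subseteq> V"
    and 0: "\<And>R. set R \<subseteq> {1..n} \<Longrightarrow> length R = length l \<Longrightarrow> contrs V a R x m = 0"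
  shows "x (l @ m) = 0"
  using supp 0
proof (induction l arbitrary: x)
  case Nil
  then show ?case using Nil(2)[of "[]"] by simp
next
  case (Cons v l)
  have *: "contr V a i x (l @ m) = 0" if i: "i \<in> {1..n}" for i
  proof (rule Cons.IH)
    fix l' assume "contr V a i x l' \<noteq> 0"
    then obtain w where "x (w # l') \<noteq> 0" unfolding contr_def by (metis (no_types, lifting) mult_zero_right sum.neutral)
    then show "set l' \<subseteq> V" using Cons.prems(1) by force
  next
    fix R assume "set R \<subseteq> {1..n}" "length R = length l"
    then show "contrs V a R (contr V a i x) m = 0" using Cons.prems(2)[of "i # R"] i by simp
  qed
  show ?case
  proof (cases "v \<in> V")
    case True
    then show ?thesis
      using generic_rows_injective[OF V gen n, of "\<lambda>v. x (v # l @ m)" v] * by (simp add: contr_def)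
  next
    case False
    then show ?thesis using Cons.prems(1)[of "v # l @ m"] by auto
  qed
qed

section \<open>Leading sets\<close>

abbreviation slist :: "nat set \<Rightarrow> nat list" where
  "slist \<equiv> sorted_list_of_set"

text \<open>The dual description of the shifting. The columns are indexed by the vertices
  themselves, of any type, so that different complexes can share one matrix without a common
  labelling.\<close>

definition leads :: "nat \<Rightarrow> 'a set \<Rightarrow> 'a set set \<Rightarrow> (nat \<times> 'a \<Rightarrow> real) \<Rightarrow> nat set set" where
  "leads n V K a = {S. S \<subseteq> {1..n} \<and> (\<exists>x\<in>forms K (card S).
     (\<forall>R. R \<subseteq> {1..n} \<and> card R = card S \<and> lex_less R S \<longrightarrow> contrs V a (slist R) x [] = 0) \<and>
     contrs V a (slist S) x [] \<noteq> 0)}"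

lemma leadsI:
  assumes "S \<subseteq> {1..n}" "x \<in> forms K (card S)"
    and "\<And>R. R \<subseteq> {1..n} \<Longrightarrow> card R = card S \<Longrightarrow> lex_less R S \<Longrightarrow> contrs V a (slist R) x [] = 0"
    and "contrs V a (slist S) x [] \<noteq> 0"
  shows "S \<in> leads n V K a"
  unfolding leads_def using assms by blast

lemma set_slist_subset: "R \<subseteq> {1..n::nat} \<Longrightarrow> set (slist R) = R"
  by (meson finite_atLeastAtMost finite_subset set_sorted_list_of_set)

text \<open>A witness for \<open>a\<close> is replaced by a polynomial family \<open>X\<close>;
  since the last contraction is not zero at \<open>a\<close>, it is not identically zero, hence not
  zero at \<open>b\<close>.\<close>

lemma leads_generic_cong:
  assumes V: "finite V" "\<And>S. S \<in> K \<Longrightarrow> S \<subseteq> V"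
    and a: "generic ({1..n} \<times> V) a" and b: "generic ({1..n} \<times> V) b"
  shows "leads n V K a = leads n V K b"
proof -
  have "S \<in> leads n V K b" if S: "S \<in> leads n V K a" and a: "generic ({1..n} \<times> V) a"
    and b: "generic ({1..n} \<times> V) b" for S a b
  proof -
    define Q where "Q = {(slist R, [] :: 'a list) | R. R \<subseteq> {1..n} \<and> card R = card S \<and> lex_less R S}"
    obtain x where x: "x \<in> forms K (card S)" "S \<subseteq> {1..n}"
      "\<And>R. R \<subseteq> {1..n} \<Longrightarrow> card R = card S \<Longrightarrow> lex_less R S \<Longrightarrow> contrs V a (slist R) x [] = 0"
      "contrs V a (slist S) x [] \<noteq> 0"
      using S unfolding leads_def by blast
    have "\<exists>X. (\<forall>l. (\<lambda>M. X M l) \<in> polyfun ({1..n} \<times> V)) \<and> (\<forall>M. X M \<in> forms K (card S)) \<and>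
        (\<forall>R l M. (R, l) \<in> Q \<longrightarrow> contrs V M R (X M) l = 0) \<and> contrs V a (slist S) (X a) [] \<noteq> 0"
    proof (rule polynomial_form_exists[where Q = Q and K = K and x = x, OF V a x(1)])
      show "set R \<subseteq> {1..n}" "contrs V a R x l = 0" if "(R, l) \<in> Q" for R l
      proof -
        obtain T where "R = slist T" "l = []" "T \<subseteq> {1..n}" "card T = card S" "lex_less T S"
          using \<open>(R, l) \<in> Q\<close> unfolding Q_def by blast
        then show "set R \<subseteq> {1..n}" "contrs V a R x l = 0" using x(3) set_slist_subset[of T n] by auto
      qed
      show "set (slist S) \<subseteq> {1..n}" using x(2) by (simp add: set_slist_subset)
    qed (use x(4) in auto)
    then obtain X where X: "\<And>l. (\<lambda>M. X M l) \<in> polyfun ({1..n} \<times> V)" "\<And>M. X M \<in> forms K (card S)"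
      "\<And>R l M. (R, l) \<in> Q \<Longrightarrow> contrs V M R (X M) l = 0" "contrs V a (slist S) (X a) [] \<noteq> 0"
      by blast
    have "contrs V b (slist S) (X b) [] \<noteq> 0"
    proof
      assume 0: "contrs V b (slist S) (X b) [] = 0"
      have "contrs V a (slist S) (X a) [] = 0"
      proof (rule genericD[OF b, where f = "\<lambda>M. contrs V M (slist S) (X M) []"])
        show "(\<lambda>M. contrs V M (slist S) (X M) []) \<in> polyfun ({1..n} \<times> V)"
          using x(2) by (intro contrs_polyfun X(1)) (simp add: set_slist_subset)
      qed (rule 0)
      then show False using X(4) by simp
    qed
    then show ?thesis
      unfolding leads_def using x(2)
      by (intro CollectI conjI bexI[OF _ X(2)[of b]] allI impI X(3)) (auto simp: Q_def)
  qed
  then show ?thesis using a b by blast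
qed

section \<open>Extensions of a prefix\<close>

text \<open>The equations are those of the sets that precede \<open>insert r P\<close> for all
  \<open>r\<close> above the maximum: their first difference \<open>q\<close> from \<open>P\<close>
  lies below the maximum. The contraction along the common beginning is required to vanish as a
  whole form. Inserting 0 gives the empty set the maximum 0.\<close>

definition prefix_forms :: "'a set \<Rightarrow> 'a set set \<Rightarrow> (nat \<times> 'a \<Rightarrow> real) \<Rightarrow> nat set \<Rightarrow> ('a list \<Rightarrow> real) set"
  where "prefix_forms V K a P = {x \<in> forms K (Suc (card P)).
    \<forall>q. q \<in> {1..<Max (insert 0 P)} - P \<longrightarrow>
      (\<forall>l. contrs V a (slist (insert q {s \<in> P. s < q})) x l = 0)}"

text \<open>Contracting with \<open>P\<close> leaves degree one; the result is stored as a finitely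
  supported map, so that \<open>dim\<close> and \<open>span\<close> apply to it.\<close>

definition prefix_vectors :: "'a set \<Rightarrow> 'a set set \<Rightarrow> (nat \<times> 'a \<Rightarrow> real) \<Rightarrow> nat set \<Rightarrow> ('a \<Rightarrow>\<^sub>0 real) set"
  where "prefix_vectors V K a P = {u. \<exists>x\<in>prefix_forms V K a P.
    \<forall>v. Poly_Mapping.lookup u v = contrs V a (slist P) x [v]}"

lemma slist_insert_greater:
  assumes "finite P" "\<And>s. s \<in> P \<Longrightarrow> s < r"
  shows "slist (insert r P) = slist P @ [r]"
proof -
  have "r \<notin> P" using assms(2) by blast
  then show ?thesis
    using assms
    by (subst sorted_list_of_set_unique[symmetric]) (auto simp: sorted_wrt_append)
qed

lemma contrs_form_length:
  assumes "x \<in> forms K k" "contrs V a R x l \<noteq> 0"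
  shows "length R + length l = k"
  using contrs_support[OF assms(2)] formsD(2)[OF assms(1)] by fastforce

lemma contrs_form_set:
  assumes "x \<in> forms K k" "contrs V a R x l \<noteq> 0" "\<And>S. S \<in> K \<Longrightarrow> S \<subseteq> W"
  shows "set l \<subseteq> W"
  using contrs_support[OF assms(2)] formsD(3)[OF assms(1)] assms(3) by fastforce

lemma lex_less_Min:
  assumes "finite S" "finite T" "lex_less S T"
  defines "q \<equiv> Min ((S - T) \<union> (T - S))"
  shows "q \<in> S" "q \<notin> T" "\<And>s. s < q \<Longrightarrow> s \<in> S \<longleftrightarrow> s \<in> T"
proof -
  have ne: "(S - T) \<union> (T - S) \<noteq> {}" and fin: "finite ((S - T) \<union> (T - S))"
    using assms by (auto simp: lex_less_def)
  have "q \<in> (S - T) \<union> (T - S)" unfolding q_def using Min_in[OF fin ne] .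
  moreover show "q \<in> S" using assms(3) by (simp add: lex_less_def q_def)
  ultimately show "q \<notin> T" by blast
  show "s \<in> S \<longleftrightarrow> s \<in> T" if "s < q" for s
    using that Min_le[OF fin, of s] unfolding q_def by (meson DiffI UnI1 UnI2 leD)
qed

lemma lex_lessI:
  assumes "finite S" "finite T" "q \<in> S" "q \<notin> T" "\<And>s. s < q \<Longrightarrow> s \<in> T \<Longrightarrow> s \<in> S"
  shows "lex_less S T"
proof -
  define m where "m = Min ((S - T) \<union> (T - S))"
  have q: "q \<in> (S - T) \<union> (T - S)" and fin: "finite ((S - T) \<union> (T - S))" using assms by auto
  have "m \<le> q" unfolding m_def by (rule Min_le[OF fin q])
  moreover have "m \<in> (S - T) \<union> (T - S)" unfolding m_def by (rule Min_in[OF fin]) (use q in blast)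
  ultimately have "m \<in> S" using assms(3,5) by (cases "m = q") auto
  then show ?thesis using assms(3,4) unfolding lex_less_def m_def by blast
qed

text \<open>Sort the sets \<open>R\<close> by their first difference \<open>q\<close> from
  \<open>insert r P\<close>. If \<open>q\<close> is below the maximum \<open>p\<close> of
  \<open>P\<close>, the part of \<open>R\<close> above \<open>q\<close> is arbitrary, and letting it
  vary shows by injectivity that the contraction along the beginning is zero. If
  \<open>q > p\<close>, counting elements forces \<open>R = insert q P\<close> with
  \<open>q < r\<close>.\<close>

lemma lex_less_insert_iff_forms:
  fixes a :: "nat \<times> 'a \<Rightarrow> real"
  assumes V: "finite V" "\<And>S. S \<in> K \<Longrightarrow> S \<subseteq> V" and gen: "generic ({1..n} \<times> V) a"
    and n: "card V \<le> n" and P: "P \<subseteq> {1..n}" and r: "Max (insert 0 P) < r" "r \<le> n"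
    and x: "x \<in> forms K (Suc (card P))"
  shows "(\<forall>R. R \<subseteq> {1..n} \<and> card R = Suc (card P) \<and> lex_less R (insert r P) \<longrightarrow>
      contrs V a (slist R) x [] = 0) \<longleftrightarrow>
    x \<in> prefix_forms V K a P \<and>
    (\<forall>q. Max (insert 0 P) < q \<and> q < r \<longrightarrow> contrs V a (slist P @ [q]) x [] = 0)"
    (is "?L \<longleftrightarrow> ?R")
proof -
  define p where "p = Max (insert 0 P)"
  have finP: "finite P" using P finite_subset by blast
  have p: "s \<le> p" if "s \<in> P" for s using that finP by (simp add: p_def)
  have p_in: "p \<in> P" if "p \<noteq> 0"
    using Max_in[of "insert 0 P"] finP that by (auto simp: p_def)
  have rP: "r \<notin> P" using p r by (fastforce simp: p_def)
  note alt = formsD(1)[OF x]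
  show ?thesis
  proof
    assume L: ?L
    have "contrs V a (slist P @ [q]) x [] = 0" if q: "p < q" "q < r" for q
    proof -
      have "q \<notin> P" using p q by fastforce
      have "lex_less (insert q P) (insert r P)"
        by (rule lex_lessI[of _ _ q]) (use finP q \<open>q \<notin> P\<close> in auto)
      moreover have "card (insert q P) = Suc (card P)" using finP \<open>q \<notin> P\<close> by simp
      moreover have "insert q P \<subseteq> {1..n}" using P q r by auto
      ultimately have "contrs V a (slist (insert q P)) x [] = 0" using L by blast
      moreover have "slist (insert q P) = slist P @ [q]"
        by (rule slist_insert_greater[OF finP]) (use p q in fastforce)
      ultimately show ?thesis by simp
    qed
    moreover have "contrs V a (slist (insert q {s \<in> P. s < q})) x l = 0"
      if q: "q \<in> {1..<p} - P" for q l
    proof -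
      define A where "A = insert q {s \<in> P. s < q}"
      have "q \<le> n" using q p_in P by fastforce
      then have finA: "finite A" and A: "A \<subseteq> {1..n}" using finP P q by (auto simp: A_def)
      show ?thesis unfolding A_def[symmetric]
      proof (rule ccontr)
        assume nz: "contrs V a (slist A) x l \<noteq> 0"
        \<comment> \<open>Non-vanishing at \<open>l\<close> is tested by contracting with all
          \<open>R\<close> of the length of \<open>l\<close>: a repeated row gives zero, and
          otherwise the rows form a set \<open>B\<close> that precedes
          \<open>insert r P\<close>.\<close>
        have "contrs V a (slist A) x (l @ []) = 0"
        proof (rule contrs_injective[OF V(1) gen n])
          show "set l' \<subseteq> V" if "contrs V a (slist A) x l' \<noteq> 0" for l'
            by (rule contrs_form_set[OF x that V(2)])
          fix R assume R: "set R \<subseteq> {1..n}" "length R = length l"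
          have len: "length (slist A @ R) = Suc (card P)"
            using contrs_form_length[OF x nz] R(2) by simp
          have "contrs V a (slist A @ R) x [] = 0"
          proof (rule ccontr)
            assume nz': "contrs V a (slist A @ R) x [] \<noteq> 0"
            from alternating_distinct[OF alternating_rows[OF alt] nz']
            have dist: "distinct (slist A @ R)" .
            define B where "B = A \<union> set R"
            have B: "B = set (slist A @ R)" using finA by (simp add: B_def)
            have "card B = Suc (card P)" using distinct_card[OF dist] len B by simp
            moreover have "B \<subseteq> {1..n}" using A R by (simp add: B_def)
            moreover have "lex_less B (insert r P)"
              by (rule lex_lessI[of _ _ q]) (use finA finP q r[folded p_def] in \<open>auto simp: B_def A_def\<close>)
            ultimately have "contrs V a (slist B) x [] = 0" using L by blast
            moreover have "contrs V a (slist B) x [] = 0 \<longleftrightarrow> contrs V a (slist A @ R) x [] = 0"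
              by (rule alternating_set_eq_0_iff[OF alternating_rows[OF alt]])
                (use dist finA in \<open>auto simp: B_def\<close>)
            ultimately show False using nz' by blast
          qed
          then show "contrs V a R (contrs V a (slist A) x) [] = 0" by simp
        qed
        then show False using nz by simp
      qed
    qed
    ultimately show ?R using x by (auto simp: prefix_forms_def p_def)
  next
    assume R: ?R
    show ?L
    proof (intro allI impI, elim conjE)
      fix T assume T: "T \<subseteq> {1..n}" "card T = Suc (card P)" "lex_less T (insert r P)"
      have finT: "finite T" using T finite_subset by blast
      define q where "q = Min ((T - insert r P) \<union> (insert r P - T))"
      have q: "q \<in> T" "q \<notin> insert r P" "\<And>s. s < q \<Longrightarrow> s \<in> T \<longleftrightarrow> s \<in> insert r P"
        unfolding q_def using lex_less_Min[OF finT _ T(3)] finP by blast+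
      have "q \<ge> 1" using q(1) T(1) by auto
      show "contrs V a (slist T) x [] = 0"
      proof (cases "q < p")
        case True
        define A where "A = insert q {s \<in> P. s < q}"
        have A: "A \<subseteq> T" using q by (auto simp: A_def)
        have fin: "finite A" "finite (T - A)" using A finT finite_subset by auto
        \<comment> \<open>\<open>T\<close> begins with \<open>A\<close>, whose contraction is
          already the zero form; the remaining rows cannot change this.\<close>
        have "contrs V a (slist A) x = (\<lambda>_. 0)"
          using R True q \<open>q \<ge> 1\<close> by (auto simp: prefix_forms_def A_def p_def)
        then have "contrs V a (slist A @ slist (T - A)) x [] = 0"
          by (simp add: contrs_zero)
        moreover have "contrs V a (slist T) x [] = 0 \<longleftrightarrow>
            contrs V a (slist A @ slist (T - A)) x [] = 0"
          by (rule alternating_set_eq_0_iff[OF alternating_rows[OF alt]])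
            (use A fin finT in auto)
        ultimately show ?thesis by simp
      next
        case False
        have "p \<noteq> q" using p_in q(2) \<open>q \<ge> 1\<close> by (cases "p = 0") auto
        with False have "p < q" by simp
        then have PT: "P \<subseteq> T" using q(3) p by (meson dual_order.strict_trans2 insertCI subsetI)
        have "insert q P \<subseteq> T" "card (insert q P) = card T"
          using PT q finP T by auto
        then have T_eq: "T = insert q P" using card_subset_eq[OF finT] by metis
        have "q < r"
        proof (rule ccontr)
          assume "\<not> q < r"
          then have "r < q" using q(2) by auto
          then have "r \<in> T" using q(3) by blast
          then show False using T_eq rP \<open>r < q\<close> by auto
        qed
        moreover have "slist (insert q P) = slist P @ [q]"
          by (rule slist_insert_greater[OF finP]) (use p \<open>p < q\<close> in fastforce)
        ultimately show ?thesis using R \<open>p < q\<close> by (simp add: T_eq p_def)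
      qed
    qed
  qed
qed

lemma prefix_forms_lin:
  assumes "x \<in> prefix_forms V K a P" "y \<in> prefix_forms V K a P"
  shows "(\<lambda>l. c * x l + d * y l) \<in> prefix_forms V K a P"
  using assms forms_lin[of x K "Suc (card P)" y c d]
  unfolding prefix_forms_def by (auto simp: contrs_lin)

lemma zero_prefix_form: "(\<lambda>_. 0) \<in> prefix_forms V K a P"
  unfolding prefix_forms_def forms_def alternating_def by (auto simp: contrs_zero)

lemma subspace_prefix_vectors: "subspace (prefix_vectors V K a P)"
  unfolding subspace_def
proof (intro conjI ballI allI)
  show "0 \<in> prefix_vectors V K a P"
    unfolding prefix_vectors_def
    by (intro CollectI bexI[OF _ zero_prefix_form]) (simp add: contrs_zero)
  fix u w assume u: "u \<in> prefix_vectors V K a P"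
  then obtain x where x: "x \<in> prefix_forms V K a P"
    "\<forall>v. Poly_Mapping.lookup u v = contrs V a (slist P) x [v]" unfolding prefix_vectors_def by blast
  show "c *\<^sub>R u \<in> prefix_vectors V K a P" for c
    unfolding prefix_vectors_def
    by (intro CollectI bexI[OF _ prefix_forms_lin[OF x(1) zero_prefix_form, of c 0]])
      (use x(2) in \<open>simp add: contrs_lin[where d = 0, simplified]\<close>)
  assume "w \<in> prefix_vectors V K a P"
  then obtain y where y: "y \<in> prefix_forms V K a P"
    "\<forall>v. Poly_Mapping.lookup w v = contrs V a (slist P) y [v]" unfolding prefix_vectors_def by blast
  show "u + w \<in> prefix_vectors V K a P"
    unfolding prefix_vectors_def
    by (intro CollectI bexI[OF _ prefix_forms_lin[OF x(1) y(1), of 1 1]])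
      (use x(2) y(2) in \<open>simp add: contrs_lin[where c = 1 and d = 1, simplified] lookup_add\<close>)
qed

lemma prefix_vectors_subset:
  assumes "\<And>S. S \<in> K \<Longrightarrow> S \<subseteq> W"
  shows "prefix_vectors V K a P \<subseteq> vectors W"
proof
  fix u assume "u \<in> prefix_vectors V K a P"
  then obtain x where x: "x \<in> forms K (Suc (card P))"
    "\<forall>v. Poly_Mapping.lookup u v = contrs V a (slist P) x [v]"
    unfolding prefix_vectors_def prefix_forms_def by blast
  have "v \<in> W" if "Poly_Mapping.lookup u v \<noteq> 0" for v
    using contrs_form_set[OF x(1) _ assms, of V a "slist P" "[v]"] that x(2) by auto
  then show "u \<in> vectors W" by (auto simp: vectors_def in_keys_iff)
qed

text \<open>Row \<open>p + s + 1\<close> acts on \<open>prefix_vectors\<close> as the functional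
  with index \<open>s\<close>, where \<open>p\<close> is the maximum of \<open>P\<close>. By
  \<open>lex_less_insert_iff_forms\<close>, \<open>insert r P\<close> is leading iff the functional
  with index \<open>r - p - 1\<close> is not zero on the common kernel of the earlier ones, which
  \<open>functional_chain\<close> translates into dimensions.\<close>

theorem insert_in_leads_iff:
  fixes a :: "nat \<times> 'a \<Rightarrow> real"
  assumes V: "finite V" "\<And>S. S \<in> K \<Longrightarrow> S \<subseteq> V" and gen: "generic ({1..n} \<times> V) a"
    and n: "card V \<le> n" and P: "P \<subseteq> {1..n}" and r: "Max (insert 0 P) < r"
  shows "insert r P \<in> leads n V K a \<longleftrightarrow> r \<le> Max (insert 0 P) + dim (prefix_vectors V K a P)"
proof -
  define p where "p = Max (insert 0 P)"
  have finP: "finite P" using P finite_subset by blast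
  have p: "s \<le> p" if "s \<in> P" for s using that finP by (simp add: p_def)
  have p_in: "p \<in> P" if "p \<noteq> 0"
    using Max_in[of "insert 0 P"] finP that by (auto simp: p_def)
  have pn: "p \<le> n" using P by (cases "p = 0") (use p_in in auto)
  let ?U = "prefix_vectors V K a P" and ?f = "\<lambda>s. row V a (Suc (p + s))"
  let ?B = "(\<lambda>v. Poly_Mapping.single v (1 :: real)) ` V"
  have row_eq: "row V a q u = contrs V a (slist P @ [q]) x []"
    if "\<forall>v. Poly_Mapping.lookup u v = contrs V a (slist P) x [v]" for q u x
    using that unfolding contrs_snoc_Nil by (simp add: row_def)
  interpret functional_chain ?U ?f ?B "n - p"
  proof
    fix t u assume t: "t < n - p" and u: "u \<in> ?U" "u \<noteq> 0" and 0: "\<And>s. s < t \<Longrightarrow> ?f s u = 0"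
    from u(1) obtain x where x: "x \<in> prefix_forms V K a P"
      "\<forall>v. Poly_Mapping.lookup u v = contrs V a (slist P) x [v]" unfolding prefix_vectors_def by blast
    have x': "x \<in> forms K (Suc (card P))" using x(1) by (simp add: prefix_forms_def)
    obtain v0 where v0: "Poly_Mapping.lookup u v0 \<noteq> 0"
      using u(2) poly_mapping_eqI[of u 0] by auto
    define r where "r = Suc (p + t)"
    \<comment> \<open>All conditions on the form involve rows below \<open>r\<close> only, so that
      row \<open>r\<close> is generic over them.\<close>
    define Q where "Q = {(slist (insert q {s \<in> P. s < q}), l :: 'a list) | q l. q \<in> {1..<p} - P} \<union>
      {(slist P @ [q], []) | q. q \<in> {p<..<r}}"
    have "\<exists>y\<in>forms K (Suc (card P)). (\<forall>(R, l)\<in>Q. contrs V a R y l = 0)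
        \<and> contrs V a (slist P @ [r]) y [] \<noteq> 0"
    proof (rule generic_row[OF V _ _ x', where I = "{1..<r}"])
      show "generic (insert r {1..<r} \<times> V) a"
        by (rule generic_mono[OF gen]) (use t in \<open>auto simp: r_def\<close>)
      show "set R \<subseteq> {1..<r}" if "(R, l) \<in> Q" for R l
      proof -
        have Pp: "P \<subseteq> {1..p}" using P p by auto
        have "set (slist (insert q {s \<in> P. s < q})) \<subseteq> {1..<r}" if "q \<in> {1..<p} - P" for q
          by (subst set_sorted_list_of_set) (use that finP P in \<open>auto simp: r_def\<close>)
        moreover have "set (slist P @ [q]) \<subseteq> {1..<r}" if "q \<in> {p<..<r}" for q
          using that finP Pp by (auto simp: r_def)
        ultimately show ?thesis using \<open>(R, l) \<in> Q\<close> unfolding Q_def by blast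
      qed
      show "contrs V a R x l = 0" if "(R, l) \<in> Q" for R l
      proof -
        have "contrs V a (slist P @ [q]) x [] = 0" if "q \<in> {p<..<r}" for q
          using 0[of "q - Suc p"] that row_eq[OF x(2), of q] by (auto simp: r_def)
        then show ?thesis
          using that x(1) unfolding Q_def prefix_forms_def p_def[symmetric] by blast
      qed
      show "set (slist P) \<subseteq> {1..<r}" using finP P p by (force simp: r_def)
      show "contrs V a (slist P) x [v0] \<noteq> 0" using v0 x(2) by simp
    qed auto
    then obtain y where y: "y \<in> forms K (Suc (card P))" "\<And>R l. (R, l) \<in> Q \<Longrightarrow> contrs V a R y l = 0"
      "contrs V a (slist P @ [r]) y [] \<noteq> 0" by blast
    have y': "y \<in> prefix_forms V K a P"
      using y(1,2) unfolding prefix_forms_def Q_def p_def[symmetric] by blast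
    define w where "w = vector_of V (\<lambda>v. contrs V a (slist P) y [v])"
    have w: "\<forall>v. Poly_Mapping.lookup w v = contrs V a (slist P) y [v]"
      using contrs_form_set[OF y(1) _ V(2), of V a "slist P" "[v]" for v]
      by (auto simp: w_def lookup_vector_of[OF V(1)])
    have "?f s w = 0" if "s < t" for s
      unfolding row_eq[OF w] by (rule y(2)) (use that in \<open>auto simp: Q_def r_def\<close>)
    moreover have "?f t w \<noteq> 0" unfolding row_eq[OF w] using y(3) by (simp add: r_def)
    ultimately show "\<exists>u\<in>?U. (\<forall>s<t. ?f s u = 0) \<and> ?f t u \<noteq> 0"
      using y' w unfolding prefix_vectors_def by blast
  qed (use V prefix_vectors_subset[where K = K and V = V and a = a and P = P, OF V(2)] vectors_span[OF V(1)] subspace_prefix_vectors in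
      \<open>auto simp: linear_add[OF linear_row] linear_scale[OF linear_row]\<close>)
  \<comment> \<open>Rows above \<open>p\<close> separate vectors, because all rows up to
    \<open>p\<close> act as zero: those in \<open>P\<close> by repetition, the others by the
    equations of \<open>prefix_forms\<close>.\<close>
  have inj: "u = 0" if u: "u \<in> ?U" and 0: "\<And>s. s < n - p \<Longrightarrow> ?f s u = 0" for u
  proof -
    from u obtain x where x: "x \<in> prefix_forms V K a P"
      "\<forall>v. Poly_Mapping.lookup u v = contrs V a (slist P) x [v]" unfolding prefix_vectors_def by blast
    have x': "x \<in> forms K (Suc (card P))" using x(1) by (simp add: prefix_forms_def)
    note alt = alternating_rows[OF formsD(1)[OF x'], of V a "[]"]
    have "(\<Sum>v\<in>V. a (q, v) * Poly_Mapping.lookup u v) = 0" if q: "q \<in> {1..n}" for q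
    proof -
      have "contrs V a (slist P @ [q]) x [] = 0"
      proof (cases "p < q")
        case True
        then show ?thesis using 0[of "q - Suc p"] q row_eq[OF x(2), of q] by auto
      next
        case False
        show ?thesis
        proof (cases "q \<in> P")
          case True
          then show ?thesis using alternating_distinct[OF alt] finP by fastforce
        next
          case qP: False
          then have qp: "q \<in> {1..<p} - P" using False p_in q by (cases "p = q") auto
          define A where "A = insert q {s \<in> P. s < q}"
          have "contrs V a (slist A) x = (\<lambda>_. 0)"
            using x(1) qp by (auto simp: prefix_forms_def A_def p_def)
          then have "contrs V a (slist A @ slist (P - A)) x [] = 0"
            by (simp add: contrs_zero)
          moreover have "contrs V a (slist P @ [q]) x [] = 0 \<longleftrightarrow>
              contrs V a (slist A @ slist (P - A)) x [] = 0"
          proof (rule alternating_set_eq_0_iff[OF alt])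
            have A: "finite A" "\<And>s. s \<in> A \<longleftrightarrow> s = q \<or> s \<in> P \<and> s < q" using finP by (auto simp: A_def)
            show "distinct (slist P @ [q])" "distinct (slist A @ slist (P - A))"
              "set (slist P @ [q]) = set (slist A @ slist (P - A))"
              using A finP qP by auto
          qed
          ultimately show ?thesis by simp
        qed
      qed
      then show ?thesis using row_eq[OF x(2), of q] by (simp add: row_def)
    qed
    then have "Poly_Mapping.lookup u v = 0" if "v \<in> V" for v
      using generic_rows_injective[OF V(1) gen n _ that] by blast
    moreover have "u \<in> vectors V"
      using u prefix_vectors_subset[of K V V a P] V(2) by blast
    ultimately have "Poly_Mapping.lookup u v = 0" for v
      using vectors_lookup[of u V v] by blast
    then show "u = 0" by (intro poly_mapping_eqI) simp
  qed
  define t where "t = r - Suc p"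
  have rt: "r = Suc (p + t)" using r by (simp add: t_def p_def)
  have slr: "slist (insert r P) = slist P @ [r]"
    by (rule slist_insert_greater[OF finP]) (use p rt in fastforce)
  have cardr: "card (insert r P) = Suc (card P)"
    using finP p rt by (subst card_insert_disjoint) fastforce+
  have "insert r P \<in> leads n V K a \<longleftrightarrow> r \<le> n \<and> (\<exists>x\<in>prefix_forms V K a P.
      (\<forall>q. p < q \<and> q < r \<longrightarrow> contrs V a (slist P @ [q]) x [] = 0) \<and> contrs V a (slist P @ [r]) x [] \<noteq> 0)"
  proof (cases "r \<le> n")
    case True
    have sub: "insert r P \<subseteq> {1..n}" using P True rt by auto
    have "insert r P \<in> leads n V K a \<longleftrightarrow> (\<exists>x\<in>forms K (Suc (card P)).
        (\<forall>R. R \<subseteq> {1..n} \<and> card R = Suc (card P) \<and> lex_less R (insert r P) \<longrightarrow>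
          contrs V a (slist R) x [] = 0) \<and> contrs V a (slist P @ [r]) x [] \<noteq> 0)"
      unfolding leads_def mem_Collect_eq cardr slr using sub by blast
    also have "\<dots> \<longleftrightarrow> (\<exists>x\<in>forms K (Suc (card P)). (x \<in> prefix_forms V K a P \<and>
        (\<forall>q. p < q \<and> q < r \<longrightarrow> contrs V a (slist P @ [q]) x [] = 0)) \<and>
        contrs V a (slist P @ [r]) x [] \<noteq> 0)"
      unfolding p_def
      by (intro bex_cong refl conj_cong lex_less_insert_iff_forms[OF V gen n P r True]) assumption
    also have "\<dots> \<longleftrightarrow> (\<exists>x\<in>prefix_forms V K a P.
        (\<forall>q. p < q \<and> q < r \<longrightarrow> contrs V a (slist P @ [q]) x [] = 0) \<and>
        contrs V a (slist P @ [r]) x [] \<noteq> 0)"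
      unfolding prefix_forms_def by blast
    finally show ?thesis using True by blast
  next
    case False
    then show ?thesis unfolding leads_def by auto
  qed
  also have "\<dots> \<longleftrightarrow> t < n - p \<and> (\<exists>u\<in>?U. (\<forall>s<t. ?f s u = 0) \<and> ?f t u \<noteq> 0)"
  proof (rule conj_cong)
    show "r \<le> n \<longleftrightarrow> t < n - p" using rt by auto
    have q_iff: "(\<forall>q. p < q \<and> q < r \<longrightarrow> F q) \<longleftrightarrow> (\<forall>s<t. F (Suc (p + s)))" for F
      unfolding rt
      by (metis Suc_le_eq add_Suc add_less_cancel_left le_Suc_ex less_add_Suc1 Suc_less_eq)
    show "(\<exists>x\<in>prefix_forms V K a P. (\<forall>q. p < q \<and> q < r \<longrightarrow> contrs V a (slist P @ [q]) x [] = 0) \<and>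
        contrs V a (slist P @ [r]) x [] \<noteq> 0) \<longleftrightarrow> (\<exists>u\<in>?U. (\<forall>s<t. ?f s u = 0) \<and> ?f t u \<noteq> 0)"
    proof
      assume "\<exists>x\<in>prefix_forms V K a P. (\<forall>q. p < q \<and> q < r \<longrightarrow> contrs V a (slist P @ [q]) x [] = 0) \<and>
        contrs V a (slist P @ [r]) x [] \<noteq> 0"
      then obtain x where x: "x \<in> prefix_forms V K a P"
        "\<forall>s<t. contrs V a (slist P @ [Suc (p + s)]) x [] = 0" "contrs V a (slist P @ [r]) x [] \<noteq> 0"
        unfolding q_iff by blast
      define w where "w = vector_of V (\<lambda>v. contrs V a (slist P) x [v])"
      have x': "x \<in> forms K (Suc (card P))" using x(1) by (simp add: prefix_forms_def)
      have w: "\<forall>v. Poly_Mapping.lookup w v = contrs V a (slist P) x [v]"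
        using contrs_form_set[OF x' _ V(2), of V a "slist P" "[v]" for v]
        by (auto simp: w_def lookup_vector_of[OF V(1)])
      then have "w \<in> ?U" using x(1) unfolding prefix_vectors_def by blast
      moreover have "\<forall>s<t. ?f s w = 0" "?f t w \<noteq> 0"
        using x(2,3) unfolding row_eq[OF w] rt by blast+
      ultimately show "\<exists>u\<in>?U. (\<forall>s<t. ?f s u = 0) \<and> ?f t u \<noteq> 0" by blast
    next
      assume "\<exists>u\<in>?U. (\<forall>s<t. ?f s u = 0) \<and> ?f t u \<noteq> 0"
      then obtain u x where "x \<in> prefix_forms V K a P"
        "\<forall>v. Poly_Mapping.lookup u v = contrs V a (slist P) x [v]"
        "\<forall>s<t. ?f s u = 0" "?f t u \<noteq> 0" unfolding prefix_vectors_def by blast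
      then show "\<exists>x\<in>prefix_forms V K a P. (\<forall>q. p < q \<and> q < r \<longrightarrow> contrs V a (slist P @ [q]) x [] = 0) \<and>
        contrs V a (slist P @ [r]) x [] \<noteq> 0"
        unfolding q_iff using row_eq[of u x] rt by auto
    qed
  qed
  also have "\<dots> \<longleftrightarrow> t < dim ?U" by (rule cut_iff_less_dim[OF inj])
  also have "\<dots> \<longleftrightarrow> r \<le> p + dim ?U" using rt by auto
  finally show ?thesis by (simp add: p_def)
qed

section \<open>Leading sets of a complex\<close>

lemma abstract_complexD:
  assumes "abstract_complex K"
  shows "finite K" "{} \<in> K" "\<And>S. S \<in> K \<Longrightarrow> finite S" "\<And>S T. S \<in> K \<Longrightarrow> T \<subseteq> S \<Longrightarrow> T \<in> K"
    "finite (vertex_set K)" "\<And>S. S \<in> K \<Longrightarrow> S \<subseteq> vertex_set K"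
proof -
  show *: "finite K" "{} \<in> K" "\<And>S. S \<in> K \<Longrightarrow> finite S" "\<And>S T. S \<in> K \<Longrightarrow> T \<subseteq> S \<Longrightarrow> T \<in> K"
    using assms unfolding abstract_complex_def by blast+
  show "S \<subseteq> vertex_set K" if "S \<in> K" for S
    using *(4)[OF that] unfolding vertex_set_def by blast
  have "vertex_set K \<subseteq> \<Union>K" unfolding vertex_set_def by blast
  then show "finite (vertex_set K)" using *(1,3) finite_subset by blast
qed

lemma leads_subset: "S \<in> leads n V K a \<Longrightarrow> S \<subseteq> {1..n}"
  by (simp add: leads_def)

lemma empty_in_leads:
  assumes "{} \<in> K"
  shows "{} \<in> leads n V K a"
proof -
  define x :: "'a list \<Rightarrow> real" where "x l = of_bool (l = [])" for l
  have "x \<in> forms K 0" using assms by (auto simp: forms_def alternating_def x_def)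
  moreover have "\<not> lex_less R {}" if "card R = 0" "R \<subseteq> {1..n}" for R
    using that finite_subset[OF that(2)] by (auto simp: lex_less_def)
  ultimately show ?thesis
    unfolding leads_def
    by (intro CollectI conjI bexI[of _ x]) (auto simp: x_def)
qed

lemma contr_form:
  assumes "abstract_complex K" and x: "x \<in> forms K (Suc k)"
  shows "contr V a i x \<in> forms K k"
  unfolding forms_def
proof (intro CollectI conjI allI impI)
  show "alternating (contr V a i x)" by (rule alternating_contr[OF formsD(1)[OF x]])
  fix l assume "contr V a i x l \<noteq> 0"
  then obtain v where v: "x (v # l) \<noteq> 0"
    using contrs_support[of V a "[i]" x l] by (auto simp: length_Suc_conv)
  show "length l = k" using formsD(2)[OF x v] by simp
  have "set l \<subseteq> set (v # l)" by auto
  then show "set l \<in> K" using abstract_complexD(4)[OF assms(1) formsD(3)[OF x v]] by blast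
qed

text \<open>If \<open>x\<close> witnesses \<open>S\<close>, its contraction with row
  \<open>t\<close> witnesses \<open>S - {t}\<close>: a set \<open>R\<close> containing
  \<open>t\<close> contributes a repeated row, and for other \<open>R\<close> the set
  \<open>insert t R\<close> precedes \<open>S\<close>.\<close>

lemma leads_remove:
  assumes "abstract_complex K" and S: "S \<in> leads n V K a" and t: "t \<in> S"
  shows "S - {t} \<in> leads n V K a"
proof -
  have Sn: "S \<subseteq> {1..n}" using S by (rule leads_subset)
  then have finS: "finite S" using finite_subset by blast
  obtain x where x: "x \<in> forms K (card S)"
    "\<And>R. R \<subseteq> {1..n} \<Longrightarrow> card R = card S \<Longrightarrow> lex_less R S \<Longrightarrow> contrs V a (slist R) x [] = 0"
    "contrs V a (slist S) x [] \<noteq> 0"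
    using S unfolding leads_def by blast
  note alt = alternating_rows[OF formsD(1)[OF x(1)], of V a "[]"]
  have cS: "card S = Suc (card (S - {t}))" using card.remove[OF finS t] .
  have cons: "contrs V a (slist R) (contr V a t x) [] = 0 \<longleftrightarrow> contrs V a (slist (insert t R)) x [] = 0"
    if "finite R" "t \<notin> R" for R
  proof -
    define B where "B = insert t R"
    have B: "finite B" "B = insert t R" using that by (auto simp: B_def)
    have "contrs V a (t # slist R) x [] = 0 \<longleftrightarrow> contrs V a (slist B) x [] = 0"
    proof (rule alternating_set_eq_0_iff[OF alt])
      show "set (t # slist R) = set (slist B)"
        unfolding set_sorted_list_of_set[OF B(1)] using that by (simp add: B(2))
    qed (use that in auto)
    then show ?thesis unfolding B_def by simp
  qed
  have "contrs V a (slist R) (contr V a t x) [] = 0"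
    if R: "R \<subseteq> {1..n}" "card R = card (S - {t})" "lex_less R (S - {t})" for R
  proof -
    have finR: "finite R" using R(1) finite_subset by blast
    show ?thesis
    proof (cases "t \<in> R")
      case True
      then have "\<not> distinct (t # slist R)" using finR by simp
      then have "contrs V a (t # slist R) x [] = 0" using alternating_distinct[OF alt] by blast
      then show ?thesis by simp
    next
      case False
      define q where "q = Min ((R - (S - {t})) \<union> ((S - {t}) - R))"
      have q: "q \<in> R" "q \<notin> S - {t}" "\<And>s. s < q \<Longrightarrow> s \<in> R \<longleftrightarrow> s \<in> S - {t}"
        unfolding q_def using lex_less_Min[OF finR _ R(3)] finS by blast+
      have "lex_less (insert t R) S"
        by (rule lex_lessI[of _ _ q]) (use finR finS q False t in auto)
      moreover have "card (insert t R) = card S" using finR False R(2) cS by simp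
      moreover have "insert t R \<subseteq> {1..n}" using R(1) Sn t by blast
      ultimately show ?thesis using x(2) cons[OF finR False] by blast
    qed
  qed
  moreover have "contrs V a (slist (S - {t})) (contr V a t x) [] \<noteq> 0"
    using cons[of "S - {t}"] finS x(3) t by (simp add: insert_absorb)
  moreover have "contr V a t x \<in> forms K (card (S - {t}))"
    using contr_form[OF assms(1)] x(1) cS by metis
  ultimately show ?thesis unfolding leads_def using Sn by blast
qed

lemma leads_downward:
  assumes "abstract_complex K" "S \<in> leads n V K a" "T \<subseteq> S"
  shows "T \<in> leads n V K a"
proof -
  have "S - U \<in> leads n V K a" if "finite U" "U \<subseteq> S" for U
    using that
  proof (induction U)
    case (insert u U)
    then have "S - U - {u} \<in> leads n V K a"
      by (intro leads_remove[OF assms(1)]) auto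
    then show ?case by (subst Diff_insert)
  qed (use assms in simp)
  moreover have "finite S" using leads_subset[OF assms(2)] finite_subset by blast
  ultimately have "S - (S - T) \<in> leads n V K a" by blast
  then show ?thesis using assms(3) by (simp add: double_diff)
qed

lemma abstract_complex_leads:
  assumes "abstract_complex K"
  shows "abstract_complex (leads n V K a)"
proof -
  have "leads n V K a \<subseteq> Pow {1..n}" using leads_subset by blast
  then have "finite (leads n V K a)" using finite_subset by blast
  moreover have "finite S" if "S \<in> leads n V K a" for S
    using leads_subset[OF that] finite_subset by blast
  moreover have "{} \<in> leads n V K a" by (rule empty_in_leads[OF abstract_complexD(2)[OF assms]])
  moreover have "T \<in> leads n V K a" if "S \<in> leads n V K a" "T \<subseteq> S" for S T
    by (rule leads_downward[OF assms that])
  ultimately show ?thesis unfolding abstract_complex_def by blast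
qed

lemma Max_insert_0_less:
  fixes P :: "nat set"
  assumes "finite P"
  shows "Max (insert 0 P) < r \<longleftrightarrow> 0 < r \<and> (\<forall>s\<in>P. s < r)"
  using assms by simp

lemma insert_max_cases:
  fixes S :: "nat set"
  assumes "finite S" "S \<noteq> {}" "0 \<notin> S"
  obtains r P where "S = insert r P" "r \<notin> P" "Max (insert 0 P) < r"
proof -
  define r where "r = Max S"
  have r: "r \<in> S" "\<And>s. s \<in> S \<Longrightarrow> s \<le> r" using assms by (auto simp: r_def)
  show thesis
  proof (rule that[of r "S - {r}"])
    show "S = insert r (S - {r})" using r by blast
    have "0 < r" using r(1) assms(3) by (cases r) auto
    then show "Max (insert 0 (S - {r})) < r"
      unfolding Max_insert_0_less[OF finite_Diff[OF assms(1)]] using r(2) by fastforce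
  qed simp
qed

text \<open>A set of positive integers is built up by successively adding larger elements.\<close>

lemma complexes_eqI:
  fixes D E :: "nat set set"
  assumes D: "abstract_complex D" and E: "abstract_complex E"
    and pos: "\<And>S. S \<in> D \<Longrightarrow> 0 \<notin> S" "\<And>S. S \<in> E \<Longrightarrow> 0 \<notin> S"
    and ext: "\<And>P r. P \<in> D \<Longrightarrow> P \<in> E \<Longrightarrow> Max (insert 0 P) < r \<Longrightarrow> insert r P \<in> D \<longleftrightarrow> insert r P \<in> E"
  shows "D = E"
proof -
  have "S \<in> D \<longleftrightarrow> S \<in> E" if "finite S" for S
    using that
  proof (induction "card S" arbitrary: S)
    case 0
    then show ?case using D E by (simp add: abstract_complex_def)
  next
    case (Suc k)
    show ?case
    proof (cases "0 \<in> S")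
      case True
      then show ?thesis using pos by blast
    next
      case False
      then obtain r P where S: "S = insert r P" "r \<notin> P" "Max (insert 0 P) < r"
        using insert_max_cases[of S] Suc.hyps(2) Suc.prems by (metis card.empty nat.distinct(1))
      have "P \<in> D \<longleftrightarrow> P \<in> E" using Suc.hyps(1)[of P] Suc.hyps(2) Suc.prems S by simp
      moreover have "P \<in> D" if "S \<in> D" using abstract_complexD(4)[OF D that, of P] S(1) by blast
      moreover have "P \<in> E" if "S \<in> E" using abstract_complexD(4)[OF E that, of P] S(1) by blast
      ultimately show ?thesis using ext[of P r] S(1,3) by blast
    qed
  qed
  then show ?thesis using abstract_complexD(3) D E by blast
qed

lemma leads_pos: "S \<in> leads n V K a \<Longrightarrow> 0 \<notin> S"
  using leads_subset by fastforce

text \<open>The criterion \<open>r \<le> p + dim\<close> of \<open>insert_in_leads_iff\<close> does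
  not mention the number of rows.\<close>

lemma leads_row_bound_indep:
  fixes a :: "nat \<times> 'a \<Rightarrow> real"
  assumes K: "abstract_complex K" and V: "finite V" "\<And>S. S \<in> K \<Longrightarrow> S \<subseteq> V"
    and n: "card V \<le> n" "n \<le> n'" and gen: "generic ({1..n'} \<times> V) a"
  shows "leads n V K a = leads n' V K a"
proof (rule complexes_eqI)
  fix P r assume P: "P \<in> leads n V K a" "P \<in> leads n' V K a" and r: "Max (insert 0 P) < r"
  have gen': "generic ({1..n} \<times> V) a" by (rule generic_mono[OF gen]) (use n in auto)
  show "insert r P \<in> leads n V K a \<longleftrightarrow> insert r P \<in> leads n' V K a"
    using insert_in_leads_iff[OF V gen' n(1) leads_subset[OF P(1)] r]
      insert_in_leads_iff[OF V gen _ leads_subset[OF P(2)] r] n by simp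
qed (auto intro: abstract_complex_leads[OF K] dest: leads_pos)

lemma contrs_column_cong:
  assumes "\<And>l. x l \<noteq> 0 \<Longrightarrow> set l \<subseteq> W" "W \<subseteq> V" "finite V"
  shows "contrs V a R x = contrs W a R x"
  using assms(1)
proof (induction R arbitrary: x)
  case (Cons i R)
  have *: "contr V a i x = contr W a i x"
    unfolding contr_def using assms(2,3) Cons.prems
    by (intro ext sum.mono_neutral_right) fastforce+
  have "set l \<subseteq> W" if nz: "contr W a i x l \<noteq> 0" for l
  proof -
    obtain v where "x (v # l) \<noteq> 0"
      using contrs_support[of W a "[i]" x l] nz by (auto simp: length_Suc_conv)
    then show ?thesis using Cons.prems by fastforce
  qed
  from Cons.IH[OF this] * show ?case by simp
qed simp

lemma leads_column_cong:
  assumes "\<And>S. S \<in> K \<Longrightarrow> S \<subseteq> W" "W \<subseteq> V" "finite V"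
  shows "leads n V K a = leads n W K a"
proof -
  have "contrs V a R x = contrs W a R x" if "x \<in> forms K k" for x k R
    by (rule contrs_column_cong) (use assms formsD(3)[OF that] in auto)
  then show ?thesis unfolding leads_def by (intro Collect_cong conj_cong bex_cong refl) auto
qed

definition shift_closed :: "nat set set \<Rightarrow> bool" where
  "shift_closed D \<longleftrightarrow>
    (\<forall>S\<in>D. \<forall>i j. i \<in> S \<longrightarrow> j \<notin> S \<longrightarrow> 1 \<le> j \<longrightarrow> j < i \<longrightarrow> insert j (S - {i}) \<in> D)"

lemma contrs_map_rows:
  "contrs V (\<lambda>(i, v). a (h i, v)) R x = contrs V a (map h R) x"
  by (induction R arbitrary: x) (simp_all add: contr_def)

text \<open>Exchanging rows \<open>i\<close> and \<open>j\<close> of a generic matrix gives a generic matrix.\<close>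

lemma shift_closed_leads:
  fixes a :: "nat \<times> 'a \<Rightarrow> real"
  assumes V: "finite V" "\<And>S. S \<in> K \<Longrightarrow> S \<subseteq> V" and gen: "generic ({1..n} \<times> V) a"
  shows "shift_closed (leads n V K a)"
  unfolding shift_closed_def
proof (intro ballI allI impI)
  fix S i j assume S: "S \<in> leads n V K a" and ij: "i \<in> S" "j \<notin> S" "1 \<le> j" "j < i"
  have Sn: "S \<subseteq> {1..n}" using S by (rule leads_subset)
  then have finS: "finite S" using finite_subset by blast
  define h where "h = (\<lambda>s. if s = i then j else if s = j then i else s)"
  have hh: "h (h s) = s" for s by (simp add: h_def)
  then have inj: "inj h" by (metis injI)
  have mem: "s \<in> h ` R \<longleftrightarrow> h s \<in> R" for s R
    using image_eqI[of s h "h s" R] by (auto simp: hh)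
  have hn: "s \<in> {1..n} \<Longrightarrow> h s \<in> {1..n}" for s
    using ij Sn by (auto simp: h_def)
  \<comment> \<open>\<open>b\<close> is \<open>a\<close> with rows \<open>i\<close> and
    \<open>j\<close> exchanged; it is generic as well, hence has the same leading sets, and a
    witness for \<open>S\<close> with \<open>b\<close> is one for \<open>T\<close> with
    \<open>a\<close>.\<close>
  define b where "b = (\<lambda>(i, v). a (h i, v))"
  have "generic ({1..n} \<times> V) (a \<circ> map_prod h id)"
  proof (rule generic_reindex[OF gen])
    show "inj_on (map_prod h id) ({1..n} \<times> V)"
      by (rule inj_on_subset[OF prod.inj_map[OF inj inj_on_id] subset_UNIV])
    show "map_prod h id ` ({1..n} \<times> V) \<subseteq> {1..n} \<times> V"
      using hn by (auto simp del: One_nat_def)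
  qed
  moreover have "a \<circ> map_prod h id = b" by (auto simp: b_def)
  ultimately have "S \<in> leads n V K b"
    using S leads_generic_cong[OF V gen] by metis
  then obtain x where x: "x \<in> forms K (card S)"
    "\<And>R. R \<subseteq> {1..n} \<Longrightarrow> card R = card S \<Longrightarrow> lex_less R S \<Longrightarrow> contrs V b (slist R) x [] = 0"
    "contrs V b (slist S) x [] \<noteq> 0"
    unfolding leads_def by blast
  note alt = alternating_rows[OF formsD(1)[OF x(1)], of V a "[]"]
  have hR: "contrs V b (slist R) x [] = 0 \<longleftrightarrow> contrs V a (slist (h ` R)) x [] = 0" if "finite R" for R
    unfolding b_def contrs_map_rows
    by (rule alternating_set_eq_0_iff[OF alt])
      (use that inj in \<open>auto simp: distinct_map intro: inj_on_subset\<close>)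
  define T where "T = insert j (S - {i})"
  have T: "T = h ` S" using ij by (auto simp: T_def h_def image_iff)
  have cT: "card T = card S" unfolding T by (rule card_image) (use inj in \<open>auto intro: inj_on_subset\<close>)
  have finT: "finite T" using finS by (simp add: T_def)
  have "contrs V a (slist R) x [] = 0" if R: "R \<subseteq> {1..n}" "card R = card T" "lex_less R T" for R
  proof -
    have finR: "finite R" using R(1) finite_subset by blast
    define q where "q = Min ((R - T) \<union> (T - R))"
    have q: "q \<in> R" "q \<notin> T" "\<And>s. s < q \<Longrightarrow> s \<in> R \<longleftrightarrow> s \<in> T"
      unfolding q_def using lex_less_Min[OF finR finT R(3)] by blast+
    have "lex_less (h ` R) S"
    \<comment> \<open>If \<open>i\<close> lies in \<open>R\<close> and \<open>j < q\<close>, the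
      exchange brings in \<open>j\<close>, which is missing from \<open>S\<close>, and
      \<open>j\<close> witnesses the order; otherwise \<open>q\<close> is untouched by the exchange
      and witnesses it.\<close>
    proof (cases "j < q \<and> i \<in> R")
      case True
      then have "j \<in> h ` R" unfolding mem by (simp add: h_def)
      then show ?thesis
        by (rule lex_lessI[rotated 2, of j])
          (use True q ij finR finS in \<open>auto simp: mem h_def T_def\<close>)
    next
      case False
      have "q \<noteq> j" using q(2) by (auto simp: T_def)
      have "q \<noteq> i"
        using False q(1) ij \<open>q \<noteq> j\<close> by auto
      have "q \<in> h ` R" unfolding mem using q(1) \<open>q \<noteq> i\<close> \<open>q \<noteq> j\<close> by (simp add: h_def)
      then show ?thesis
      proof (rule lex_lessI[rotated 2])
        show "q \<notin> S" using q(2) \<open>q \<noteq> i\<close> by (simp add: T_def)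
        fix s assume s: "s < q" "s \<in> S"
        have "i < q \<Longrightarrow> j \<in> R" using q(3)[of j] ij by (simp add: T_def)
        then show "s \<in> h ` R" unfolding mem using s q(3)[of s] ij by (auto simp: h_def T_def)
      qed (use finR finS in auto)
    qed
    moreover have "h ` R \<subseteq> {1..n}" using R(1) hn by blast
    moreover have "card (h ` R) = card S"
      using R(2) cT card_image[OF inj_on_subset[OF inj subset_UNIV]] by simp
    ultimately have "contrs V b (slist (h ` R)) x [] = 0" using x(2) by blast
    then have "contrs V a (slist (h ` h ` R)) x [] = 0" using hR finR by blast
    moreover have "h ` h ` R = R" by (simp add: image_image hh)
    ultimately show ?thesis by simp
  qed
  moreover have "contrs V a (slist T) x [] \<noteq> 0" using x(3) hR[OF finS] by (simp add: T)
  moreover have "T \<subseteq> {1..n}" unfolding T using Sn hn by blast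
  ultimately show "insert j (S - {i}) \<in> leads n V K a"
    unfolding T_def[symmetric] leads_def using x(1) cT by auto
qed

section \<open>Disjoint unions\<close>

definition restrict_form :: "'a set \<Rightarrow> ('a list \<Rightarrow> real) \<Rightarrow> 'a list \<Rightarrow> real" where
  "restrict_form W x = (\<lambda>l. if set l \<subseteq> W then x l else 0)"

text \<open>In a disjoint union, a nonempty face lies in the component of any of its vertices; this fails
  for the empty face, so the last contraction does not respect the components.\<close>

lemma contrs_restrict_form:
  assumes K: "abstract_complex K" and W: "\<And>S. S \<in> K \<Longrightarrow> S \<inter> W \<noteq> {} \<Longrightarrow> S \<subseteq> W"
    and x: "x \<in> forms K k" and "l \<noteq> []"
  shows "contrs V a R (restrict_form W x) l = restrict_form W (contrs V a R x) l"
  using assms(4)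
proof (induction R arbitrary: l rule: rev_induct)
  case (snoc i R)
  have "contrs V a R (restrict_form W x) (v # l) = restrict_form W (contrs V a R x) (v # l)" for v
    by (rule snoc.IH) simp
  then have "contrs V a (R @ [i]) (restrict_form W x) l
      = (\<Sum>v\<in>V. a (i, v) * restrict_form W (contrs V a R x) (v # l))"
    by (simp add: contr_def)
  also have "\<dots> = (\<Sum>v\<in>V. if set l \<subseteq> W then a (i, v) * contrs V a R x (v # l) else 0)"
  proof (rule sum.cong)
    fix v
    have "v \<in> W" if nz: "contrs V a R x (v # l) \<noteq> 0" and l: "set l \<subseteq> W"
    proof -
      obtain m where "x (m @ v # l) \<noteq> 0" using contrs_support[OF nz] by blast
      moreover have "set (v # l) \<subseteq> set (m @ v # l)" by auto
      ultimately have "set (v # l) \<in> K"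
        using formsD(3)[OF x] abstract_complexD(4)[OF K] by blast
      moreover have "set (v # l) \<inter> W \<noteq> {}" using l snoc.prems by (cases l) auto
      ultimately show "v \<in> W" using W by fastforce
    qed
    then show "a (i, v) * restrict_form W (contrs V a R x) (v # l)
        = (if set l \<subseteq> W then a (i, v) * contrs V a R x (v # l) else 0)"
      by (auto simp: restrict_form_def)
  qed simp
  also have "\<dots> = restrict_form W (contrs V a (R @ [i]) x) l"
    by (simp add: restrict_form_def contr_def)
  finally show ?case .
qed simp

lemma abstract_complex_Un:
  "abstract_complex K \<Longrightarrow> abstract_complex L \<Longrightarrow> abstract_complex (K \<union> L)"
  unfolding abstract_complex_def by blast

text \<open>On nonempty lists the equations restrict to a component. On the empty list they hold for
  reasons of degree, since fewer than \<open>card P + 1\<close> rows are contracted.\<close>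

lemma restrict_prefix_form:
  fixes K L :: "'a set set"
  assumes K: "abstract_complex K" and L: "abstract_complex L"
    and disj: "vertex_set K \<inter> vertex_set L = {}" and finP: "finite P"
    and x: "x \<in> prefix_forms V (K \<union> L) a P"
  shows "restrict_form (vertex_set K) x \<in> prefix_forms V K a P"
proof -
  let ?W = "vertex_set K"
  have KL: "abstract_complex (K \<union> L)" by (rule abstract_complex_Un[OF K L])
  have x': "x \<in> forms (K \<union> L) (Suc (card P))" using x by (simp add: prefix_forms_def)
  have W: "S \<subseteq> ?W \<and> S \<in> K" if "S \<in> K \<union> L" "S \<inter> ?W \<noteq> {}" for S
    using that disj abstract_complexD(6)[OF K] abstract_complexD(6)[OF L] by blast
  have y: "restrict_form ?W x \<in> forms K (Suc (card P))"
    unfolding forms_def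
  proof (intro CollectI conjI allI impI)
    show "alternating (restrict_form ?W x)"
      unfolding restrict_form_def
      by (rule alternating_if[OF formsD(1)[OF x']]) (simp add: insert_commute)
    fix l assume "restrict_form ?W x l \<noteq> 0"
    then have l: "x l \<noteq> 0" "set l \<subseteq> ?W" by (auto simp: restrict_form_def split: if_splits)
    show "length l = Suc (card P)" by (rule formsD(2)[OF x' l(1)])
    then have "set l \<inter> ?W \<noteq> {}" using l(2) by (cases l) auto
    then show "set l \<in> K" using W formsD(3)[OF x' l(1)] by blast
  qed
  have "contrs V a (slist (insert q {s \<in> P. s < q})) (restrict_form ?W x) l = 0"
    if q: "q \<in> {1..<Max (insert 0 P)} - P" for q l
  proof (cases "l = []")
    case False
    have "contrs V a (slist (insert q {s \<in> P. s < q})) x l = 0"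
      using x q by (auto simp: prefix_forms_def)
    moreover have "contrs V a (slist (insert q {s \<in> P. s < q})) (restrict_form ?W x) l =
        restrict_form ?W (contrs V a (slist (insert q {s \<in> P. s < q})) x) l"
      by (rule contrs_restrict_form[OF KL _ x' False]) (use W in blast)
    ultimately show ?thesis unfolding restrict_form_def by simp
  next
    case True
    let ?A = "insert q {s \<in> P. s < q}" and ?p = "Max (insert 0 P)"
    have "?p \<in> insert 0 P" using finP by (intro Max_in) auto
    moreover have "?p \<noteq> 0" using q by (metis DiffE atLeastLessThan_iff not_less_zero)
    \<comment> \<open>The maximum of \<open>P\<close> is missing from \<open>?A\<close>, which
      therefore has at most \<open>card P\<close> elements.\<close>
    ultimately have "{s \<in> P. s < q} \<subseteq> P - {?p}" "?p \<in> P" using q by auto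
    then have "card {s \<in> P. s < q} < card P"
      using finP by (intro psubset_card_mono) auto
    then have "card ?A < Suc (card P)" using finP q by simp
    then show ?thesis
      using contrs_form_length[OF y, of V a "slist ?A" "[]"] True finP by fastforce
  qed
  then show ?thesis using y unfolding prefix_forms_def by blast
qed

text \<open>A face of size \<open>card P + 1\<close> is nonempty and lies in exactly one component,
  so a form is the sum of its two restrictions. The sum of the vector spaces is direct because their
  supports are disjoint.\<close>

lemma dim_prefix_vectors_Un:
  assumes K: "abstract_complex K" and L: "abstract_complex L"
    and disj: "vertex_set K \<inter> vertex_set L = {}" and finP: "finite P"
    and V: "finite V" "vertex_set K \<union> vertex_set L \<subseteq> V"
  shows "dim (prefix_vectors V (K \<union> L) a P) =
    dim (prefix_vectors V K a P) + dim (prefix_vectors V L a P)"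
proof -
  let ?U = "\<lambda>K. prefix_vectors V K a P"
  have KV: "S \<subseteq> V" if "S \<in> K" for S using abstract_complexD(6)[OF K that] V(2) by blast
  have LV: "S \<subseteq> V" if "S \<in> L" for S using abstract_complexD(6)[OF L that] V(2) by blast
  have lookup: "Poly_Mapping.lookup (vector_of V (\<lambda>v. contrs V a R x [v])) v = contrs V a R x [v]"
    if "x \<in> forms (K \<union> L) k" for x k R v
    using contrs_form_set[OF that, of V a R "[v]" V] KV LV
    by (auto simp: lookup_vector_of[OF V(1)])
  have mono: "prefix_forms V K a P \<subseteq> prefix_forms V (K \<union> L) a P"
    "prefix_forms V L a P \<subseteq> prefix_forms V (K \<union> L) a P"
    by (auto simp: prefix_forms_def forms_def)
  have "?U (K \<union> L) \<subseteq> {u + w | u w. u \<in> ?U K \<and> w \<in> ?U L}"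
  proof
    fix u assume "u \<in> ?U (K \<union> L)"
    then obtain x where x: "x \<in> prefix_forms V (K \<union> L) a P"
      "\<And>v. Poly_Mapping.lookup u v = contrs V a (slist P) x [v]"
      unfolding prefix_vectors_def by blast
    define y z where "y = restrict_form (vertex_set K) x" and "z = restrict_form (vertex_set L) x"
    have y: "y \<in> prefix_forms V K a P"
      unfolding y_def by (rule restrict_prefix_form[OF K L disj finP x(1)])
    have z: "z \<in> prefix_forms V L a P"
      unfolding z_def using restrict_prefix_form[OF L K _ finP, of x V a] disj x(1)
      by (simp add: Un_commute Int_commute)
    have "x l = 1 * y l + 1 * z l" for l
    proof (cases "x l = 0")
      case False
      then have l: "length l = Suc (card P)" "set l \<in> K \<union> L"
        using x(1) by (auto simp: prefix_forms_def dest: formsD)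
      then have "set l \<noteq> {}" by auto
      then have "\<not> (set l \<subseteq> vertex_set K \<and> set l \<subseteq> vertex_set L)"
        using disj by (metis Int_subset_iff subset_empty)
      then show ?thesis
        using l(2) disj abstract_complexD(6)[OF K, of "set l"] abstract_complexD(6)[OF L, of "set l"]
        by (auto simp: y_def z_def restrict_form_def)
    qed (simp add: y_def z_def restrict_form_def)
    then have "x = (\<lambda>l. 1 * y l + 1 * z l)" by blast
    then have x_eq: "contrs V a (slist P) x [v] =
        1 * contrs V a (slist P) y [v] + 1 * contrs V a (slist P) z [v]" for v
      by (simp only: contrs_lin)
    define u1 u2 where "u1 = vector_of V (\<lambda>v. contrs V a (slist P) y [v])"
      and "u2 = vector_of V (\<lambda>v. contrs V a (slist P) z [v])"
    have yz: "y \<in> forms (K \<union> L) (Suc (card P))" "z \<in> forms (K \<union> L) (Suc (card P))"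
      using y z mono by (auto simp: prefix_forms_def)
    have "u = u1 + u2"
      by (rule poly_mapping_eqI) (simp add: x(2) x_eq u1_def u2_def lookup_add lookup[OF yz(1)]
          lookup[OF yz(2)])
    moreover have "u1 \<in> ?U K" "u2 \<in> ?U L"
      unfolding prefix_vectors_def u1_def u2_def using y z lookup[OF yz(1)] lookup[OF yz(2)]
      by blast+
    ultimately show "u \<in> {u + w | u w. u \<in> ?U K \<and> w \<in> ?U L}" by blast
  qed
  moreover have "u + w \<in> ?U (K \<union> L)" if "u \<in> ?U K" "w \<in> ?U L" for u w
    using that mono subspace_add[OF subspace_prefix_vectors] unfolding prefix_vectors_def by blast
  ultimately have eq: "?U (K \<union> L) = {u + w | u w. u \<in> ?U K \<and> w \<in> ?U L}" by blast
  have sub: "?U K \<subseteq> vectors (vertex_set K)" "?U L \<subseteq> vectors (vertex_set L)"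
    using prefix_vectors_subset abstract_complexD(6) K L by blast+
  show ?thesis
    unfolding eq
  proof (rule dim_direct_sum[OF subspace_prefix_vectors _ subspace_prefix_vectors])
    have *: "vectors (vertex_set K) \<subseteq> vectors V" "vectors (vertex_set L) \<subseteq> vectors V"
      using V(2) by (auto simp: vectors_def)
    show "?U K \<subseteq> span ((\<lambda>v. Poly_Mapping.single v 1) ` V)"
      "?U L \<subseteq> span ((\<lambda>v. Poly_Mapping.single v 1) ` V)"
      using sub * vectors_span[OF V(1)] by blast+
    show "?U K \<inter> ?U L \<subseteq> {0}"
    proof
      fix u assume "u \<in> ?U K \<inter> ?U L"
      then have "u \<in> vectors (vertex_set K)" "u \<in> vectors (vertex_set L)" using sub by auto
      then have "Poly_Mapping.lookup u v = 0" for v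
        using vectors_lookup disj by (metis IntI empty_iff)
      then show "u \<in> {0}" using poly_mapping_eqI[of u 0] by simp
    qed
  qed (use V in simp)
qed

text \<open>Recovers the dimension from the leading sets alone, as the length of the interval of
  admissible \<open>r\<close>.\<close>

lemma extension_count:
  fixes a :: "nat \<times> 'a \<Rightarrow> real"
  assumes V: "finite V" "\<And>S. S \<in> K \<Longrightarrow> S \<subseteq> V" and gen: "generic ({1..n} \<times> V) a"
    and n: "card V \<le> n" and P: "P \<subseteq> {1..n}"
  shows "card {r. Max (insert 0 P) < r \<and> insert r P \<in> leads n V K a} = dim (prefix_vectors V K a P)"
proof -
  have "{r. Max (insert 0 P) < r \<and> insert r P \<in> leads n V K a} =
      {Max (insert 0 P)<..Max (insert 0 P) + dim (prefix_vectors V K a P)}"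
    using insert_in_leads_iff[OF V gen n P] by auto
  then show ?thesis by simp
qed

text \<open>With the dimensions replaced by counts, the right-hand side depends on \<open>K\<close>
  and \<open>L\<close> only through their leading sets.\<close>

theorem leads_Un:
  fixes a :: "nat \<times> 'a \<Rightarrow> real"
  assumes K: "abstract_complex K" and L: "abstract_complex L"
    and disj: "vertex_set K \<inter> vertex_set L = {}"
    and V: "finite V" "vertex_set K \<union> vertex_set L \<subseteq> V" and gen: "generic ({1..n} \<times> V) a"
    and n: "card V \<le> n" and P: "P \<subseteq> {1..n}" and r: "Max (insert 0 P) < r"
  shows "insert r P \<in> leads n V (K \<union> L) a \<longleftrightarrow> r \<le> Max (insert 0 P) +
    card {r. Max (insert 0 P) < r \<and> insert r P \<in> leads n V K a} +
    card {r. Max (insert 0 P) < r \<and> insert r P \<in> leads n V L a}"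
proof -
  have KV: "S \<subseteq> V" if "S \<in> K" for S using abstract_complexD(6)[OF K that] V(2) by blast
  have LV: "S \<subseteq> V" if "S \<in> L" for S using abstract_complexD(6)[OF L that] V(2) by blast
  have KLV: "S \<subseteq> V" if "S \<in> K \<union> L" for S using that KV LV by blast
  have "finite P" using P finite_subset by blast
  note dim = dim_prefix_vectors_Un[OF K L disj this V]
  have "insert r P \<in> leads n V (K \<union> L) a \<longleftrightarrow>
      r \<le> Max (insert 0 P) + dim (prefix_vectors V (K \<union> L) a P)"
    by (rule insert_in_leads_iff[OF V(1) KLV gen n P r])
  moreover have "card {r. Max (insert 0 P) < r \<and> insert r P \<in> leads n V K a} =
      dim (prefix_vectors V K a P)"
    by (rule extension_count[OF V(1) KV gen n P])
  moreover have "card {r. Max (insert 0 P) < r \<and> insert r P \<in> leads n V L a} =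
      dim (prefix_vectors V L a P)"
    by (rule extension_count[OF V(1) LV gen n P])
  ultimately show ?thesis by (simp only: dim add.assoc)
qed

section \<open>Shifted complexes\<close>

text \<open>For sets of equal size this is the componentwise order of the increasing enumerations
  (Gale order); counting avoids enumerations.\<close>

definition componentwise_le :: "nat set \<Rightarrow> nat set \<Rightarrow> bool" where
  "componentwise_le A B \<longleftrightarrow> (\<forall>t. card {s \<in> B. s \<le> t} \<le> card {s \<in> A. s \<le> t})"

text \<open>The lists need not be sorted: an element of \<open>m\<close> that is at most
  \<open>t\<close> is matched with an element of \<open>l\<close> that is at most
  \<open>t\<close>.\<close>

lemma componentwise_le_lists:
  assumes "list_all2 (\<le>) l m" "distinct l" "distinct m"
  shows "componentwise_le (set l) (set m)"
proof -
  have card: "card {s \<in> set l. s \<le> t} = length (filter (\<lambda>s. s \<le> t) l)" if "distinct l" for l and t :: nat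
    using distinct_card[OF distinct_filter[OF that]] by simp
  have "length (filter (\<lambda>s. s \<le> t) m) \<le> length (filter (\<lambda>s. s \<le> t) l)" for t
    using assms(1) by (induction rule: list_all2_induct) auto
  then show ?thesis using assms(2,3) by (simp add: componentwise_le_def card)
qed

text \<open>If the first difference \<open>q\<close> belonged to \<open>B\<close>, there would be
  more elements up to \<open>q\<close> in \<open>B\<close> than in \<open>A\<close>.\<close>

lemma componentwise_le_imp_lex_less:
  assumes "finite A" "finite B" "componentwise_le A B" "A \<noteq> B"
  shows "lex_less A B"
proof (rule ccontr)
  assume "\<not> lex_less A B"
  moreover define q where "q = Min ((A - B) \<union> (B - A))"
  moreover have "q \<in> (A - B) \<union> (B - A)"
    unfolding q_def by (rule Min_in) (use assms in auto)
  ultimately have q: "q \<in> B" "q \<notin> A" using assms(4) by (auto simp: lex_less_def)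
  have below: "s \<in> A \<longleftrightarrow> s \<in> B" if "s < q" for s
    using that Min_le[of "(A - B) \<union> (B - A)" s] assms unfolding q_def
    by (meson DiffI UnI1 UnI2 finite_Diff finite_UnI leD)
  have "{s \<in> A. s \<le> q} \<subseteq> {s \<in> B. s \<le> q} - {q}"
    using q(2) below by (auto simp: order.order_iff_strict)
  then have "card {s \<in> A. s \<le> q} < card {s \<in> B. s \<le> q}"
    using q(1) assms(2) by (intro psubset_card_mono) auto
  then show False using assms(3) by (auto simp: componentwise_le_def not_less dest: spec[of _ q])
qed

lemma lex_less_trans:
  assumes "finite A" "finite B" "finite C" "lex_less A B" "lex_less B C"
  shows "lex_less A C"
proof -
  define q where "q = Min ((A - B) \<union> (B - A))"
  define r where "r = Min ((B - C) \<union> (C - B))"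
  have q: "q \<in> A" "q \<notin> B" "\<And>s. s < q \<Longrightarrow> s \<in> A \<longleftrightarrow> s \<in> B"
    unfolding q_def using lex_less_Min[OF assms(1,2,4)] by blast+
  have r: "r \<in> B" "r \<notin> C" "\<And>s. s < r \<Longrightarrow> s \<in> B \<longleftrightarrow> s \<in> C"
    unfolding r_def using lex_less_Min[OF assms(2,3,5)] by blast+
  show ?thesis
  proof (cases "q < r")
    case True
    then show ?thesis by (intro lex_lessI[of _ _ q]) (use assms q r in auto)
  next
    case False
    then have "r < q" using q(2) r(1) by (metis linorder_neqE_nat)
    then show ?thesis by (intro lex_lessI[of _ _ r]) (use assms q r in auto)
  qed
qed

lemma lex_less_asym:
  assumes "finite A" "finite B" "lex_less A B"
  shows "\<not> lex_less B A"
  using lex_less_Min(2)[OF assms] by (auto simp: lex_less_def Un_commute)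

text \<open>Moves \<open>B\<close> towards \<open>A\<close>: the least element \<open>b\<close> of
  \<open>B - A\<close> is replaced by a smaller element \<open>a\<close> of \<open>A - B\<close>,
  which exists because \<open>A\<close> has at least as many elements up to
  \<open>b\<close>.\<close>

lemma shift_closed_componentwise_le:
  assumes D: "shift_closed D"
    and "finite A" "finite B" "card A = card B" "0 \<notin> A" "componentwise_le A B" "B \<in> D"
  shows "A \<in> D"
  using assms(2-)
proof (induction "card (A - B)" arbitrary: B)
  case 0
  then have "A \<subseteq> B" by simp
  then show ?case using 0 card_subset_eq by metis
next
  case (Suc k)
  have "\<not> B \<subseteq> A"
  proof
    assume "B \<subseteq> A"
    then have "B = A" using Suc.prems card_subset_eq by metis
    then show False using Suc.hyps(2) by simp
  qed
  define b where "b = Min (B - A)"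
  have b: "b \<in> B" "b \<notin> A"
    using Min_in[of "B - A"] \<open>\<not> B \<subseteq> A\<close> Suc.prems(2) by (auto simp: b_def)
  have below: "s \<in> A" if "s \<in> B" "s < b" for s
    using that Min_le[of "B - A" s] Suc.prems(2) by (fastforce simp: b_def)
  obtain a where a: "a \<in> A" "a \<notin> B" "a < b"
  proof (rule ccontr)
    assume "\<not> thesis"
    then have "{s \<in> A. s \<le> b} \<subseteq> {s \<in> B. s \<le> b} - {b}"
      using b that by (auto simp: order.order_iff_strict)
    then have "card {s \<in> A. s \<le> b} < card {s \<in> B. s \<le> b}"
      using b(1) Suc.prems(2) by (intro psubset_card_mono) auto
    then show False
      using Suc.prems(5) by (auto simp: componentwise_le_def not_less dest: spec[of _ b])
  qed
  define C where "C = insert a (B - {b})"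
  have "1 \<le> a" using a(1) Suc.prems(4) by (cases a) auto
  then have "C \<in> D"
    using D Suc.prems(6) a b unfolding shift_closed_def C_def by blast
  moreover have "card (A - C) = k"
  proof -
    have "A - C = (A - B) - {a}" using b by (auto simp: C_def)
    then show ?thesis using Suc.hyps(2) Suc.prems(1) a by simp
  qed
  moreover have "card C = card B"
    using card.remove[OF Suc.prems(2) b(1)] Suc.prems(2) a by (simp add: C_def)
  \<comment> \<open>Below \<open>b\<close> all of \<open>C\<close> lies in \<open>A\<close>; from
    \<open>b\<close> on the counts of \<open>C\<close> and \<open>B\<close> agree.\<close>
  moreover have "componentwise_le A C"
    unfolding componentwise_le_def
  proof
    fix t
    show "card {s \<in> C. s \<le> t} \<le> card {s \<in> A. s \<le> t}"
    proof (cases "t < b")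
      case True
      then show ?thesis
        using Suc.prems(1) a below by (intro card_mono) (auto simp: C_def)
    next
      case False
      then have "{s \<in> C. s \<le> t} = insert a ({s \<in> B. s \<le> t} - {b})"
        using a by (auto simp: C_def)
      then have "card {s \<in> C. s \<le> t} = card {s \<in> B. s \<le> t}"
        using card.remove[of "{s \<in> B. s \<le> t}" b] Suc.prems(2) a b False by simp
      then show ?thesis using Suc.prems(5) by (simp add: componentwise_le_def)
    qed
  qed
  moreover have "finite C" using Suc.prems(2) by (simp add: C_def)
  ultimately show ?case using Suc.hyps(1)[of C] Suc.prems by simp
qed

text \<open>The Vandermonde product stands in for the sign of a permutation: all that matters is
  that it is alternating and vanishes exactly on lists with repetitions.\<close>

primrec vandermonde :: "nat list \<Rightarrow> real" where
  "vandermonde [] = 1"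
| "vandermonde (v # l) = (\<Prod>w\<leftarrow>l. real w - real v) * vandermonde l"

lemma vandermonde_swap: "vandermonde (xs @ v # w # ys) = - vandermonde (xs @ w # v # ys)"
  by (induction xs) (simp_all add: algebra_simps)

lemma vandermonde_eq_0_iff: "vandermonde l = 0 \<longleftrightarrow> \<not> distinct l"
  by (induction l) (auto simp: prod_list_zero_iff)

text \<open>For finite \<open>S\<close>, a non-zero multiple of the coordinate functional dual to
  \<open>e_basis S\<close>.\<close>

definition delta_form :: "nat set \<Rightarrow> nat list \<Rightarrow> real" where
  "delta_form S l = (if set l = S then vandermonde l else 0)"

lemma alternating_delta_form: "alternating (delta_form S)"
  unfolding delta_form_def[abs_def]
proof (rule alternating_if)
  show "alternating vandermonde" unfolding alternating_def using vandermonde_swap by blast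
qed (simp add: insert_commute)

lemma delta_form_eq_0_iff: "delta_form S l = 0 \<longleftrightarrow> \<not> (distinct l \<and> set l = S)"
  by (auto simp: delta_form_def vandermonde_eq_0_iff)

text \<open>Contraction is multilinear in the rows: substituting the rows of \<open>w\<close> for
  the vertices and contracting with \<open>a\<close> amounts to contracting with the product matrix.
  This plays the part of the Cauchy-Binet formula.\<close>

lemma contrs_compose:
  assumes "finite V"
  shows "contrs V a R (\<lambda>l. contrs V w l z []) [] =
    contrs V (\<lambda>(i, j). \<Sum>v\<in>V. a (i, v) * w (v, j)) R z []"
proof (induction R arbitrary: z)
  case (Cons i R)
  let ?M = "\<lambda>(i, j). \<Sum>v\<in>V. a (i, v) * w (v, j)"
  have "contr V a i (\<lambda>l. contrs V w l z []) = (\<lambda>l. \<Sum>v\<in>V. a (i, v) * contrs V w l (contr V w v z) [])"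
    by (simp add: contr_def)
  also have "\<dots> = (\<lambda>l. contrs V w l (\<lambda>m. \<Sum>v\<in>V. a (i, v) * contr V w v z m) [])"
    by (simp add: contrs_sum)
  also have "(\<lambda>m. \<Sum>v\<in>V. a (i, v) * contr V w v z m) = contr V ?M i z"
  proof
    fix m
    have "(\<Sum>v\<in>V. a (i, v) * contr V w v z m) = (\<Sum>v\<in>V. \<Sum>j\<in>V. a (i, v) * w (v, j) * z (j # m))"
      by (simp add: contr_def sum_distrib_left mult.assoc)
    also have "\<dots> = (\<Sum>j\<in>V. \<Sum>v\<in>V. a (i, v) * w (v, j) * z (j # m))" by (rule sum.swap)
    also have "\<dots> = contr V ?M i z m" by (simp add: contr_def sum_distrib_right)
    finally show "(\<Sum>v\<in>V. a (i, v) * contr V w v z m) = contr V ?M i z m" .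
  qed
  finally show ?case using Cons.IH by simp
qed simp

text \<open>A lower triangular matrix leads from row \<open>i\<close> only to columns up to
  \<open>i\<close>, that is, from \<open>R\<close> to lists below \<open>R\<close>; by assumption
  \<open>x\<close> sees only \<open>R\<close> itself among them, so the diagonal term alone
  survives.\<close>

lemma contrs_triangular:
  fixes m :: "nat \<times> nat \<Rightarrow> real"
  assumes "finite V" "set R \<subseteq> V" "\<And>i j. i \<in> set R \<Longrightarrow> j \<in> V \<Longrightarrow> i < j \<Longrightarrow> m (i, j) = 0"
    and "\<And>l'. list_all2 (\<le>) l' R \<Longrightarrow> x (l' @ l) \<noteq> 0 \<Longrightarrow> l' = R"
  shows "contrs V m R x l = (\<Prod>r\<leftarrow>R. m (r, r)) * x (R @ l)"
  using assms(2-)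
proof (induction R arbitrary: x)
  case (Cons i R)
  have nz: "m (i, v) = 0 \<or> v \<le> i" if "v \<in> V" for v
    using Cons.prems(2)[of i v] that by force
  have "contrs V m R (contr V m i x) l = (\<Prod>r\<leftarrow>R. m (r, r)) * contr V m i x (R @ l)"
  proof (rule Cons.IH)
    fix l' assume l': "list_all2 (\<le>) l' R" "contr V m i x (l' @ l) \<noteq> 0"
    then obtain v where "v \<in> V" "m (i, v) * x (v # l' @ l) \<noteq> 0"
      unfolding contr_def by (metis (no_types, lifting) sum.neutral)
    then show "l' = R" using Cons.prems(3)[of "v # l'"] l'(1) nz by auto
  qed (use Cons.prems in auto)
  also have "contr V m i x (R @ l) = (\<Sum>v\<in>V. if v = i then m (i, i) * x (i # R @ l) else 0)"
    unfolding contr_def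
  proof (rule sum.cong)
    fix v assume v: "v \<in> V"
    have "list_all2 (\<le>) R R" by (simp add: list_all2_same)
    then have "m (i, v) * x (v # R @ l) = 0" if "v \<noteq> i"
      using nz[OF v] Cons.prems(3)[of "v # R"] that by auto
    then show "m (i, v) * x (v # R @ l) = (if v = i then m (i, i) * x (i # R @ l) else 0)" by auto
  qed simp
  also have "\<dots> = m (i, i) * x (i # R @ l)" using assms(1) Cons.prems(1) by simp
  finally show ?case by simp
qed simp

lemma list_le_sum_eq:
  fixes l m :: "nat list"
  assumes "list_all2 (\<le>) l m" "sum_list l = sum_list m"
  shows "l = m"
  using assms
proof (induction rule: list_all2_induct)
  case (Cons x l y m)
  have "sum_list l \<le> sum_list m"
    using Cons.hyps(2) by (induction rule: list_all2_induct) auto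
  then show ?case using Cons by simp
qed simp

lemma distinct_list_le_eq:
  fixes l m :: "nat list"
  assumes "list_all2 (\<le>) l m" "distinct l" "distinct m" "set l = set m"
  shows "l = m"
proof (rule list_le_sum_eq[OF assms(1)])
  have "mset l = mset m" using assms(2-) set_eq_iff_mset_eq_distinct by blast
  then show "sum_list l = sum_list m" by (metis sum_mset_sum_list)
qed

text \<open>Column operations turn a generic matrix into a lower triangular one, and a shifted complex
  is stable under the corresponding triangular change of coordinates.\<close>

lemma shifted_subset_leads:
  assumes gen: "generic ({1..n} \<times> {1..n}) a" and D: "shift_closed D" "\<And>S. S \<in> D \<Longrightarrow> S \<subseteq> {1..n}"
  shows "D \<subseteq> leads n {1..n} D a"
proof
  fix S assume S: "S \<in> D"
  let ?V = "{1..n}"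
  have Sn: "S \<subseteq> ?V" and finS: "finite S" using D(2)[OF S] finite_subset by auto
  \<comment> \<open>Column \<open>j\<close> of an upper triangular matrix \<open>w\<close>: the
    vector lives on the first \<open>j\<close> vertices, is killed by the rows before
    \<open>j\<close> and not by row \<open>j\<close>. Hence \<open>M\<close>, the product of
    \<open>a\<close> and \<open>w\<close>, is lower triangular with non-zero diagonal.\<close>
  define Q where "Q j u \<longleftrightarrow> (\<forall>v. v \<notin> {1..j} \<longrightarrow> u v = 0) \<and>
    (\<forall>i\<in>{1..<j}. (\<Sum>v\<in>?V. a (i, v) * u v) = 0) \<and> (\<Sum>v\<in>?V. a (j, v) * u v) \<noteq> 0" for j u
  have "\<forall>j\<in>?V. \<exists>u. Q j u"
  proof
    fix j assume j: "j \<in> ?V"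
    have "generic ({1..n} \<times> {1..j}) a" by (rule generic_mono[OF gen]) (use j in auto)
    then have "\<exists>u. (\<forall>v. v \<notin> {1..j} \<longrightarrow> u v = 0) \<and>
        (\<forall>i\<in>{1..j - 1}. (\<Sum>v\<in>{1..j}. a (i, v) * u v) = 0) \<and>
        (\<Sum>v\<in>{1..j}. a (Suc (j - 1), v) * u v) \<noteq> 0"
      by (rule generic_triangular_vector[rotated]) (use j in auto)
    then obtain u where u: "\<And>v. v \<notin> {1..j} \<Longrightarrow> u v = 0"
      "\<And>i. i \<in> {1..j - 1} \<Longrightarrow> (\<Sum>v\<in>{1..j}. a (i, v) * u v) = 0"
      "(\<Sum>v\<in>{1..j}. a (Suc (j - 1), v) * u v) \<noteq> 0"
      by blast
    have "(\<Sum>v\<in>{1..j}. a (i, v) * u v) = (\<Sum>v\<in>?V. a (i, v) * u v)" for i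
      by (rule sum.mono_neutral_left) (use u(1) j in auto)
    then show "\<exists>u. Q j u" unfolding Q_def using u j by (intro exI[of _ u]) auto
  qed
  then obtain u where "\<forall>j\<in>?V. Q j (u j)" using bchoice by blast
  then have u: "\<And>j v. j \<in> ?V \<Longrightarrow> v \<notin> {1..j} \<Longrightarrow> u j v = 0"
    "\<And>j i. j \<in> ?V \<Longrightarrow> i \<in> {1..<j} \<Longrightarrow> (\<Sum>v\<in>?V. a (i, v) * u j v) = 0"
    "\<And>j. j \<in> ?V \<Longrightarrow> (\<Sum>v\<in>?V. a (j, v) * u j v) \<noteq> 0"
    unfolding Q_def by blast+
  define w where "w = (\<lambda>(v, j). u j v)"
  define M where "M = (\<lambda>(i, j). \<Sum>v\<in>?V. a (i, v) * w (v, j))"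
  have M: "M (i, j) = 0" if "i \<in> ?V" "j \<in> ?V" "i < j" for i j
    using u(2)[of j i] that by (simp add: M_def w_def)
  \<comment> \<open>The witness is \<open>delta_form S\<close> in the new coordinates. Since
    \<open>w\<close> is upper triangular, \<open>x\<close> lives on sets componentwise below
    \<open>S\<close>, and these are faces of \<open>D\<close>.\<close>
  define x where "x l = contrs ?V w l (delta_form S) []" for l
  have x_M: "contrs ?V a R x [] = contrs ?V M R (delta_form S) []" for R
    unfolding x_def[abs_def] M_def by (rule contrs_compose) simp
  have alt: "alternating x"
    unfolding x_def[abs_def] by (rule alternating_rows[OF alternating_delta_form])
  have "x \<in> forms D (card S)"
    unfolding forms_def
  proof (intro CollectI conjI allI impI alt)
    fix l assume nz: "x l \<noteq> 0"
    then obtain m where m: "list_all2 (\<lambda>i v. v \<in> ?V \<and> w (i, v) \<noteq> 0) l m" "delta_form S (m @ []) \<noteq> 0"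
      unfolding x_def using contrs_support_entries by blast
    then have S_m: "distinct m" "set m = S" by (auto simp: delta_form_eq_0_iff)
    have dist: "distinct l" by (rule alternating_distinct[OF alt nz])
    have w1: "i \<in> {1..j}" if "j \<in> ?V \<and> w (i, j) \<noteq> 0" for i j
      using u(1)[of j i] that by (auto simp: w_def)
    have l_m: "list_all2 (\<lambda>i j. i \<in> {1..j}) l m"
      by (rule list_all2_mono[OF m(1)]) (use w1 in blast)
    have le: "list_all2 (\<le>) l m" by (rule list_all2_mono[OF l_m]) simp
    have "0 \<notin> set l"
    proof
      assume "0 \<in> set l"
      then obtain k where "k < length l" "l ! k = 0" by (auto simp: in_set_conv_nth)
      then show False using list_all2_nthD[OF l_m, of k] by simp
    qed
    show len: "length l = card S"
      using list_all2_lengthD[OF m(1)] distinct_card[OF S_m(1)] S_m(2) by simp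
    show "set l \<in> D"
    proof (rule shift_closed_componentwise_le[OF D(1)])
      show "componentwise_le (set l) S"
        using componentwise_le_lists[OF le dist S_m(1)] S_m(2) by simp
      show "card (set l) = card S" using distinct_card[OF dist] len by simp
    qed (use finS S \<open>0 \<notin> set l\<close> in auto)
  qed
  moreover have "contrs ?V a (slist R) x [] = 0"
    if R: "R \<subseteq> {1..n}" "card R = card S" "lex_less R S" for R
  proof (rule ccontr)
    have finR: "finite R" using R(1) finite_subset by blast
    \<comment> \<open>Triangularity of \<open>M\<close> would put \<open>S\<close> componentwise
      below \<open>R\<close>, so that \<open>S\<close> would precede \<open>R\<close>.\<close>
    assume "contrs ?V a (slist R) x [] \<noteq> 0"
    then obtain m where m: "list_all2 (\<lambda>i v. v \<in> ?V \<and> M (i, v) \<noteq> 0) (slist R) m"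
      "delta_form S (m @ []) \<noteq> 0"
      unfolding x_M using contrs_support_entries by blast
    then have S_m: "distinct m" "set m = S" by (auto simp: delta_form_eq_0_iff)
    have "list_all2 (\<lambda>i v. v \<le> i) (slist R) m"
    proof (rule list_all2_all_nthI)
      show len: "length (slist R) = length m" by (rule list_all2_lengthD[OF m(1)])
      fix k assume k: "k < length (slist R)"
      then have "slist R ! k \<in> ?V" using R(1) finR nth_mem[OF k] by auto
      then show "m ! k \<le> slist R ! k"
        using list_all2_nthD[OF m(1) k] M by (metis not_le)
    qed
    then have "componentwise_le S R"
      using componentwise_le_lists[of m "slist R"] S_m finR
      by (auto simp: list_all2_conv_all_nth)
    moreover have "S \<noteq> R" using R(3) by (auto simp: lex_less_def)
    ultimately show False
      using componentwise_le_imp_lex_less[OF finS finR] lex_less_asym[OF finR finS R(3)] by blast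
  qed
  moreover have "contrs ?V a (slist S) x [] \<noteq> 0"
  proof -
    have "contrs ?V M (slist S) (delta_form S) [] =
        (\<Prod>r\<leftarrow>slist S. M (r, r)) * delta_form S (slist S @ [])"
    proof (rule contrs_triangular)
      show "M (i, j) = 0" if "i \<in> set (slist S)" "j \<in> ?V" "i < j" for i j
        using M that Sn finS by auto
      show "l = slist S" if "list_all2 (\<le>) l (slist S)" "delta_form S (l @ []) \<noteq> 0" for l
        using distinct_list_le_eq[OF that(1)] that(2) finS by (auto simp: delta_form_eq_0_iff)
    qed (use Sn finS in auto)
    moreover have "M (r, r) \<noteq> 0" if "r \<in> S" for r
      using u(3)[of r] that Sn by (auto simp: M_def w_def)
    then have "(\<Prod>r\<leftarrow>slist S. M (r, r)) \<noteq> 0"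
      using finS by (auto simp: prod_list_zero_iff)
    moreover have "delta_form S (slist S) \<noteq> 0" using finS by (auto simp: delta_form_eq_0_iff)
    ultimately show ?thesis unfolding x_M by simp
  qed
  ultimately show "S \<in> leads n ?V D a" unfolding leads_def using Sn by blast
qed

text \<open>Expand each row of \<open>a\<close> in the rows of \<open>b\<close> with at most the
  same index; by multilinearity some term of the expansion is non-zero.\<close>

lemma contrs_span:
  fixes a b :: "nat \<times> 'a \<Rightarrow> real"
  assumes V: "finite V"
    and span: "\<And>i. i \<in> set R \<Longrightarrow>
      vector_of V (\<lambda>v. a (i, v)) \<in> span ((\<lambda>j. vector_of V (\<lambda>v. b (j, v))) ` {1..i})"
    and nz: "contrs V a R x l \<noteq> 0"
  shows "\<exists>R'. list_all2 (\<lambda>j i. 1 \<le> j \<and> j \<le> i) R' R \<and> contrs V b R' x l \<noteq> 0"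
  using span nz
proof (induction R arbitrary: x)
  case (Cons i R)
  define g where "g u = contrs V a R (\<lambda>l. \<Sum>v\<in>V. Poly_Mapping.lookup u v * x (v # l)) l" for u
  have g_sum: "g u = (\<Sum>v\<in>V. Poly_Mapping.lookup u v * contrs V a R (\<lambda>l. x (v # l)) l)" for u
    by (simp add: g_def contrs_sum)
  have g_row: "g (vector_of V (\<lambda>v. c (j, v))) = contrs V a R (contr V c j x) l" for c :: "nat \<times> 'a \<Rightarrow> real" and j
    unfolding g_def contr_def using V by (simp add: lookup_vector_of cong: sum.cong)
  have lin: "linear g"
    by (rule linearI) (simp_all add: g_sum lookup_add algebra_simps sum.distrib sum_distrib_left)
  have "\<exists>j\<in>{1..i}. g (vector_of V (\<lambda>v. b (j, v))) \<noteq> 0"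
  proof (rule ccontr)
    assume "\<not> ?thesis"
    then have "g u = 0" if "u \<in> (\<lambda>j. vector_of V (\<lambda>v. b (j, v))) ` {1..i}" for u
      using that by blast
    then have "g (vector_of V (\<lambda>v. a (i, v))) = 0"
      using linear_eq_0_on_span[OF lin] Cons.prems(1)[of i] by auto
    then show False using Cons.prems(2) by (simp add: g_row)
  qed
  then obtain j where j: "j \<in> {1..i}" "contrs V a R (contr V b j x) l \<noteq> 0"
    unfolding g_row by blast
  obtain R' where "list_all2 (\<lambda>j i. 1 \<le> j \<and> j \<le> i) R' R" "contrs V b R' (contr V b j x) l \<noteq> 0"
    using Cons.IH[OF Cons.prems(1) j(2)] by auto
  then show ?case using j(1) by (intro exI[of _ "j # R'"]) auto
qed auto

text \<open>Row operations turn a generic matrix into an upper triangular one without changing the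
  leading sets.\<close>

lemma leads_subset_shifted:
  assumes gen: "generic ({1..n} \<times> {1..n}) a" and D: "shift_closed D" "\<And>S. S \<in> D \<Longrightarrow> S \<subseteq> {1..n}"
  shows "leads n {1..n} D a \<subseteq> D"
proof
  let ?V = "{1..n}"
  fix S assume S: "S \<in> leads n ?V D a"
  have Sn: "S \<subseteq> ?V" and finS: "finite S" using leads_subset[OF S] finite_subset by auto
  \<comment> \<open>Row operations come from \<open>generic_triangular_vector\<close> applied to the
    transposed matrix, which is generic too.\<close>
  have "generic (?V \<times> ?V) (a \<circ> prod.swap)"
    by (rule generic_reindex[OF gen]) auto
  then have genT: "generic (?V \<times> ?V) (\<lambda>(v, i). a (i, v))"
    by (simp add: comp_def prod.swap_def case_prod_unfold)
  \<comment> \<open>Coefficients of a combination of the rows up to \<open>i\<close> that is zero in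
    the columns before \<open>i\<close>; \<open>u i \<noteq> 0\<close> makes the change of rows
    invertible.\<close>
  define Q where "Q i u \<longleftrightarrow> u i \<noteq> 0 \<and> (\<forall>v\<in>{1..<i}. (\<Sum>j\<in>{1..i}. u j * a (j, v)) = 0)" for i u
  have "\<forall>i\<in>?V. \<exists>u. Q i u"
  proof
    fix i assume i: "i \<in> ?V"
    have g1: "generic ({1..i} \<times> {1..i}) (\<lambda>(v, i). a (i, v))"
      by (rule generic_mono[OF genT]) (use i in auto)
    have g2: "generic ({1..i - 1} \<times> {1..i - 1}) (\<lambda>(v, i). a (i, v))"
      by (rule generic_mono[OF genT]) (use i in auto)
    have "\<exists>u. (\<forall>v. v \<notin> {1..i} \<longrightarrow> u v = 0) \<and>
        (\<forall>v\<in>{1..i - 1}. (\<Sum>j\<in>{1..i}. (\<lambda>(v, i). a (i, v)) (v, j) * u j) = 0) \<and>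
        (\<Sum>j\<in>{1..i}. (\<lambda>(v, i). a (i, v)) (Suc (i - 1), j) * u j) \<noteq> 0"
      by (rule generic_triangular_vector[OF _ g1]) (use i in auto)
    moreover have "Suc (i - 1) = i" using i by simp
    ultimately obtain u where u: "\<And>v. v \<in> {1..i - 1} \<Longrightarrow> (\<Sum>j\<in>{1..i}. a (j, v) * u j) = 0"
      "(\<Sum>j\<in>{1..i}. a (j, i) * u j) \<noteq> 0"
      by fastforce
    have ins: "{1..i} = insert i {1..i - 1}" using i by auto
    \<comment> \<open>Otherwise a combination of the first \<open>i - 1\<close> rows would vanish in
      the first \<open>i - 1\<close> columns, and a generic square matrix allows only the zero
      combination.\<close>
    have "u i \<noteq> 0"
    proof
      assume ui: "u i = 0"
      have sum: "(\<Sum>j\<in>{1..i}. a (j, v) * u j) = (\<Sum>j\<in>{1..i - 1}. a (j, v) * u j)" for v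
        using ui i unfolding ins by (subst sum.insert) auto
      have "u j = 0" if "j \<in> {1..i - 1}" for j
      proof (rule generic_rows_injective[OF _ g2 _ _ that])
        fix v assume "v \<in> {1..i - 1}"
        from u(1)[OF this] show "(\<Sum>j\<in>{1..i - 1}. (\<lambda>(v, i). a (i, v)) (v, j) * u j) = 0"
          unfolding sum by simp
      qed auto
      then show False using u(2) unfolding sum by simp
    qed
    then show "\<exists>u. Q i u"
      unfolding Q_def using u(1) by (intro exI[of _ u]) (auto simp: mult.commute)
  qed
  then obtain u where "\<forall>i\<in>?V. Q i (u i)" using bchoice by blast
  then have u: "\<And>i. i \<in> ?V \<Longrightarrow> u i i \<noteq> 0"
    "\<And>i v. i \<in> ?V \<Longrightarrow> v \<in> {1..<i} \<Longrightarrow> (\<Sum>j\<in>{1..i}. u i j * a (j, v)) = 0"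
    unfolding Q_def by blast+
  define b where "b = (\<lambda>(i, v). \<Sum>j\<in>{1..i}. u i j * a (j, v))"
  define A where "A i = vector_of ?V (\<lambda>v. a (i, v))" for i
  define B where "B i = vector_of ?V (\<lambda>v. b (i, v))" for i
  have B_eq: "B i = (\<Sum>j\<in>{1..i}. u i j *\<^sub>R A j)" for i
    by (rule poly_mapping_eqI) (auto simp: A_def B_def b_def lookup_sum lookup_vector_of)
  have B_span: "B i \<in> span (A ` {1..i})" for i
    unfolding B_eq by (intro span_sum span_scale span_base) auto
  \<comment> \<open>A triangular matrix with non-zero diagonal is inverted recursively, so initial
    segments of the rows of \<open>a\<close> and \<open>b\<close> span the same spaces.\<close>
  have A_span: "A i \<in> span (B ` {1..i})" if "i \<in> ?V" for i
    using that
  proof (induction i rule: less_induct)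
    case (less i)
    have IH: "A j \<in> span (B ` {1..i})" if "j \<in> {1..i - 1}" for j
    proof -
      have "j < i" "j \<in> ?V" using that less.prems by auto
      then have "A j \<in> span (B ` {1..j})" by (rule less.IH)
      moreover have "B ` {1..j} \<subseteq> B ` {1..i}" using \<open>j < i\<close> by auto
      ultimately show ?thesis using span_mono by blast
    qed
    have ins: "{1..i} = insert i {1..i - 1}" using less.prems by auto
    have "B i = u i i *\<^sub>R A i + (\<Sum>j\<in>{1..i - 1}. u i j *\<^sub>R A j)"
      unfolding B_eq using less.prems by (subst ins, subst sum.insert) auto
    then have "A i = (1 / u i i) *\<^sub>R (B i - (\<Sum>j\<in>{1..i - 1}. u i j *\<^sub>R A j))"
      using u(1)[OF less.prems] by simp
    also have "\<dots> \<in> span (B ` {1..i})"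
      by (intro span_scale span_diff span_sum IH span_base) (use less.prems in auto)
    finally show ?case .
  qed
  obtain x where x: "x \<in> forms D (card S)"
    "\<And>R. R \<subseteq> {1..n} \<Longrightarrow> card R = card S \<Longrightarrow> lex_less R S \<Longrightarrow> contrs ?V a (slist R) x [] = 0"
    "contrs ?V a (slist S) x [] \<noteq> 0"
    using S unfolding leads_def by blast
  note alt_a = alternating_rows[OF formsD(1)[OF x(1)], of ?V a "[]"]
  note alt_b = alternating_rows[OF formsD(1)[OF x(1)], of ?V b "[]"]
  have bound: "componentwise_le (set l) (set m) \<and> set l \<subseteq> ?V \<and> length l = length m"
    if "list_all2 (\<lambda>j i. 1 \<le> j \<and> j \<le> i) l m" "distinct l" "distinct m" "set m \<subseteq> ?V" for l m
  proof -
    have "list_all2 (\<le>) l m" by (rule list_all2_mono[OF that(1)]) blast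
    moreover have "set l \<subseteq> ?V"
      using that(1,4) by (fastforce simp: list_all2_conv_all_nth in_set_conv_nth subset_iff)
    ultimately show ?thesis
      using componentwise_le_lists that(2,3) list_all2_lengthD by blast
  qed
  have "A i \<in> span (B ` {1..i})" if "i \<in> set (slist S)" for i
    using A_span that Sn finS by auto
  then have "\<exists>R. list_all2 (\<lambda>j i. 1 \<le> j \<and> j \<le> i) R (slist S) \<and> contrs ?V b R x [] \<noteq> 0"
    unfolding A_def B_def by (intro contrs_span[OF _ _ x(3)]) simp_all
  then obtain R where R: "list_all2 (\<lambda>j i. 1 \<le> j \<and> j \<le> i) R (slist S)" "contrs ?V b R x [] \<noteq> 0"
    by blast
  have distR: "distinct R" by (rule alternating_distinct[OF alt_b R(2)])
  have R_S: "componentwise_le (set R) S" "set R \<subseteq> ?V" "length R = card S"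
    using bound[OF R(1) distR] Sn finS by auto
  \<comment> \<open>Going from \<open>a\<close> to \<open>b\<close> and back to \<open>a\<close>
    only lowers the rows; if \<open>set R\<close> were not \<open>S\<close>, a set before
    \<open>S\<close> would have a non-zero contraction with \<open>a\<close>.\<close>
  have "set R = S"
  proof (rule ccontr)
    assume "set R \<noteq> S"
    then have RS: "lex_less (set R) S"
      using componentwise_le_imp_lex_less[OF _ finS R_S(1)] by simp
    have "\<exists>T. list_all2 (\<lambda>j i. 1 \<le> j \<and> j \<le> i) T R \<and> contrs ?V a T x [] \<noteq> 0"
      by (rule contrs_span[OF _ B_span[unfolded A_def B_def] R(2)]) simp
    then obtain T where T: "list_all2 (\<lambda>j i. 1 \<le> j \<and> j \<le> i) T R" "contrs ?V a T x [] \<noteq> 0"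
      by blast
    have distT: "distinct T" by (rule alternating_distinct[OF alt_a T(2)])
    have T_R: "componentwise_le (set T) (set R)" "set T \<subseteq> ?V" "length T = card S"
      using bound[OF T(1) distT distR R_S(2)] R_S(3) by auto
    have "lex_less (set T) S"
      using componentwise_le_imp_lex_less[OF _ _ T_R(1)] lex_less_trans[OF _ _ finS _ RS] RS
      by (cases "set T = set R") auto
    moreover have "card (set T) = card S" using distinct_card[OF distT] T_R(3) by simp
    ultimately have "contrs ?V a (slist (set T)) x [] = 0" using x(2) T_R(2) by blast
    moreover have "contrs ?V a (slist (set T)) x [] = 0 \<longleftrightarrow> contrs ?V a T x [] = 0"
      by (rule alternating_set_eq_0_iff[OF alt_a]) (use distT in auto)
    ultimately show False using T(2) by blast
  qed
  \<comment> \<open>As \<open>b\<close> is upper triangular, a face supporting the contraction lies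
    componentwise above \<open>S\<close>.\<close>
  obtain m where m: "list_all2 (\<lambda>i v. v \<in> ?V \<and> b (i, v) \<noteq> 0) R m" "x (m @ []) \<noteq> 0"
    using contrs_support_entries[OF R(2)] by blast
  then have xm: "x m \<noteq> 0" by simp
  have distm: "distinct m" by (rule alternating_distinct[OF formsD(1)[OF x(1)] xm])
  have b0: "i \<le> v" if "i \<in> ?V" "v \<in> ?V \<and> b (i, v) \<noteq> 0" for i v
    using u(2)[of i v] that by (fastforce simp: b_def)
  have "list_all2 (\<le>) R m"
  proof (rule list_all2_all_nthI)
    show len: "length R = length m" by (rule list_all2_lengthD[OF m(1)])
    fix k assume k: "k < length R"
    then have "R ! k \<in> ?V" using R_S(2) nth_mem by blast
    then show "R ! k \<le> m ! k" using list_all2_nthD[OF m(1) k] b0 by blast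
  qed
  then have le: "componentwise_le S (set m)"
    using componentwise_le_lists[OF _ distR distm] \<open>set R = S\<close> by simp
  show "S \<in> D"
  proof (rule shift_closed_componentwise_le[OF D(1) finS _ _ _ le formsD(3)[OF x(1) xm]])
    show "card S = card (set m)"
      using distinct_card[OF distm] formsD(2)[OF x(1) xm] by simp
    show "0 \<notin> S" using Sn by auto
  qed simp
qed

section \<open>The exterior algebra\<close>

lemma wedge_superset:
  assumes "finite A" "finite B" "Poly_Mapping.keys x \<subseteq> A" "Poly_Mapping.keys y \<subseteq> B"
  shows "wedge x y =
    (\<Sum>S\<in>A. \<Sum>T\<in>B. (Poly_Mapping.lookup x S * Poly_Mapping.lookup y T) *\<^sub>R e_wedge S T)"
proof -
  have "wedge x y = (\<Sum>S\<in>A. \<Sum>T\<in>Poly_Mapping.keys y.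
      (Poly_Mapping.lookup x S * Poly_Mapping.lookup y T) *\<^sub>R e_wedge S T)"
    unfolding wedge_def using assms
    by (intro sum.mono_neutral_left) (auto simp: not_in_keys_iff_lookup_eq_zero)
  also have "\<dots> = (\<Sum>S\<in>A. \<Sum>T\<in>B. (Poly_Mapping.lookup x S * Poly_Mapping.lookup y T) *\<^sub>R e_wedge S T)"
    using assms
    by (intro sum.cong sum.mono_neutral_left refl) (auto simp: not_in_keys_iff_lookup_eq_zero)
  finally show ?thesis .
qed

lemma keys_scaleR_subset: "Poly_Mapping.keys (c *\<^sub>R (x :: 'a \<Rightarrow>\<^sub>0 real)) \<subseteq> Poly_Mapping.keys x"
  by (auto simp: in_keys_iff)

lemma linear_wedge_right: "linear (wedge x)"
proof (rule linearI)
  fix y z :: ext and c :: real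
  let ?A = "Poly_Mapping.keys x" and ?B = "Poly_Mapping.keys y \<union> Poly_Mapping.keys z"
  have "Poly_Mapping.keys (y + z) \<subseteq> ?B" by (rule Poly_Mapping.keys_add)
  then show "wedge x (y + z) = wedge x y + wedge x z"
    by (simp add: wedge_superset[of ?A ?B] lookup_add sum.distrib[symmetric] algebra_simps)
  show "wedge x (c *\<^sub>R y) = c *\<^sub>R wedge x y"
    using keys_scaleR_subset[of c y]
    by (simp add: wedge_superset[of ?A "Poly_Mapping.keys y"] scaleR_right.sum mult.left_commute)
qed

lemma linear_wedge_left: "linear (\<lambda>x. wedge x y)"
proof (rule linearI)
  fix x z :: ext and c :: real
  let ?A = "Poly_Mapping.keys x \<union> Poly_Mapping.keys z" and ?B = "Poly_Mapping.keys y"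
  have "Poly_Mapping.keys (x + z) \<subseteq> ?A" by (rule Poly_Mapping.keys_add)
  then show "wedge (x + z) y = wedge x y + wedge z y"
    by (simp add: wedge_superset[of ?A ?B] lookup_add sum.distrib[symmetric] algebra_simps)
  show "wedge (c *\<^sub>R x) y = c *\<^sub>R wedge x y"
    using keys_scaleR_subset[of c x]
    by (simp add: wedge_superset[of "Poly_Mapping.keys x" ?B] scaleR_right.sum mult.assoc)
qed

lemma wedge_e_basis: "wedge (e_basis S) (e_basis T) = e_wedge S T"
  by (simp add: wedge_def e_basis_def)

lemma ext_eq_sum_basis:
  "x = (\<Sum>T\<in>Poly_Mapping.keys x. Poly_Mapping.lookup x T *\<^sub>R e_basis T)"
  by (rule poly_mapping_eqI)
    (simp add: lookup_sum e_basis_def lookup_single when_def if_distrib not_in_keys_iff_lookup_eq_zero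
      cong: if_cong)

lemma linear_eqI_basis:
  assumes "linear f" "linear g" "\<And>T. f (e_basis T) = g (e_basis T)"
  shows "f x = g x"
  by (subst (1 2) ext_eq_sum_basis)
    (simp add: linear_sum[OF assms(1)] linear_sum[OF assms(2)] linear_scale[OF assms(1)]
      linear_scale[OF assms(2)] assms(3))

lemma wedge_vertex_basis:
  "wedge (e_basis {v}) (e_basis T) =
    (if v \<in> T then 0 else (- 1) ^ card {t \<in> T. t < v} *\<^sub>R e_basis (insert v T))"
proof -
  have "{(s, t). s \<in> {v} \<and> t \<in> T \<and> t < s} = Pair v ` {t \<in> T. t < v}" by auto
  then have "card {(s, t). s \<in> {v} \<and> t \<in> T \<and> t < s} = card {t \<in> T. t < v}"
    by (simp add: card_image inj_on_def)
  then show ?thesis by (simp add: wedge_e_basis e_wedge_def)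
qed

lemma wedge_vertex_swap_basis:
  assumes "v < w"
  shows "wedge (e_basis {v}) (wedge (e_basis {w}) (e_basis T)) =
    - wedge (e_basis {w}) (wedge (e_basis {v}) (e_basis T))"
proof (cases "v \<in> T \<or> w \<in> T")
  case True
  then show ?thesis
    by (auto simp: wedge_vertex_basis linear_scale[OF linear_wedge_right] linear_0[OF linear_wedge_right])
next
  case False
  \<comment> \<open>Inserting \<open>w\<close> leaves the number of elements below \<open>v\<close>
    unchanged, inserting \<open>v\<close> raises the number below \<open>w\<close> by one: this
    gives the sign.\<close>
  have 1: "{t. (t = w \<or> t \<in> T) \<and> t < v} = {t \<in> T. t < v}" using assms by auto
  have "{t. (t = v \<or> t \<in> T) \<and> t < w} = insert v {t \<in> T. t < w}" using assms by auto
  then have 2: "card {t. (t = v \<or> t \<in> T) \<and> t < w} = Suc (card {t \<in> T. t < w})"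
    using False by simp
  show ?thesis
    using False assms
    by (simp add: wedge_vertex_basis linear_scale[OF linear_wedge_right] 1 2 insert_commute
        mult.commute)
qed

lemma wedge_vertex_swap:
  "wedge (e_basis {v}) (wedge (e_basis {w}) x) = - wedge (e_basis {w}) (wedge (e_basis {v}) x)"
proof (rule linear_eqI_basis[where f = "\<lambda>x. wedge (e_basis {v}) (wedge (e_basis {w}) x)"
      and g = "\<lambda>x. - wedge (e_basis {w}) (wedge (e_basis {v}) x)"])
  show "linear (\<lambda>x. wedge (e_basis {v}) (wedge (e_basis {w}) x))"
    using linear_compose[OF linear_wedge_right linear_wedge_right] by (simp add: comp_def)
  show "linear (\<lambda>x. - wedge (e_basis {w}) (wedge (e_basis {v}) x))"
    using linear_compose_neg[OF linear_compose[OF linear_wedge_right linear_wedge_right]]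
    by (simp add: comp_def)
  fix T
  show "wedge (e_basis {v}) (wedge (e_basis {w}) (e_basis T)) =
      - wedge (e_basis {w}) (wedge (e_basis {v}) (e_basis T))"
  proof (cases v w rule: linorder_cases)
    case equal
    then show ?thesis
      by (simp add: wedge_vertex_basis linear_scale[OF linear_wedge_right] linear_0[OF linear_wedge_right])
  next
    case greater
    then show ?thesis using wedge_vertex_swap_basis[of w v T] by simp
  qed (rule wedge_vertex_swap_basis)
qed

text \<open>Wedge products in the order of a list, repetitions allowed, connect forms on lists with
  the exterior algebra: a linear functional composed with \<open>e_word\<close> is
  alternating.\<close>

definition e_word :: "nat list \<Rightarrow> ext" where
  "e_word l = foldr (\<lambda>v. wedge (e_basis {v})) l (e_basis {})"

lemma e_word_simps [simp]:
  "e_word [] = e_basis {}" "e_word (v # l) = wedge (e_basis {v}) (e_word l)"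
  by (simp_all add: e_word_def)

lemma e_word_swap: "e_word (xs @ v # w # ys) = - e_word (xs @ w # v # ys)"
proof (induction xs)
  case Nil
  then show ?case using wedge_vertex_swap[of v w "e_word ys"] by simp
next
  case (Cons x xs)
  then show ?case by (simp add: linear_neg[OF linear_wedge_right])
qed

lemma e_word_sorted: "sorted l \<Longrightarrow> distinct l \<Longrightarrow> e_word l = e_basis (set l)"
proof (induction l)
  case (Cons v l)
  then have e: "{t \<in> set l. t < v} = {}" by auto
  have "wedge (e_basis {v}) (e_basis (set l)) = e_basis (insert v (set l))"
    unfolding wedge_vertex_basis e using Cons.prems(2) by simp
  then show ?case using Cons by simp
qed simp

lemma alternating_e_word:
  assumes "linear g"
  shows "alternating (\<lambda>l. g (e_word l))"
  unfolding alternating_def using e_word_swap linear_neg[OF assms] by metis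

text \<open>Left multiplication by a generic vector is transposed into \<open>contr\<close>. Moving
  the first factor into the functional \<open>g\<close> keeps the induction over \<open>R\<close>
  going.\<close>

lemma foldr_wedge_generic:
  assumes "linear g"
  shows "g (foldr (\<lambda>s. wedge (generic_vector n \<alpha> s)) R (e_word l)) =
    contrs {1..n} \<alpha> R (\<lambda>l. g (e_word l)) l"
  using assms
proof (induction R arbitrary: g)
  case (Cons i R)
  have lin: "linear (\<lambda>z. g (wedge (generic_vector n \<alpha> i) z))"
    using linear_compose[OF linear_wedge_right Cons.prems] by (simp add: comp_def)
  have "contr {1..n} \<alpha> i (\<lambda>l. g (e_word l)) = (\<lambda>l. g (wedge (generic_vector n \<alpha> i) (e_word l)))"
    by (simp add: contr_def generic_vector_def linear_sum[OF linear_wedge_left]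
        linear_scale[OF linear_wedge_left] linear_sum[OF Cons.prems] linear_scale[OF Cons.prems])
  then show ?case using Cons.IH[OF lin] by simp
qed simp

lemma ext_prod_functional:
  assumes "linear g"
  shows "g (ext_prod (generic_vector n \<alpha>) R) = contrs {1..n} \<alpha> (slist R) (\<lambda>l. g (e_word l)) []"
  using foldr_wedge_generic[OF assms, of n \<alpha> "slist R" "[]"] by (simp add: ext_prod_def)

lemma ext_algebra_iff_keys: "x \<in> ext_algebra n \<longleftrightarrow> Poly_Mapping.keys x \<subseteq> Pow {1..n}"
proof
  assume "x \<in> ext_algebra n"
  moreover have "subspace {x :: ext. Poly_Mapping.keys x \<subseteq> Pow {1..n}}"
    unfolding subspace_def using Poly_Mapping.keys_add keys_scaleR_subset by fastforce
  moreover have "e_basis ` Pow {1..n} \<subseteq> {x :: ext. Poly_Mapping.keys x \<subseteq> Pow {1..n}}"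
    by (auto simp: e_basis_def)
  ultimately show "Poly_Mapping.keys x \<subseteq> Pow {1..n}"
    unfolding ext_algebra_def using span_minimal by blast
next
  assume "Poly_Mapping.keys x \<subseteq> Pow {1..n}"
  then have "(\<Sum>T\<in>Poly_Mapping.keys x. Poly_Mapping.lookup x T *\<^sub>R e_basis T) \<in> ext_algebra n"
    unfolding ext_algebra_def by (intro span_sum span_scale span_base) auto
  then show "x \<in> ext_algebra n" using ext_eq_sum_basis[of x] by simp
qed

lemma keys_wedge:
  assumes "U \<in> Poly_Mapping.keys (wedge x y)"
  shows "\<exists>S\<in>Poly_Mapping.keys x. \<exists>T\<in>Poly_Mapping.keys y. U = S \<union> T"
proof -
  have "Poly_Mapping.lookup (wedge x y) U \<noteq> 0" using assms by (simp add: in_keys_iff)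
  then obtain S where S: "S \<in> Poly_Mapping.keys x"
    "Poly_Mapping.lookup (\<Sum>T\<in>Poly_Mapping.keys y.
      (Poly_Mapping.lookup x S * Poly_Mapping.lookup y T) *\<^sub>R e_wedge S T) U \<noteq> 0"
    unfolding wedge_def lookup_sum[of _ "Poly_Mapping.keys x"] by (meson sum.neutral)
  then obtain T where T: "T \<in> Poly_Mapping.keys y"
    "Poly_Mapping.lookup ((Poly_Mapping.lookup x S * Poly_Mapping.lookup y T) *\<^sub>R e_wedge S T) U \<noteq> 0"
    unfolding lookup_sum by (meson sum.neutral)
  then have "U = S \<union> T"
    by (auto simp: e_wedge_def e_basis_def lookup_single when_def split: if_splits)
  then show ?thesis using S(1) T(1) by blast
qed

lemma wedge_in_ext_algebra:
  assumes "x \<in> ext_algebra n" "y \<in> ext_algebra n"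
  shows "wedge x y \<in> ext_algebra n"
  using assms keys_wedge[of _ x y] unfolding ext_algebra_iff_keys by fastforce

lemma e_basis_in_ext_algebra: "T \<subseteq> {1..n} \<Longrightarrow> e_basis T \<in> ext_algebra n"
  unfolding ext_algebra_def by (intro span_base) auto

lemma subspace_ext_algebra: "subspace (ext_algebra n)"
  by (simp add: ext_algebra_def)

lemma ext_prod_in_ext_algebra: "ext_prod (generic_vector n \<alpha>) S \<in> ext_algebra n"
proof -
  have "generic_vector n \<alpha> s \<in> ext_algebra n" for s
    unfolding generic_vector_def
    by (intro subspace_sum subspace_scale subspace_ext_algebra e_basis_in_ext_algebra) auto
  then have "foldr (\<lambda>s. wedge (generic_vector n \<alpha> s)) l (e_basis {}) \<in> ext_algebra n" for l
    by (induction l) (auto intro: wedge_in_ext_algebra e_basis_in_ext_algebra)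
  then show ?thesis by (simp add: ext_prod_def)
qed

lemma e_basis_in_nonface_ideal:
  assumes "T \<subseteq> {1..n}" "T \<notin> K"
  shows "e_basis T \<in> nonface_ideal n K"
proof -
  have "wedge (wedge (e_basis {}) (e_basis T)) (e_basis {}) = e_basis T"
    by (simp add: wedge_e_basis e_wedge_def)
  then show ?thesis
    unfolding nonface_ideal_def using assms e_basis_in_ext_algebra[of "{}" n]
    by (intro span_base) (auto intro!: exI[of _ "e_basis {}"] exI[of _ T])
qed

text \<open>Every basis element occurring in a product with \<open>e_basis T\<close> contains
  \<open>T\<close>, and supersets of non-faces are non-faces; so elements of the ideal are
  combinations of basis elements of non-faces.\<close>

lemma functional_zero_on_nonface_ideal:
  assumes K: "abstract_complex K" and g: "linear g"
    and 0: "\<And>T. T \<subseteq> {1..n} \<Longrightarrow> T \<notin> K \<Longrightarrow> g (e_basis T) = 0"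
    and z: "z \<in> nonface_ideal n K"
  shows "g z = 0"
proof (rule linear_eq_0_on_span[OF g _ z[unfolded nonface_ideal_def]])
  fix b assume "b \<in> {wedge (wedge x (e_basis T)) y |x T y.
    x \<in> ext_algebra n \<and> y \<in> ext_algebra n \<and> T \<subseteq> {1..n} \<and> T \<notin> K}"
  then obtain x T y where b: "b = wedge (wedge x (e_basis T)) y" "x \<in> ext_algebra n"
    "y \<in> ext_algebra n" "T \<subseteq> {1..n}" "T \<notin> K" by blast
  have "b \<in> ext_algebra n"
    unfolding b(1) using b(2-4) by (intro wedge_in_ext_algebra e_basis_in_ext_algebra)
  have "g (e_basis U) = 0" if U: "U \<in> Poly_Mapping.keys b" for U
  proof (rule 0)
    show "U \<subseteq> {1..n}" using \<open>b \<in> ext_algebra n\<close> U unfolding ext_algebra_iff_keys by blast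
    obtain S S' where "S \<in> Poly_Mapping.keys (wedge x (e_basis T))" "U = S \<union> S'"
      using keys_wedge U unfolding b(1) by blast
    moreover then obtain S'' where "S = S'' \<union> T"
      using keys_wedge[of S x "e_basis T"] by (auto simp: e_basis_def)
    ultimately have "T \<subseteq> U" by blast
    then show "U \<notin> K" using abstract_complexD(4)[OF K] b(5) by blast
  qed
  then have "g (\<Sum>T\<in>Poly_Mapping.keys b. Poly_Mapping.lookup b T *\<^sub>R e_basis T) = 0"
    by (simp add: linear_sum[OF g] linear_scale[OF g])
  then show "g b = 0" using ext_eq_sum_basis[of b] by simp
qed

section \<open>Duality between cosets and linear functionals\<close>

lemma quotient_image_eq_iff:
  assumes "x \<in> ext_algebra n"
  shows "quotient_image n K x = quotient_image n K y \<longleftrightarrow> x - y \<in> nonface_ideal n K"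
proof
  have I: "subspace (nonface_ideal n K)" by (simp add: nonface_ideal_def)
  assume "quotient_image n K x = quotient_image n K y"
  moreover have "x \<in> quotient_image n K x"
    using assms subspace_0[OF I] by (simp add: quotient_image_def)
  ultimately show "x - y \<in> nonface_ideal n K" by (simp add: quotient_image_def)
next
  have I: "subspace (nonface_ideal n K)" by (simp add: nonface_ideal_def)
  assume xy: "x - y \<in> nonface_ideal n K"
  have "z - x \<in> nonface_ideal n K \<longleftrightarrow> z - y \<in> nonface_ideal n K" for z
    using subspace_add[OF I, of "z - x" "x - y"] subspace_diff[OF I, of "z - y" "x - y"] xy by auto
  then show "quotient_image n K x = quotient_image n K y" by (simp add: quotient_image_def)
qed

text \<open>A basis of the span together with \<open>z\<close> is independent, so a functional may
  be prescribed on it.\<close>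

lemma separating_functional:
  fixes z :: "'v::real_vector"
  assumes "z \<notin> span A"
  shows "\<exists>g :: 'v \<Rightarrow> real. linear g \<and> (\<forall>a\<in>A. g a = 0) \<and> g z \<noteq> 0"
proof -
  obtain B where B: "B \<subseteq> A" "independent B" "A \<subseteq> span B"
    using maximal_independent_subset by blast
  have zB: "z \<notin> span B" using assms B(1) span_mono by blast
  then have "independent (insert z B)" using B(2) by (simp add: independent_insert)
  then obtain g :: "'v \<Rightarrow> real" where g: "linear g" "\<forall>b\<in>insert z B. g b = of_bool (b = z)"
    using linear_independent_extend[of "insert z B" "\<lambda>b. of_bool (b = z) :: real"] by blast
  have "g b = 0" if "b \<in> B" for b using g(2) that zB span_base by fastforce
  then have "g a = 0" if "a \<in> A" for a
    using linear_eq_0_on_span[OF g(1)] B(3) that by blast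
  then show ?thesis using g by auto
qed

text \<open>A coset lies outside the span of other cosets iff the element lies outside the span of
  their representatives and the ideal; a functional then separates it from that span.\<close>

lemma in_shifting_wrt_iff:
  fixes \<alpha> :: "nat \<times> nat \<Rightarrow> real"
  assumes S: "S \<subseteq> {1..n}"
  defines "A \<equiv> {ext_prod (generic_vector n \<alpha>) R | R. R \<subseteq> {1..n} \<and> card R = card S \<and> lex_less R S}"
  shows "S \<in> shifting_wrt n \<alpha> K \<longleftrightarrow> (\<exists>g :: ext \<Rightarrow> real. linear g \<and> (\<forall>a\<in>A. g a = 0) \<and>
    (\<forall>a\<in>nonface_ideal n K. g a = 0) \<and> g (ext_prod (generic_vector n \<alpha>) S) \<noteq> 0)" (is "_ \<longleftrightarrow> ?G")
proof -
  let ?z = "ext_prod (generic_vector n \<alpha>) S" and ?I = "nonface_ideal n K"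
  have "S \<in> shifting_wrt n \<alpha> K \<longleftrightarrow> quotient_image n K ?z \<notin> quotient_image n K ` span A"
    unfolding shifting_wrt_def A_def using S by blast
  also have "\<dots> \<longleftrightarrow> (\<forall>w\<in>span A. ?z - w \<notin> ?I)"
    using quotient_image_eq_iff[OF ext_prod_in_ext_algebra[of n \<alpha> S], of K] by (auto simp: image_iff)
  also have "\<dots> \<longleftrightarrow> ?z \<notin> span (A \<union> ?I)"
  proof -
    have I: "span ?I = ?I" by (simp add: nonface_ideal_def span_span)
    have "?z \<in> span (A \<union> ?I) \<longleftrightarrow> (\<exists>w\<in>span A. \<exists>i\<in>?I. ?z = w + i)"
      unfolding span_Un I by auto
    also have "\<dots> \<longleftrightarrow> (\<exists>w\<in>span A. ?z - w \<in> ?I)"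
      by (metis add_diff_cancel_left' diff_add_cancel add.commute)
    finally show ?thesis by blast
  qed
  also have "\<dots> \<longleftrightarrow> ?G"
  proof
    assume "?z \<notin> span (A \<union> ?I)"
    from separating_functional[OF this] show ?G by blast
  next
    assume ?G
    then obtain g :: "ext \<Rightarrow> real" where g: "linear g" "\<forall>a\<in>A \<union> ?I. g a = 0" "g ?z \<noteq> 0" by blast
    then show "?z \<notin> span (A \<union> ?I)" using linear_eq_0_on_span[OF g(1)] by blast
  qed
  finally show ?thesis .
qed

lemma contrs_form_cong:
  assumes "\<And>m. length m = length R \<Longrightarrow> set m \<subseteq> V \<Longrightarrow> x (m @ l) = y (m @ l)"
  shows "contrs V a R x l = contrs V a R y l"
proof (rule ccontr)
  assume "contrs V a R x l \<noteq> contrs V a R y l"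
  then have "contrs V a R (\<lambda>l. 1 * x l + (- 1) * y l) l \<noteq> 0"
    unfolding contrs_lin by simp
  from contrs_support[OF this] show False using assms by auto
qed

text \<open>Functionals that vanish on the ideal yield forms on \<open>K\<close> by composition with
  \<open>e_word\<close>; conversely a form yields a functional by summing coordinates weighted with
  its values on sorted lists.\<close>

theorem shifting_wrt_eq_leads:
  assumes K: "abstract_complex K" and Kn: "\<And>S. S \<in> K \<Longrightarrow> S \<subseteq> {1..n}"
  shows "shifting_wrt n \<alpha> K = leads n {1..n} K \<alpha>"
proof -
  let ?f = "generic_vector n \<alpha>" and ?V = "{1..n}"
  have "S \<in> shifting_wrt n \<alpha> K \<longleftrightarrow> S \<in> leads n ?V K \<alpha>" if S: "S \<subseteq> ?V" for S
  proof
    assume "S \<in> shifting_wrt n \<alpha> K"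
    then obtain g :: "ext \<Rightarrow> real" where g: "linear g" "g (ext_prod ?f S) \<noteq> 0"
      "\<And>R. R \<subseteq> {1..n} \<Longrightarrow> card R = card S \<Longrightarrow> lex_less R S \<Longrightarrow> g (ext_prod ?f R) = 0"
      "\<And>a. a \<in> nonface_ideal n K \<Longrightarrow> g a = 0"
      unfolding in_shifting_wrt_iff[OF S] by blast
    \<comment> \<open>Cutting down to lists of length \<open>card S\<close> makes the functional
      homogeneous; no product of \<open>card S\<close> rows notices the difference.\<close>
    define x where "x l = (if length l = card S \<and> set l \<subseteq> ?V then g (e_word l) else 0)" for l
    note alt = alternating_e_word[OF g(1)]
    have "x \<in> forms K (card S)"
      unfolding forms_def
    proof (intro CollectI conjI allI impI)
      show "alternating x"
        unfolding x_def[abs_def] by (rule alternating_if[OF alt]) (simp add: insert_commute)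
      fix l assume "x l \<noteq> 0"
      then have l: "length l = card S" "set l \<subseteq> ?V" "g (e_word l) \<noteq> 0"
        by (auto simp: x_def split: if_splits)
      show "length l = card S" by (rule l(1))
      have "distinct l" by (rule alternating_distinct[OF alt l(3)])
      then have "g (e_word (slist (set l))) \<noteq> 0"
        using alternating_set_eq_0_iff[OF alt, of l "slist (set l)"] l(3) by simp
      then have "g (e_basis (set l)) \<noteq> 0" by (simp add: e_word_sorted)
      then show "set l \<in> K" using g(4) e_basis_in_nonface_ideal[OF l(2)] by blast
    qed
    moreover have x_eq: "contrs ?V \<alpha> (slist R) x [] = g (ext_prod ?f R)"
      if "R \<subseteq> ?V" "card R = card S" for R
      unfolding ext_prod_functional[OF g(1)]
      by (rule contrs_form_cong) (use that in \<open>auto simp: x_def\<close>)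
    ultimately show "S \<in> leads n ?V K \<alpha>"
      by (intro leadsI[OF S]) (use S g(2,3) x_eq in auto)
  next
    assume "S \<in> leads n ?V K \<alpha>"
    then obtain x where x: "x \<in> forms K (card S)"
      "\<And>R. R \<subseteq> {1..n} \<Longrightarrow> card R = card S \<Longrightarrow> lex_less R S \<Longrightarrow> contrs ?V \<alpha> (slist R) x [] = 0"
      "contrs ?V \<alpha> (slist S) x [] \<noteq> 0"
      unfolding leads_def by blast
    define g :: "ext \<Rightarrow> real"
      where "g z = (\<Sum>T\<in>Pow ?V. Poly_Mapping.lookup z T * x (slist T))" for z
    have lin: "linear g"
      by (rule linearI) (simp_all add: g_def lookup_add algebra_simps sum.distrib sum_distrib_left)
    have basis: "g (e_basis T) = x (slist T)" if "T \<subseteq> ?V" for T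
    proof -
      have "g (e_basis T) = (\<Sum>U\<in>Pow ?V. if U = T then x (slist T) else 0)"
        unfolding g_def by (rule sum.cong) (auto simp: e_basis_def lookup_single when_def)
      then show ?thesis using that by simp
    qed
    have x_K: "x l = 0" if "set l \<notin> K" for l using formsD(3)[OF x(1)] that by blast
    have "g (e_word l) = x l" if "set l \<subseteq> ?V" for l
    proof (rule alternating_eq_if_eq_on_sorted[OF alternating_e_word[OF lin] formsD(1)[OF x(1)] _ that])
      fix l assume l: "sorted l" "distinct l" "set l \<subseteq> ?V"
      then have "slist (set l) = l" by (simp add: sorted_list_of_set.idem_if_sorted_distinct)
      then show "g (e_word l) = x l" using e_word_sorted[OF l(1,2)] basis[OF l(3)] by simp
    qed
    then have g_x: "g (ext_prod ?f R) = contrs ?V \<alpha> (slist R) x []" for R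
      unfolding ext_prod_functional[OF lin] by (intro contrs_form_cong) simp
    have "g a = 0" if "a \<in> nonface_ideal n K" for a
      by (rule functional_zero_on_nonface_ideal[OF K lin _ that])
        (use basis x_K set_slist_subset in auto)
    then show "S \<in> shifting_wrt n \<alpha> K"
      unfolding in_shifting_wrt_iff[OF S] using lin g_x x(2,3) by auto
  qed
  then have "S \<in> shifting_wrt n \<alpha> K \<longleftrightarrow> S \<in> leads n ?V K \<alpha>" for S
    by (cases "S \<subseteq> ?V") (simp_all add: shifting_wrt_def leads_def)
  then show ?thesis by blast
qed

section \<open>Relabelling\<close>

lemma relabel_relabel: "relabel \<phi> (relabel \<psi> K) = relabel (\<phi> \<circ> \<psi>) K"
  by (simp add: relabel_def image_image)

lemma abstract_complex_relabel:
  assumes "abstract_complex K"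
  shows "abstract_complex (relabel \<phi> K)"
  unfolding abstract_complex_def
proof (intro conjI ballI allI impI)
  show "finite (relabel \<phi> K)" using abstract_complexD(1)[OF assms] by (simp add: relabel_def)
  show "{} \<in> relabel \<phi> K"
    using abstract_complexD(2)[OF assms] unfolding relabel_def by (metis image_empty image_eqI)
  fix S assume "S \<in> relabel \<phi> K"
  then obtain S' where S': "S' \<in> K" "S = \<phi> ` S'" by (auto simp: relabel_def)
  show "finite S" using abstract_complexD(3)[OF assms S'(1)] S'(2) by simp
  fix T assume "T \<subseteq> S"
  then obtain T' where "T' \<subseteq> S'" "T = \<phi> ` T'" unfolding S'(2) by (meson subset_image_iff)
  then show "T \<in> relabel \<phi> K"
    using abstract_complexD(4)[OF assms S'(1)] by (auto simp: relabel_def)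
qed

lemma vertex_set_relabel:
  assumes "abstract_complex K"
  shows "vertex_set (relabel \<phi> K) = \<phi> ` vertex_set K"
proof
  show "vertex_set (relabel \<phi> K) \<subseteq> \<phi> ` vertex_set K"
  proof
    fix w assume "w \<in> vertex_set (relabel \<phi> K)"
    then obtain S where S: "S \<in> K" "\<phi> ` S = {w}" by (auto simp: vertex_set_def relabel_def)
    then obtain v where "v \<in> S" "\<phi> v = w" by blast
    then show "w \<in> \<phi> ` vertex_set K" using abstract_complexD(6)[OF assms S(1)] by blast
  qed
  show "\<phi> ` vertex_set K \<subseteq> vertex_set (relabel \<phi> K)"
    unfolding vertex_set_def relabel_def by (auto intro!: image_eqI[where x = "{_}"])
qed

lemma contrs_relabel:
  assumes "inj_on \<phi> V" "\<And>l. set l \<subseteq> V \<Longrightarrow> x' (map \<phi> l) = x l" "set l \<subseteq> V"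
  shows "contrs (\<phi> ` V) a R x' (map \<phi> l) = contrs V (\<lambda>(i, v). a (i, \<phi> v)) R x l"
  using assms(2,3)
proof (induction R arbitrary: x x' l)
  case (Cons i R)
  have step: "contr (\<phi> ` V) a i x' (map \<phi> l) = contr V (\<lambda>(i, v). a (i, \<phi> v)) i x l" if "set l \<subseteq> V" for l
  proof -
    have "contr (\<phi> ` V) a i x' (map \<phi> l) = (\<Sum>v\<in>V. a (i, \<phi> v) * x' (map \<phi> (v # l)))"
      by (simp add: contr_def sum.reindex[OF assms(1)])
    also have "\<dots> = (\<Sum>v\<in>V. a (i, \<phi> v) * x (v # l))"
      using that by (intro sum.cong refl) (subst Cons.prems(1), auto)
    finally show ?thesis by (simp add: contr_def)
  qed
  have "contrs (\<phi> ` V) a R (contr (\<phi> ` V) a i x') (map \<phi> l) =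
      contrs V (\<lambda>(i, v). a (i, \<phi> v)) R (contr V (\<lambda>(i, v). a (i, \<phi> v)) i x) l"
    by (rule Cons.IH[OF _ Cons.prems(2)]) (rule step)
  then show ?case by simp
qed simp

lemma leads_relabel_subset:
  assumes inj: "inj_on \<phi> V" and K: "\<And>S. S \<in> K \<Longrightarrow> S \<subseteq> V"
  shows "leads n (\<phi> ` V) (relabel \<phi> K) a \<subseteq> leads n V K (\<lambda>(i, v). a (i, \<phi> v))"
proof
  fix S assume S: "S \<in> leads n (\<phi> ` V) (relabel \<phi> K) a"
  then obtain x' where x': "x' \<in> forms (relabel \<phi> K) (card S)"
    "\<And>R. R \<subseteq> {1..n} \<Longrightarrow> card R = card S \<Longrightarrow> lex_less R S \<Longrightarrow> contrs (\<phi> ` V) a (slist R) x' [] = 0"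
    "contrs (\<phi> ` V) a (slist S) x' [] \<noteq> 0"
    unfolding leads_def by blast
  define x where "x l = (if set l \<subseteq> V then x' (map \<phi> l) else 0)" for l
  have "x \<in> forms K (card S)"
    unfolding forms_def
  proof (intro CollectI conjI allI impI)
    have "alternating (\<lambda>l. x' (map \<phi> l))"
      unfolding alternating_def map_append list.map
      by (intro allI alternatingD[OF formsD(1)[OF x'(1)]])
    then show "alternating x"
      unfolding x_def[abs_def] by (rule alternating_if) (simp add: insert_commute)
    fix l assume "x l \<noteq> 0"
    then have l: "set l \<subseteq> V" "x' (map \<phi> l) \<noteq> 0" by (auto simp: x_def split: if_splits)
    show "length l = card S" using formsD(2)[OF x'(1) l(2)] by simp
    obtain T where T: "T \<in> K" "\<phi> ` set l = \<phi> ` T"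
      using formsD(3)[OF x'(1) l(2)] by (auto simp: relabel_def)
    then have "set l = T" using inj_on_image_eq_iff[OF inj l(1) K] by blast
    then show "set l \<in> K" using T(1) by simp
  qed
  moreover have "contrs (\<phi> ` V) a R x' [] = contrs V (\<lambda>(i, v). a (i, \<phi> v)) R x []" for R
    using contrs_relabel[OF inj, of x' x "[]" a R] by (simp add: x_def)
  ultimately show "S \<in> leads n V K (\<lambda>(i, v). a (i, \<phi> v))"
    by (intro leadsI[OF leads_subset[OF S]]) (use x'(2,3) in auto)
qed

lemma leads_matrix_cong:
  assumes "\<And>i v. v \<in> V \<Longrightarrow> a (i, v) = b (i, v)"
  shows "leads n V K a = leads n V K b"
proof -
  have "contrs V a R x = contrs V b R x" for R x by (rule contrs_cong) (rule assms)
  then show ?thesis by (simp add: leads_def)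
qed

lemma leads_relabel:
  assumes inj: "inj_on \<phi> V" and K: "\<And>S. S \<in> K \<Longrightarrow> S \<subseteq> V"
  shows "leads n (\<phi> ` V) (relabel \<phi> K) a = leads n V K (\<lambda>(i, v). a (i, \<phi> v))"
proof
  show "leads n (\<phi> ` V) (relabel \<phi> K) a \<subseteq> leads n V K (\<lambda>(i, v). a (i, \<phi> v))"
    by (rule leads_relabel_subset[OF assms])
  \<comment> \<open>The reverse inclusion is \<open>leads_relabel_subset\<close> for the inverse
    labelling.\<close>
  let ?\<psi> = "inv_into V \<phi>"
  have \<psi>: "?\<psi> ` \<phi> ` S = S" if "S \<subseteq> V" for S using inj that by (rule inv_into_image_cancel)
  have "relabel ?\<psi> (relabel \<phi> K) = K"
    unfolding relabel_def image_image using K \<psi> by (force simp: image_image)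
  moreover have "leads n (?\<psi> ` \<phi> ` V) (relabel ?\<psi> (relabel \<phi> K)) (\<lambda>(i, v). a (i, \<phi> v))
      \<subseteq> leads n (\<phi> ` V) (relabel \<phi> K) (\<lambda>(i, w). (\<lambda>(i, v). a (i, \<phi> v)) (i, ?\<psi> w))"
  proof (rule leads_relabel_subset)
    show "inj_on ?\<psi> (\<phi> ` V)" by (rule inj_on_inv_into) simp
    show "S \<subseteq> \<phi> ` V" if "S \<in> relabel \<phi> K" for S using that K by (auto simp: relabel_def)
  qed
  moreover have "leads n (\<phi> ` V) (relabel \<phi> K) (\<lambda>(i, w). (\<lambda>(i, v). a (i, \<phi> v)) (i, ?\<psi> w))
      = leads n (\<phi> ` V) (relabel \<phi> K) a"
    by (rule leads_matrix_cong) (auto simp: inv_into_f_f[OF inj])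
  ultimately show "leads n V K (\<lambda>(i, v). a (i, \<phi> v)) \<subseteq> leads n (\<phi> ` V) (relabel \<phi> K) a"
    using \<psi>[of V] by simp
qed

section \<open>The shifting of a complex\<close>

text \<open>Removes every choice made by \<open>is_shifting\<close>: the labelling is pulled back to
  the vertices, and generic matrices with different numbers of rows are compared after restriction
  to \<open>card (vertex_set K)\<close> rows.\<close>

lemma is_shifting_imp_leads:
  assumes K: "abstract_complex K" and D: "is_shifting K D"
    and n: "card (vertex_set K) \<le> n" and gen: "generic ({1..n} \<times> vertex_set K) a"
  shows "D = leads n (vertex_set K) K a"
proof -
  let ?V = "vertex_set K"
  note V = abstract_complexD(5,6)[OF K]
  obtain m \<phi> \<alpha> where \<phi>: "inj_on \<phi> ?V" "\<phi> ` ?V \<subseteq> {1..m}"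
    and \<alpha>: "algebraically_independent ({1..m} \<times> {1..m}) \<alpha>"
    and D_eq: "D = shifting_wrt m \<alpha> (relabel \<phi> K)"
    using D unfolding is_shifting_def by blast
  let ?b = "\<lambda>(i, v). \<alpha> (i, \<phi> v)"
  have rel: "S \<subseteq> \<phi> ` ?V" if "S \<in> relabel \<phi> K" for S
    using that V(2) by (auto simp: relabel_def)
  have "D = leads m {1..m} (relabel \<phi> K) \<alpha>"
    unfolding D_eq
    by (rule shifting_wrt_eq_leads[OF abstract_complex_relabel[OF K]]) (use rel \<phi>(2) in blast)
  also have "\<dots> = leads m (\<phi> ` ?V) (relabel \<phi> K) \<alpha>"
    by (rule leads_column_cong[OF rel \<phi>(2)]) simp_all
  also have "\<dots> = leads m ?V K ?b"
    by (rule leads_relabel[OF \<phi>(1) V(2)])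
  finally have D_b: "D = leads m ?V K ?b" .
  have "generic ({1..m} \<times> ?V) (\<alpha> \<circ> map_prod id \<phi>)"
  proof (rule generic_reindex[OF algebraically_independent_imp_generic[OF \<alpha>]])
    show "inj_on (map_prod id \<phi>) ({1..m} \<times> ?V)"
      by (rule map_prod_inj_on[OF inj_on_id \<phi>(1)])
    show "map_prod id \<phi> ` ({1..m} \<times> ?V) \<subseteq> {1..m} \<times> {1..m}" using \<phi>(2) by auto
  qed
  moreover have "\<alpha> \<circ> map_prod id \<phi> = ?b" by auto
  ultimately have b: "generic ({1..m} \<times> ?V) ?b" by simp
  have m: "card ?V \<le> m" using card_inj_on_le[OF \<phi>] by simp
  let ?c = "card ?V"
  have bc: "generic ({1..?c} \<times> ?V) ?b" by (rule generic_mono[OF b]) (use m in auto)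
  have ac: "generic ({1..?c} \<times> ?V) a" by (rule generic_mono[OF gen]) (use n in auto)
  have "leads m ?V K ?b = leads ?c ?V K ?b"
    by (rule leads_row_bound_indep[OF K V order_refl m b, symmetric])
  also have "\<dots> = leads ?c ?V K a" by (rule leads_generic_cong[OF V bc ac])
  also have "\<dots> = leads n ?V K a" by (rule leads_row_bound_indep[OF K V order_refl n gen])
  finally show ?thesis using D_b by simp
qed

lemma generic_exists:
  assumes "finite V"
  shows "\<exists>a. generic ({1..n::nat} \<times> V) a"
  using algebraically_independent_exists[of "{1..n} \<times> V"] algebraically_independent_imp_generic assms
  by blast

lemma is_shifting_algebraic_shifting:
  assumes K: "abstract_complex K"
  shows "is_shifting K (\<Delta> K)"
proof -
  let ?V = "vertex_set K" and ?n = "card (vertex_set K)"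
  have "finite ?V" by (rule abstract_complexD(5)[OF K])
  then obtain \<phi> where "bij_betw \<phi> ?V {1..?n}"
    using finite_same_card_bij[of ?V "{1..?n}"] by auto
  then have \<phi>: "inj_on \<phi> ?V" "\<phi> ` ?V \<subseteq> {1..?n}" by (auto simp: bij_betw_def)
  obtain \<alpha> :: "nat \<times> nat \<Rightarrow> real" where "algebraically_independent ({1..?n} \<times> {1..?n}) \<alpha>"
    using algebraically_independent_exists[of "{1..?n} \<times> {1..?n}"] by auto
  with \<phi> have "\<exists>D. is_shifting K D" unfolding is_shifting_def by blast
  then show ?thesis unfolding algebraic_shifting_def by (rule someI_ex)
qed

text \<open>Here \<open>V\<close> may exceed the vertex set, so that two complexes and their union
  can be treated with the same columns.\<close>

lemma algebraic_shifting_eq_leads: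
  assumes K: "abstract_complex K" and V: "finite V" "vertex_set K \<subseteq> V"
    and n: "card V \<le> n" and gen: "generic ({1..n} \<times> V) a"
  shows "\<Delta> K = leads n V K a"
proof -
  have "\<Delta> K = leads n (vertex_set K) K a"
  proof (rule is_shifting_imp_leads[OF K is_shifting_algebraic_shifting[OF K]])
    show "card (vertex_set K) \<le> n" using card_mono[OF V] n by simp
    show "generic ({1..n} \<times> vertex_set K) a" by (rule generic_mono[OF gen]) (use V in auto)
  qed
  also have "\<dots> = leads n V K a"
    by (rule leads_column_cong[OF abstract_complexD(6)[OF K] V(2,1), symmetric])
  finally show ?thesis .
qed

lemma algebraic_shifting_properties:
  assumes K: "abstract_complex K"
  shows "abstract_complex (\<Delta> K)" "shift_closed (\<Delta> K)"
    "S \<in> \<Delta> K \<Longrightarrow> S \<subseteq> {1..card (vertex_set K)}"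
proof -
  let ?V = "vertex_set K"
  note V = abstract_complexD(5,6)[OF K]
  obtain a where a: "generic ({1..card ?V} \<times> ?V) a" using generic_exists[OF V(1)] by blast
  have eq: "\<Delta> K = leads (card ?V) ?V K a"
    by (rule algebraic_shifting_eq_leads[OF K V(1) _ _ a]) simp_all
  show "abstract_complex (\<Delta> K)" unfolding eq by (rule abstract_complex_leads[OF K])
  show "shift_closed (\<Delta> K)" unfolding eq by (rule shift_closed_leads[OF V a])
  show "S \<in> \<Delta> K \<Longrightarrow> S \<subseteq> {1..card ?V}" unfolding eq by (rule leads_subset)
qed

lemma algebraic_shifting_pos: "abstract_complex K \<Longrightarrow> S \<in> \<Delta> K \<Longrightarrow> 0 \<notin> S"
  using algebraic_shifting_properties(3)[of K S] by auto

lemma algebraic_shifting_shifted: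
  assumes D: "abstract_complex D" "shift_closed D" and Dn: "\<And>S. S \<in> D \<Longrightarrow> S \<subseteq> {1..n}"
  shows "\<Delta> D = D"
proof -
  obtain a where a: "generic ({1..n} \<times> {1..n}) a" using generic_exists[of "{1..n}" n] by auto
  have "vertex_set D \<subseteq> {1..n}" using Dn by (auto simp: vertex_set_def)
  then have "\<Delta> D = leads n {1..n} D a"
    by (intro algebraic_shifting_eq_leads[OF D(1) _ _ _ a]) simp_all
  also have "\<dots> = D"
    using shifted_subset_leads[OF a D(2) Dn] leads_subset_shifted[OF a D(2) Dn] by (rule equalityI[rotated])
  finally show ?thesis .
qed

text \<open>A labelling of the relabelled complex composed with \<open>\<psi>\<close> is a labelling
  of \<open>K\<close>; uniqueness of the shifting does the rest.\<close>

lemma algebraic_shifting_relabel: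
  assumes K: "abstract_complex K" and \<psi>: "inj_on \<psi> (vertex_set K)"
  shows "\<Delta> (relabel \<psi> K) = \<Delta> K"
proof -
  obtain n \<phi> \<alpha> where "inj_on \<phi> (vertex_set (relabel \<psi> K))" "\<phi> ` vertex_set (relabel \<psi> K) \<subseteq> {1..n}"
    "algebraically_independent ({1..n} \<times> {1..n}) \<alpha>"
    "\<Delta> (relabel \<psi> K) = shifting_wrt n \<alpha> (relabel \<phi> (relabel \<psi> K))"
    using is_shifting_algebraic_shifting[OF abstract_complex_relabel[OF K, of \<psi>]]
    unfolding is_shifting_def by blast
  then have "is_shifting K (\<Delta> (relabel \<psi> K))"
    unfolding is_shifting_def vertex_set_relabel[OF K] relabel_relabel
    using comp_inj_on[OF \<psi>, of \<phi>]
    by (intro exI[of _ n] exI[of _ "\<phi> \<circ> \<psi>"] exI[of _ \<alpha>]) (simp add: image_comp)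
  moreover obtain a where "generic ({1..card (vertex_set K)} \<times> vertex_set K) a"
    using generic_exists[OF abstract_complexD(5)[OF K]] by blast
  ultimately show ?thesis
    using is_shifting_imp_leads[OF K _ order_refl] is_shifting_algebraic_shifting[OF K] by metis
qed

theorem algebraic_shifting_Un:
  assumes K: "abstract_complex K" and L: "abstract_complex L"
    and disj: "vertex_set K \<inter> vertex_set L = {}"
    and P: "finite P" "0 \<notin> P" and r: "Max (insert 0 P) < r"
  shows "insert r P \<in> \<Delta> (K \<union> L) \<longleftrightarrow> r \<le> Max (insert 0 P) +
    card {r. Max (insert 0 P) < r \<and> insert r P \<in> \<Delta> K} +
    card {r. Max (insert 0 P) < r \<and> insert r P \<in> \<Delta> L}"
proof -
  define V where "V = vertex_set K \<union> vertex_set L"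
  \<comment> \<open>At least \<open>card V\<close> rows are needed for injectivity, and the rows
    have to include \<open>P\<close>.\<close>
  define n where "n = max (card V) (Max (insert 0 P))"
  have V: "finite V" using abstract_complexD(5)[OF K] abstract_complexD(5)[OF L] by (simp add: V_def)
  have n: "card V \<le> n" by (simp add: n_def)
  have "s \<le> Max (insert 0 P)" if "s \<in> P" for s using that P(1) by simp
  then have Pn: "P \<subseteq> {1..n}" using P(2) unfolding n_def by (fastforce simp: Suc_le_eq intro: gr0I)
  obtain a where a: "generic ({1..n} \<times> V) a" using generic_exists[OF V] by blast
  have KL: "abstract_complex (K \<union> L)" by (rule abstract_complex_Un[OF K L])
  have "vertex_set (K \<union> L) \<subseteq> V" by (auto simp: V_def vertex_set_def)
  then have "\<Delta> (K \<union> L) = leads n V (K \<union> L) a"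
    by (rule algebraic_shifting_eq_leads[OF KL V _ n a])
  moreover have "\<Delta> K = leads n V K a"
    by (rule algebraic_shifting_eq_leads[OF K V _ n a]) (simp add: V_def)
  moreover have "\<Delta> L = leads n V L a"
    by (rule algebraic_shifting_eq_leads[OF L V _ n a]) (simp add: V_def)
  moreover have "vertex_set K \<union> vertex_set L \<subseteq> V" by (simp add: V_def)
  ultimately show ?thesis
    using leads_Un[OF K L disj V _ a n Pn r] by simp
qed

theorem corollary4p3:
  fixes K L :: "'a set set"
  assumes "abstract_complex K" and "abstract_complex L"
    and "vertex_set K \<inter> vertex_set L = {}"
  shows "\<Delta> (K \<union> L) = \<Delta> (\<Delta> K \<uplus> \<Delta> L)"
proof -
  have idem: "\<Delta> (\<Delta> M) = \<Delta> M" if "abstract_complex M" for M :: "'a set set"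
    using algebraic_shifting_properties[OF that] by (rule algebraic_shifting_shifted)
  have D: "abstract_complex (\<Delta> K)" and E: "abstract_complex (\<Delta> L)"
    using algebraic_shifting_properties(1) assms(1,2) by blast+
  \<comment> \<open>Copies of the two shiftings with disjoint vertex sets; by idempotence they have
    the same shiftings as \<open>K\<close> and \<open>L\<close>.\<close>
  define D E :: "(nat + nat) set set" where "D = relabel Inl (\<Delta> K)" and "E = relabel Inr (\<Delta> L)"
  have D': "abstract_complex D" "\<Delta> D = \<Delta> K"
    unfolding D_def using algebraic_shifting_relabel[OF D, of Inl] idem[OF assms(1)]
    by (simp_all add: abstract_complex_relabel[OF D])
  have E': "abstract_complex E" "\<Delta> E = \<Delta> L"
    unfolding E_def using algebraic_shifting_relabel[OF E, of Inr] idem[OF assms(2)]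
    by (simp_all add: abstract_complex_relabel[OF E])
  have DE: "vertex_set D \<inter> vertex_set E = {}"
    unfolding D_def E_def vertex_set_relabel[OF D] vertex_set_relabel[OF E] by auto
  note Un = abstract_complex_Un[OF assms(1,2)] abstract_complex_Un[OF D'(1) E'(1)]
  \<comment> \<open>Both sides contain the empty set and satisfy the same extension rule with the
    same counts, so they agree by induction on the size of the faces.\<close>
  have "\<Delta> (K \<union> L) = \<Delta> (D \<union> E)"
  proof (rule complexes_eqI)
    fix P r assume P: "P \<in> \<Delta> (K \<union> L)" and r: "Max (insert 0 P) < r"
    have "finite P" "0 \<notin> P"
      using abstract_complexD(3)[OF algebraic_shifting_properties(1)[OF Un(1)] P] algebraic_shifting_pos[OF Un(1) P]
      by auto
    then show "insert r P \<in> \<Delta> (K \<union> L) \<longleftrightarrow> insert r P \<in> \<Delta> (D \<union> E)"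
      using algebraic_shifting_Un[OF assms _ _ r] algebraic_shifting_Un[OF D'(1) E'(1) DE _ _ r]
      unfolding D'(2) E'(2) by blast
  qed (use algebraic_shifting_properties(1) Un algebraic_shifting_pos in blast)+
  then show ?thesis by (simp add: disjoint_union_def D_def E_def)
qed

end
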